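(* Let $l\in\mathbb{Z}_{\ge 0}$ and let $$T_2^l=z_1^l\,\frac{\partial^l}{\partial z_2^l}\,\delta(z_2,\overline{z_2})=\Bigl(z_1\frac{\partial}{\partial z_2}\Bigr)^l\delta(z_2,\overline{z_2}),$$ a distribution on $X_{\mathbb{R}}$. Then, with the notation of the context, $$T_2^l\in\{u\in\mathcal{B}_{X_{\mathbb{R}}}\mid Pu=0 \text{ for all } P\in\mathcal{I}_{1l}\}\simeq\mathrm{Hom}_{\mathcal{D}}(\mathcal{M}_{1l},\mathcal{B}_{X_{\mathbb{R}}}).$$ In particular, $T_2^l$ is relatively invariant under $\mathfrak{h}_1$ with the character $\chi_l$ (that is, $(\rho(A)-\chi_l(A))T_2^l=0$ for all $A\in\mathfrak{h}_1$), and is relatively invariant under $\mathfrak{h}_3$ with the character $\chi$ (that is, $(\rho(A)-\chi(A))T_2^l=0$ for all $A\in\mathfrak{h}_3$).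
   Context: Let $X=\mathbb{C}^4$ with coordinates $(z_1,z_2,z_3,z_4)$, and let $\mathcal{D}=\mathbb{C}[z_1,\dots,z_4,\frac{\partial}{\partial z_1},\dots,\frac{\partial}{\partial z_4}]$ be the ring of differential operators with polynomial coefficients. Real form: $X_{\mathbb{R}}=\{(z_1,z_2,\overline{z_1},\overline{z_2}) \mid z_1,z_2\in\mathbb{C}\}\simeq\mathbb{R}^4$. $\mathcal{B}_{X_{\mathbb{R}}}$ denotes the space of hyperfunctions on $X_{\mathbb{R}}$ (it contains the distributions). The ring $\mathcal{D}$ acts on it by restricting to $X_{\mathbb{R}}$: $z_3,z_4$ act as multiplication by $\overline{z_1},\overline{z_2}$, and $\frac{\partial}{\partial z_1},\frac{\partial}{\partial z_2},\frac{\partial}{\partial z_3},\frac{\partial}{\partial z_4}$ act as the Wirtinger derivatives $\frac{\partial}{\partial z_1},\frac{\partial}{\partial z_2},\frac{\partial}{\partial \overline{z_1}},\frac{\partial}{\partial \overline{z_2}}$. The symbol $\delta(z_2,\overline{z_2})$ denotes the Dirac distribution $\frac{1}{-2\sqrt{-1}}\,\delta(\mathrm{Re}\,z_2,\mathrm{Im}\,z_2)$ in the variable $z_2$, regarded as a distribution on $\mathbb{R}^4$ (constant in $z_1$). For $l\in\mathbb{Z}_{\ge 0}$, $\mathcal{I}_{1l}$ is the left ideal of $\mathcal{D}$ generated by $$z_1\tfrac{\partial}{\partial z_1}-l,\quad \tfrac{\partial^{l+1}}{\partial z_1^{l+1}},\quad z_2\tfrac{\partial}{\partial z_2}+l+1,\quad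 z_2^{l+1},\quad \tfrac{\partial}{\partial z_3},\quad z_4,$$ and $\mathcal{M}_{1l}=\mathcal{D}/\mathcal{I}_{1l}$. Lie algebras: let $E_{ij}$ be the matrix units of $\mathfrak{gl}(4,\mathbb{C})$. Put $\mathfrak{h}_1=\mathfrak{a}\oplus\mathfrak{n}$ with $\mathfrak{a}=\mathbb{C}E_{11}\oplus\mathbb{C}E_{22}\oplus\mathbb{C}E_{33}\oplus\mathbb{C}E_{44}$ and $\mathfrak{n}=\mathbb{C}E_{14}\oplus\mathbb{C}E_{24}\oplus\mathbb{C}E_{31}\oplus\mathbb{C}E_{32}\oplus\mathbb{C}E_{34}$, and $\mathfrak{h}_3=\mathbb{C}(E_{11}+E_{22})\oplus\mathbb{C}(E_{33}+E_{44})\oplus\mathbb{C}E_{14}\oplus\mathbb{C}E_{32}\subset\mathfrak{h}_1$. Let $\rho:\mathfrak{gl}(4,\mathbb{C})\to\mathcal{D}$ be the Lie algebra homomorphism $\rho(E_{ij})=-z_j\frac{\partial}{\partial z_i}$. Let $\chi_l:\mathfrak{h}_1\to\mathbb{C}$ be the character with $\chi_l(E_{11})=-l$, $\chi_l(E_{22})=l+1$, $\chi_l(E_{33})=0$, $\chi_l(E_{44})=1$, $\chi_l(\mathfrak{n})=0$. Its restriction to $\mathfrak{h}_3$ does not depend on $l$ and is denoted $\chi$. *)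

theory Defs
  imports "HOL-Complex_Analysis.Cauchy_Integral_Formula" "HOL-Library.Set_Algebras"
begin

section \<open>Entire functions on X\<close>

text \<open>Holomorphy in several variables, in the form of Osgood's lemma: continuous and separately
  holomorphic.\<close>

definition entire_fun :: "(complex^4 \<Rightarrow> complex) \<Rightarrow> bool" where
  "entire_fun f \<longleftrightarrow> continuous_on UNIV f \<and>
     (\<forall>z i. (\<lambda>t. f (z + axis i t)) holomorphic_on UNIV)"

definition pderiv_fun :: "4 \<Rightarrow> (complex^4 \<Rightarrow> complex) \<Rightarrow> complex^4 \<Rightarrow> complex" where
  "pderiv_fun i f = (\<lambda>z. deriv (\<lambda>t. f (z + axis i t)) 0)"

lemma continuous_on_axis [continuous_intros]:
  fixes g :: "'b::topological_space \<Rightarrow> 'a::real_normed_vector"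
  assumes "continuous_on S g"
  shows "continuous_on S (\<lambda>t. axis i (g t) :: 'a^'n)"
  unfolding axis_def
proof (rule continuous_on_vec_lambda)
  show "continuous_on S (\<lambda>t. if j = i then g t else 0)" for j
    using assms by (cases "j = i") auto
qed

lemma norm_axis: "norm (axis i x :: 'a::real_normed_vector^'n) = norm x"
proof -
  have "(\<Sum>j\<in>UNIV. (norm ((axis i x :: 'a^'n) $ j))\<^sup>2) = (\<Sum>j\<in>UNIV. if j = i then (norm x)\<^sup>2 else 0)"
    by (intro sum.cong) (auto simp: axis_def)
  then show ?thesis by (simp add: norm_vec_def L2_set_def)
qed

lemma entire_fun_differentiable:
  "entire_fun f \<Longrightarrow> (\<lambda>t. f (z + axis i t)) field_differentiable at t"
  unfolding entire_fun_def by (blast intro: holomorphic_on_imp_differentiable_at)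

lemma Cauchy_bound_0:
  fixes F :: "complex \<Rightarrow> complex"
  assumes "F holomorphic_on UNIV" "0 < r" and "\<And>t. norm t = r \<Longrightarrow> norm (F t) \<le> B"
  shows "norm (deriv F 0) \<le> B / r"
  using Cauchy_inequality[of F 0 r B 1] assms
  by (auto intro: holomorphic_on_subset holomorphic_on_imp_continuous_on)

lemma diff_quotient_bound:
  fixes F :: "complex \<Rightarrow> complex"
  assumes F: "F holomorphic_on UNIV" and M: "\<And>t. norm t \<le> 2 \<Longrightarrow> norm (F t) \<le> M"
    and h: "h \<noteq> 0" "norm h \<le> 1"
  shows "norm ((F h - F 0) / h - deriv F 0) \<le> 2 * M * norm h"
proof -
  have "norm ((deriv ^^ 0) F h - (\<Sum>i\<le>1. (deriv ^^ i) F 0 * (h - 0) ^ i / fact i))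
      \<le> (2 * M) * norm (h - 0) ^ Suc 1 / fact 1"
  proof (rule complex_Taylor[of "cball 0 1"])
    fix i and x :: complex
    have "(deriv ^^ i) F holomorphic_on UNIV" by (intro holomorphic_higher_deriv F) auto
    then show "((deriv ^^ i) F has_field_derivative (deriv ^^ Suc i) F x) (at x within cball 0 1)"
      by (auto intro: has_field_derivative_at_within holomorphic_derivI)
  next
    fix x :: complex assume x: "x \<in> cball 0 1"
    have "norm ((deriv ^^ 2) F x) \<le> fact 2 * M / 1 ^ 2"
    proof (rule Cauchy_inequality)
      show "norm (F y) \<le> M" if "norm (x - y) = 1" for y
      proof (rule M)
        have "norm y \<le> norm x + norm (x - y)" by (metis norm_triangle_sub norm_minus_commute)
        then show "norm y \<le> 2" using x that by simp
      qed
    qed (auto intro: holomorphic_on_subset[OF F] holomorphic_on_imp_continuous_on)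
    then show "norm ((deriv ^^ Suc 1) F x) \<le> 2 * M" by (simp add: numeral_2_eq_2)
  qed (use h in auto)
  then have "norm (F h - (F 0 + deriv F 0 * h)) \<le> 2 * M * norm h ^ 2"
    by (simp add: power2_eq_square)
  moreover have "(F h - F 0) / h - deriv F 0 = (F h - (F 0 + deriv F 0 * h)) / h"
    using h by (simp add: field_simps)
  ultimately show ?thesis
    using h by (simp add: norm_divide divide_le_eq power2_eq_square mult.assoc)
qed

lemma pderiv_fun_continuous:
  assumes f: "entire_fun f"
  shows "continuous_on UNIV (pderiv_fun i f)"
  unfolding continuous_on_iff
proof (intro ballI allI impI)
  fix z :: "complex^4" and e :: real assume e: "e > 0"
  have "uniformly_continuous_on (cball z 2) f"
    using f by (intro compact_uniformly_continuous) (auto simp: entire_fun_def intro: continuous_on_subset)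
  then obtain d where d: "d > 0" and
    D: "\<And>x y. x \<in> cball z 2 \<Longrightarrow> y \<in> cball z 2 \<Longrightarrow> dist y x < d \<Longrightarrow> dist (f y) (f x) < e / 2"
    unfolding uniformly_continuous_on_def using e by (metis half_gt_zero)
  show "\<exists>d>0. \<forall>y\<in>UNIV. dist y z < d \<longrightarrow> dist (pderiv_fun i f y) (pderiv_fun i f z) < e"
  proof (intro exI conjI ballI impI)
    show "min d 1 > 0" using d by simp
    fix y assume y: "dist y z < min d 1"
    let ?F = "\<lambda>t. f (y + axis i t)" and ?G = "\<lambda>t. f (z + axis i t)"
    have hol: "?F holomorphic_on UNIV" "?G holomorphic_on UNIV"
      using f by (auto simp: entire_fun_def)
    have "norm (deriv (\<lambda>t. ?F t - ?G t) 0) \<le> (e / 2) / 1"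
    proof (rule Cauchy_bound_0)
      fix t :: complex assume t: "norm t = 1"
      have ax: "norm (axis i t :: complex^4) = 1" using t by (simp add: norm_axis)
      have 1: "y + axis i t \<in> cball z 2"
      proof -
        have "dist z (y + axis i t) \<le> dist z y + norm (axis i t :: complex^4)"
          by (metis (no_types, opaque_lifting) add_diff_cancel_left' dist_norm dist_triangle norm_minus_commute)
        then show ?thesis using ax y by (simp add: dist_commute)
      qed
      have 2: "z + axis i t \<in> cball z 2" using ax by (simp add: dist_norm)
      show "norm (?F t - ?G t) \<le> e / 2"
        using D[OF 2 1] y by (simp add: dist_norm)
    qed (use hol in \<open>auto intro: holomorphic_intros\<close>)
    moreover have "deriv (\<lambda>t. ?F t - ?G t) 0 = deriv ?F 0 - deriv ?G 0"
      by (intro deriv_diff entire_fun_differentiable f)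
    ultimately show "dist (pderiv_fun i f y) (pderiv_fun i f z) < e"
      using e by (simp add: pderiv_fun_def dist_norm)
  qed
qed

lemma pderiv_fun_holomorphic:
  assumes f: "entire_fun f"
  shows "(\<lambda>s. pderiv_fun i f (z + axis j s)) holomorphic_on UNIV"
proof -
  define h :: "nat \<Rightarrow> complex" where "h n = inverse (of_nat (Suc n))" for n
  have h0: "h n \<noteq> 0" and h1: "norm (h n) \<le> 1" for n
  proof -
    show "h n \<noteq> 0" unfolding h_def by (simp del: of_nat_Suc)
    show "norm (h n) \<le> 1" unfolding h_def
      by (simp add: norm_inverse inverse_le_1_iff del: of_nat_Suc)
  qed
  let ?q = "\<lambda>n s. (f (z + axis j s + axis i (h n)) - f (z + axis j s)) / h n"
  show ?thesis
  proof (rule holomorphic_uniform_sequence[where f = ?q])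
    fix n
    have "(\<lambda>s. f ((z + axis i (h n)) + axis j s)) holomorphic_on UNIV"
      and "(\<lambda>s. f (z + axis j s)) holomorphic_on UNIV"
      using f unfolding entire_fun_def by blast+
    moreover have "z + axis i (h n) + axis j s = z + axis j s + axis i (h n)" for s
      by (simp add: add_ac)
    ultimately show "?q n holomorphic_on UNIV"
      using h0[of n] by (intro holomorphic_on_divide holomorphic_on_diff holomorphic_on_const) simp_all
  next
    fix x :: complex
    let ?K = "(\<lambda>(s, t). z + axis j s + axis i t) ` (cball x 1 \<times> cball 0 2)"
    have "continuous_on (cball x 1 \<times> cball 0 2)
      (\<lambda>(s, t). z + axis j s + axis i t :: complex^4)"
      unfolding case_prod_unfold by (intro continuous_intros)
    then have "compact ?K"
      by (rule compact_continuous_image[OF _ compact_Times[OF compact_cball compact_cball]])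
    moreover have "continuous_on ?K f"
      using f by (auto simp: entire_fun_def intro: continuous_on_subset)
    ultimately have "compact (f ` ?K)" by (rule compact_continuous_image[rotated])
    then obtain M where M: "\<And>w. w \<in> f ` ?K \<Longrightarrow> norm w \<le> M"
      by (meson bounded_iff compact_imp_bounded)
    have bd: "norm (?q n s - pderiv_fun i f (z + axis j s)) \<le> 2 * M * norm (h n)"
      if "s \<in> cball x 1" for n s
    proof -
      let ?F = "\<lambda>t. f (z + axis j s + axis i t)"
      have "norm ((?F (h n) - ?F 0) / h n - deriv ?F 0) \<le> 2 * M * norm (h n)"
      proof (rule diff_quotient_bound)
        show "?F holomorphic_on UNIV" using f by (auto simp: entire_fun_def)
        fix t :: complex assume t: "norm t \<le> 2"
        show "norm (?F t) \<le> M"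
        proof (rule M)
          have "(s, t) \<in> cball x 1 \<times> cball 0 2" using that t by simp
          then have "(\<lambda>(s, t). z + axis j s + axis i t) (s, t) \<in> ?K" by (rule imageI)
          then show "?F t \<in> f ` ?K" by simp
        qed
      qed (use h0 h1 in auto)
      moreover have "axis i (0::complex) = (0 :: complex^4)" by simp
      ultimately show ?thesis by (simp add: pderiv_fun_def)
    qed
    have "uniform_limit (cball x 1) ?q (\<lambda>s. pderiv_fun i f (z + axis j s)) sequentially"
    proof (rule uniform_limitI)
      fix e :: real assume e: "e > 0"
      have "(\<lambda>n. 2 * M * norm (h n)) \<longlonglongrightarrow> 2 * M * 0"
        unfolding h_def norm_inverse norm_of_nat
        by (intro tendsto_intros LIMSEQ_inverse_real_of_nat)
      then have "\<forall>\<^sub>F n in sequentially. 2 * M * norm (h n) < e"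
        using e by (intro order_tendstoD(2)[of _ "2 * M * 0"]) auto
      then show "\<forall>\<^sub>F n in sequentially. \<forall>s\<in>cball x 1.
          dist (?q n s) (pderiv_fun i f (z + axis j s)) < e"
      proof eventually_elim
        case (elim n)
        show ?case
        proof
          fix s assume "s \<in> cball x 1"
          from bd[OF this, of n] elim
          show "dist (?q n s) (pderiv_fun i f (z + axis j s)) < e" unfolding dist_norm by linarith
        qed
      qed
    qed
    then show "\<exists>d>0. cball x d \<subseteq> UNIV \<and>
        uniform_limit (cball x d) ?q (\<lambda>s. pderiv_fun i f (z + axis j s)) sequentially"
      by (intro exI[of _ 1]) simp
  qed simp
qed

lemma entire_pderiv_fun: "entire_fun f \<Longrightarrow> entire_fun (pderiv_fun i f)"
  using pderiv_fun_continuous pderiv_fun_holomorphic by (auto simp: entire_fun_def)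

typedef entire = "{f. entire_fun f}"
  morphisms eval_entire Abs_entire
proof
  show "(\<lambda>_. 0) \<in> {f. entire_fun f}" by (simp add: entire_fun_def)
qed

setup_lifting type_definition_entire

instantiation entire :: comm_ring_1
begin

lift_definition zero_entire :: entire is "\<lambda>_. 0" by (simp add: entire_fun_def)
lift_definition one_entire :: entire is "\<lambda>_. 1" by (simp add: entire_fun_def)
lift_definition plus_entire :: "entire \<Rightarrow> entire \<Rightarrow> entire" is "\<lambda>f g z. f z + g z"
  by (auto simp: entire_fun_def intro!: continuous_intros holomorphic_intros)
lift_definition minus_entire :: "entire \<Rightarrow> entire \<Rightarrow> entire" is "\<lambda>f g z. f z - g z"
  by (auto simp: entire_fun_def intro!: continuous_intros holomorphic_intros)
lift_definition uminus_entire :: "entire \<Rightarrow> entire" is "\<lambda>f z. - f z"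
  by (auto simp: entire_fun_def intro!: continuous_intros holomorphic_intros)
lift_definition times_entire :: "entire \<Rightarrow> entire \<Rightarrow> entire" is "\<lambda>f g z. f z * g z"
  by (auto simp: entire_fun_def intro!: continuous_intros holomorphic_intros)

instance
  by standard (transfer; simp add: algebra_simps fun_eq_iff)+

end

lift_definition const_entire :: "complex \<Rightarrow> entire" is "\<lambda>c _. c"
  by (simp add: entire_fun_def)

lift_definition coord_entire :: "4 \<Rightarrow> entire" is "\<lambda>i z. z $ i"
proof -
  fix i :: 4
  have "(\<lambda>t. (z + axis j t) $ i) = (\<lambda>t. z $ i + (if i = j then t else 0))"
    for z :: "complex^4" and j
    by (simp add: axis_def fun_eq_iff)
  then have "(\<lambda>t. (z + axis j t) $ i) holomorphic_on UNIV" for z :: "complex^4" and j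
    by (cases "i = j") (auto intro!: holomorphic_intros)
  then show "entire_fun (\<lambda>z. z $ i)"
    by (auto simp: entire_fun_def intro!: continuous_intros)
qed

lift_definition pderiv_entire :: "4 \<Rightarrow> entire \<Rightarrow> entire" is pderiv_fun
  by (rule entire_pderiv_fun)

lemma pderiv_entire_add: "pderiv_entire i (f + g) = pderiv_entire i f + pderiv_entire i g"
proof transfer
  fix i f g assume "entire_fun f" "entire_fun g"
  then show "pderiv_fun i (\<lambda>z. f z + g z) = (\<lambda>z. pderiv_fun i f z + pderiv_fun i g z)"
    unfolding pderiv_fun_def by (intro ext deriv_add entire_fun_differentiable)
qed

lemma pderiv_entire_const_mult:
  "pderiv_entire i (const_entire c * f) = const_entire c * pderiv_entire i f"
proof transfer
  fix i c f assume "entire_fun f"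
  then show "pderiv_fun i (\<lambda>z. c * f z) = (\<lambda>z. c * pderiv_fun i f z)"
    unfolding pderiv_fun_def by (intro ext deriv_cmult entire_fun_differentiable)
qed


section \<open>The ring of differential operators with polynomial coefficients\<close>

text \<open>Realised as the subring of the linear endomorphisms of the entire functions generated by the
  constants, the coordinates and the partial derivatives; this representation is faithful.\<close>

inductive_set diff_ops :: "(entire \<Rightarrow> entire) set" where
  const: "(\<lambda>f. const_entire c * f) \<in> diff_ops"
| coord: "(\<lambda>f. coord_entire i * f) \<in> diff_ops"
| pderiv: "pderiv_entire i \<in> diff_ops"
| add: "P \<in> diff_ops \<Longrightarrow> Q \<in> diff_ops \<Longrightarrow> (\<lambda>f. P f + Q f) \<in> diff_ops"
| comp: "P \<in> diff_ops \<Longrightarrow> Q \<in> diff_ops \<Longrightarrow> (\<lambda>f. P (Q f)) \<in> diff_ops"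

lemma const_entire_simps:
  "const_entire 0 = 0" "const_entire 1 = 1" "const_entire (-1) = -1"
  by (transfer; simp)+

lemma diff_ops_add: "P \<in> diff_ops \<Longrightarrow> P (f + g) = P f + P g"
proof (induction arbitrary: f g rule: diff_ops.induct)
  case (pderiv i)
  then show ?case by (rule pderiv_entire_add)
qed (simp_all add: algebra_simps)

lemma diff_ops_uminus: "P \<in> diff_ops \<Longrightarrow> (\<lambda>f. - P f) \<in> diff_ops"
  using diff_ops.comp[OF diff_ops.const[of "-1"], of P] by (simp add: const_entire_simps)

typedef diffop = diff_ops
  morphisms apply_diffop Abs_diffop
  using diff_ops.coord by blast

setup_lifting type_definition_diffop

instantiation diffop :: ring_1
begin

lift_definition zero_diffop :: diffop is "\<lambda>_. 0"
proof -
  have "(\<lambda>_. 0) = (\<lambda>f. const_entire 0 * f)" by (simp add: const_entire_simps fun_eq_iff)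
  then show "(\<lambda>_. 0) \<in> diff_ops" using diff_ops.const by simp
qed
lift_definition one_diffop :: diffop is "\<lambda>f. f"
proof -
  have "(\<lambda>f. f) = (\<lambda>f. const_entire 1 * f)" by (simp add: const_entire_simps fun_eq_iff)
  then show "(\<lambda>f. f) \<in> diff_ops" using diff_ops.const by simp
qed
lift_definition plus_diffop :: "diffop \<Rightarrow> diffop \<Rightarrow> diffop" is "\<lambda>P Q f. P f + Q f"
  by (rule diff_ops.add)
lift_definition uminus_diffop :: "diffop \<Rightarrow> diffop" is "\<lambda>P f. - P f"
  by (rule diff_ops_uminus)
lift_definition minus_diffop :: "diffop \<Rightarrow> diffop \<Rightarrow> diffop" is "\<lambda>P Q f. P f - Q f"
  using diff_ops.add[OF _ diff_ops_uminus] by force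
lift_definition times_diffop :: "diffop \<Rightarrow> diffop \<Rightarrow> diffop" is "\<lambda>P Q f. P (Q f)"
  by (rule diff_ops.comp)

instance
proof
  fix P Q R :: diffop
  show "(P + Q) + R = P + (Q + R)" by transfer (simp add: add.assoc)
  show "P + Q = Q + P" by transfer (simp add: add.commute)
  show "0 + P = P" by transfer simp
  show "- P + P = 0" by transfer simp
  show "P - Q = P + - Q" by transfer simp
  show "(P * Q) * R = P * (Q * R)" by transfer simp
  show "1 * P = P" by transfer simp
  show "P * 1 = P" by transfer simp
  show "(P + Q) * R = P * R + Q * R" by transfer simp
  show "P * (Q + R) = P * Q + P * R" by transfer (simp add: diff_ops_add)
  show "(0::diffop) \<noteq> 1"
  proof transfer
    show "(\<lambda>_. 0) \<noteq> (\<lambda>f::entire. f)" by (metis zero_neq_one)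
  qed
qed

end

lift_definition const_op :: "complex \<Rightarrow> diffop" is "\<lambda>c f. const_entire c * f"
  by (rule diff_ops.const)
lift_definition z_op :: "4 \<Rightarrow> diffop" is "\<lambda>i f. coord_entire i * f"
  by (rule diff_ops.coord)
lift_definition d_op :: "4 \<Rightarrow> diffop" is pderiv_entire
  by (rule diff_ops.pderiv)

text \<open>The formal adjoint: the unique anti-automorphism over the complex numbers that fixes the
  coordinates and changes the sign of the partial derivatives.\<close>

definition transpose_op :: "diffop \<Rightarrow> diffop" where
  "transpose_op = (THE \<tau>.
     (\<forall>P Q. \<tau> (P + Q) = \<tau> P + \<tau> Q) \<and> (\<forall>P Q. \<tau> (P * Q) = \<tau> Q * \<tau> P) \<and>
     (\<forall>c. \<tau> (const_op c) = const_op c) \<and> (\<forall>i. \<tau> (z_op i) = z_op i) \<and>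
     (\<forall>i. \<tau> (d_op i) = - d_op i))"


section \<open>Left ideals, cyclic modules and their solutions\<close>

definition left_ideal :: "'a::ring_1 set \<Rightarrow> bool" where
  "left_ideal I \<longleftrightarrow> 0 \<in> I \<and> (\<forall>P\<in>I. \<forall>Q\<in>I. P + Q \<in> I) \<and> (\<forall>R. \<forall>P\<in>I. R * P \<in> I)"

definition left_ideal_gen :: "'a::ring_1 set \<Rightarrow> 'a set" where
  "left_ideal_gen S = \<Inter> {I. left_ideal I \<and> S \<subseteq> I}"

definition ideal_I1 :: "nat \<Rightarrow> diffop set" where
  "ideal_I1 l = left_ideal_gen
     {z_op 1 * d_op 1 - of_nat l, d_op 1 ^ (l + 1),
      z_op 2 * d_op 2 + of_nat l + 1, z_op 2 ^ (l + 1), d_op 3, z_op 4}"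

definition quotient_module :: "'a::ring_1 set \<Rightarrow> 'a set set" where
  "quotient_module I = range (\<lambda>P. P +o I)"


section \<open>Hyperfunctions on the real form\<close>

text \<open>The real form is parametrised by the pairs \<open>(z1, z2)\<close>.\<close>

definition real_form :: "complex \<times> complex \<Rightarrow> complex^4" where
  "real_form p = vector [fst p, snd p, cnj (fst p), cnj (snd p)]"

text \<open>A linear functional on the entire functions is carried by \<open>K\<close> if it is bounded with respect to
  the supremum over every complex neighbourhood of \<open>K\<close>.\<close>

definition carried_by :: "(complex^4) set \<Rightarrow> (entire \<Rightarrow> complex) \<Rightarrow> bool" where
  "carried_by K u \<longleftrightarrow>
     (\<forall>f g. u (f + g) = u f + u g) \<and> (\<forall>c f. u (const_entire c * f) = c * u f) \<and>
     (\<forall>\<omega>. open \<omega> \<and> K \<subseteq> \<omega> \<longrightarrow>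
        (\<exists>C. \<forall>f B. 0 \<le> B \<and> (\<forall>z\<in>\<omega>. norm (eval_entire f z) \<le> B) \<longrightarrow> norm (u f) \<le> C * B))"

text \<open>The analytic functionals carried by a compact subset of the part of the real form
  parametrised by \<open>S\<close>.\<close>

definition analytic_functional :: "(complex \<times> complex) set \<Rightarrow> (entire \<Rightarrow> complex) \<Rightarrow> bool" where
  "analytic_functional S u \<longleftrightarrow> (\<exists>K\<subseteq>S. compact K \<and> carried_by (real_form ` K) u)"

text \<open>Following Martineau, the hyperfunctions on the open ball \<open>ball 0 k\<close> are the analytic
  functionals with compact real carrier modulo those with a carrier disjoint from the ball;
  a hyperfunction on the whole real form is a compatible sequence of such classes.\<close>

definition hyp_rep :: "(nat \<Rightarrow> entire \<Rightarrow> complex) \<Rightarrow> bool" where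
  "hyp_rep u \<longleftrightarrow> (\<forall>k. analytic_functional UNIV (u k)) \<and>
     (\<forall>k. analytic_functional (- ball 0 (real k)) (\<lambda>f. u (Suc k) f - u k f))"

definition hyp_eq :: "(nat \<Rightarrow> entire \<Rightarrow> complex) \<Rightarrow> (nat \<Rightarrow> entire \<Rightarrow> complex) \<Rightarrow> bool" where
  "hyp_eq u v \<longleftrightarrow> hyp_rep u \<and> hyp_rep v \<and>
     (\<forall>k. analytic_functional (- ball 0 (real k)) (\<lambda>f. u k f - v k f))"

lemma carried_by_mono: "carried_by K u \<Longrightarrow> K \<subseteq> L \<Longrightarrow> carried_by L u"
  unfolding carried_by_def by (meson order_trans)

lemma carried_by_zero: "carried_by K (\<lambda>_. 0)"
  unfolding carried_by_def by (auto intro: exI[of _ 0])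

lemma carried_by_add:
  assumes "carried_by K u" "carried_by K v"
  shows "carried_by K (\<lambda>f. u f + v f)"
  unfolding carried_by_def
proof (intro conjI allI impI)
  fix \<omega> :: "(complex^4) set" assume w: "open \<omega> \<and> K \<subseteq> \<omega>"
  obtain C D where
    C: "\<And>f B. 0 \<le> B \<and> (\<forall>z\<in>\<omega>. norm (eval_entire f z) \<le> B) \<Longrightarrow> norm (u f) \<le> C * B" and
    D: "\<And>f B. 0 \<le> B \<and> (\<forall>z\<in>\<omega>. norm (eval_entire f z) \<le> B) \<Longrightarrow> norm (v f) \<le> D * B"
    using assms w unfolding carried_by_def by meson
  show "\<exists>C. \<forall>f B. 0 \<le> B \<and> (\<forall>z\<in>\<omega>. norm (eval_entire f z) \<le> B) \<longrightarrow> norm (u f + v f) \<le> C * B"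
  proof (intro exI allI impI)
    fix f B assume "0 \<le> B \<and> (\<forall>z\<in>\<omega>. norm (eval_entire f z) \<le> B)"
    from C[OF this] D[OF this] show "norm (u f + v f) \<le> (C + D) * B"
      by (intro norm_triangle_le) (simp add: algebra_simps)
  qed
qed (use assms in \<open>auto simp: carried_by_def algebra_simps\<close>)

lemma carried_by_uminus: "carried_by K u \<Longrightarrow> carried_by K (\<lambda>f. - u f)"
  unfolding carried_by_def by auto

lemma analytic_functional_zero: "analytic_functional S (\<lambda>_. 0)"
  unfolding analytic_functional_def by (intro exI[of _ "{}"]) (auto simp: carried_by_zero)

lemma analytic_functional_add:
  assumes "analytic_functional S u" "analytic_functional S v"
  shows "analytic_functional S (\<lambda>f. u f + v f)"
proof -
  obtain K L where "K \<subseteq> S" "compact K" "carried_by (real_form ` K) u"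
    and "L \<subseteq> S" "compact L" "carried_by (real_form ` L) v"
    using assms unfolding analytic_functional_def by blast
  then show ?thesis
    unfolding analytic_functional_def
    by (intro exI[of _ "K \<union> L"] conjI carried_by_add)
       (auto intro: carried_by_mono compact_Un)
qed

lemma analytic_functional_uminus:
  "analytic_functional S u \<Longrightarrow> analytic_functional S (\<lambda>f. - u f)"
  unfolding analytic_functional_def using carried_by_uminus by blast

lemma carried_by_coord:
  assumes u: "carried_by K u" and K: "compact K"
  shows "carried_by K (\<lambda>f. u (coord_entire i * f))"
  unfolding carried_by_def
proof (intro conjI allI impI)
  show "u (coord_entire i * (f + g)) = u (coord_entire i * f) + u (coord_entire i * g)" for f g
    using u by (simp add: carried_by_def distrib_left)
  show "u (coord_entire i * (const_entire c * f)) = c * u (coord_entire i * f)" for c f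
    using u by (simp add: carried_by_def mult.left_commute)
next
  fix \<omega> :: "(complex^4) set" assume w: "open \<omega> \<and> K \<subseteq> \<omega>"
  obtain r where r: "\<And>z. z \<in> K \<Longrightarrow> norm z < r" "r > 0"
    using compact_imp_bounded[OF K] by (metis bounded_pos_less)
  let ?w = "\<omega> \<inter> ball 0 r"
  have "open ?w" "K \<subseteq> ?w" using w r by auto
  then obtain C where
    C: "\<And>f B. 0 \<le> B \<and> (\<forall>z\<in>?w. norm (eval_entire f z) \<le> B) \<Longrightarrow> norm (u f) \<le> C * B"
    using u unfolding carried_by_def by meson
  show "\<exists>C. \<forall>f B. 0 \<le> B \<and> (\<forall>z\<in>\<omega>. norm (eval_entire f z) \<le> B) \<longrightarrow>
      norm (u (coord_entire i * f)) \<le> C * B"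
  proof (intro exI allI impI)
    fix f B assume f: "0 \<le> B \<and> (\<forall>z\<in>\<omega>. norm (eval_entire f z) \<le> B)"
    have "norm (u (coord_entire i * f)) \<le> C * (r * B)"
    proof (intro C conjI ballI)
      show "0 \<le> r * B" using f r by simp
      fix z assume z: "z \<in> ?w"
      have "norm (z $ i) \<le> r" using z Finite_Cartesian_Product.norm_nth_le[of z i] by auto
      then have "norm (z $ i) * norm (eval_entire f z) \<le> r * B"
        using f z r by (intro mult_mono) auto
      then show "norm (eval_entire (coord_entire i * f) z) \<le> r * B"
        by (simp add: times_entire.rep_eq coord_entire.rep_eq norm_mult)
    qed
    then show "norm (u (coord_entire i * f)) \<le> (C * r) * B" by (simp add: mult.assoc)
  qed
qed

lemma carried_by_pderiv:
  assumes u: "carried_by K u" and K: "compact K"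
  shows "carried_by K (\<lambda>f. u (pderiv_entire i f))"
  unfolding carried_by_def
proof (intro conjI allI impI)
  show "u (pderiv_entire i (f + g)) = u (pderiv_entire i f) + u (pderiv_entire i g)" for f g
    using u by (simp add: carried_by_def pderiv_entire_add)
  show "u (pderiv_entire i (const_entire c * f)) = c * u (pderiv_entire i f)" for c f
    using u by (simp add: carried_by_def pderiv_entire_const_mult)
next
  fix \<omega> :: "(complex^4) set" assume w: "open \<omega> \<and> K \<subseteq> \<omega>"
  then obtain e where e: "e > 0" "(\<Union>z\<in>K. cball z e) \<subseteq> \<omega>"
    using compact_subset_open_imp_cball_epsilon_subset[OF K, of \<omega>] by blast
  let ?w = "\<Union>z\<in>K. ball z (e/2)"
  have "open ?w" "K \<subseteq> ?w" using e by auto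
  then obtain C where
    C: "\<And>f B. 0 \<le> B \<and> (\<forall>z\<in>?w. norm (eval_entire f z) \<le> B) \<Longrightarrow> norm (u f) \<le> C * B"
    using u unfolding carried_by_def by meson
  show "\<exists>C. \<forall>f B. 0 \<le> B \<and> (\<forall>z\<in>\<omega>. norm (eval_entire f z) \<le> B) \<longrightarrow>
      norm (u (pderiv_entire i f)) \<le> C * B"
  proof (intro exI allI impI)
    fix f B assume f: "0 \<le> B \<and> (\<forall>z\<in>\<omega>. norm (eval_entire f z) \<le> B)"
    have "norm (u (pderiv_entire i f)) \<le> C * (B / (e/2))"
    proof (intro C conjI ballI)
      show "0 \<le> B / (e/2)" using f e by simp
      fix z assume "z \<in> ?w"
      then obtain k where k: "k \<in> K" "dist k z < e/2" by auto
      have "norm (deriv (\<lambda>t. eval_entire f (z + axis i t)) 0) \<le> B / (e/2)"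
      proof (rule Cauchy_bound_0)
        show "(\<lambda>t. eval_entire f (z + axis i t)) holomorphic_on UNIV"
          using eval_entire[of f] by (simp add: entire_fun_def)
        show "e/2 > 0" using e by simp
        fix t :: complex assume t: "norm t = e/2"
        have "dist k (z + axis i t) \<le> dist k z + norm (axis i t :: complex^4)"
          by (metis (no_types, opaque_lifting) add_diff_cancel_left' dist_norm dist_triangle norm_minus_commute)
        also have "\<dots> \<le> e" using k t by (simp add: norm_axis)
        finally have "z + axis i t \<in> cball k e" by simp
        then have "z + axis i t \<in> \<omega>" using e k by blast
        then show "norm (eval_entire f (z + axis i t)) \<le> B" using f by blast
      qed
      then show "norm (eval_entire (pderiv_entire i f) z) \<le> B / (e/2)"
        by (simp add: pderiv_entire.rep_eq pderiv_fun_def)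
    qed
    then show "norm (u (pderiv_entire i f)) \<le> (C / (e/2)) * B" by (simp add: mult_ac)
  qed
qed

lemma carried_by_diff_ops:
  assumes "P \<in> diff_ops" "carried_by K u" "compact K"
  shows "carried_by K (\<lambda>f. u (P f))"
  using assms
proof (induction arbitrary: u rule: diff_ops.induct)
  case (const c)
  then have "carried_by K (\<lambda>f. c * u f)"
  proof -
    assume u: "carried_by K u"
    show ?thesis
      unfolding carried_by_def
    proof (intro conjI allI impI)
      fix \<omega> :: "(complex^4) set" assume w: "open \<omega> \<and> K \<subseteq> \<omega>"
      then obtain C where
        C: "\<And>f B. 0 \<le> B \<and> (\<forall>z\<in>\<omega>. norm (eval_entire f z) \<le> B) \<Longrightarrow> norm (u f) \<le> C * B"
        using u unfolding carried_by_def by meson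
      show "\<exists>C. \<forall>f B. 0 \<le> B \<and> (\<forall>z\<in>\<omega>. norm (eval_entire f z) \<le> B) \<longrightarrow> norm (c * u f) \<le> C * B"
        by (intro exI[of _ "norm c * C"] allI impI)
           (auto simp: norm_mult mult.assoc intro!: mult_left_mono C)
    qed (use u in \<open>auto simp: carried_by_def algebra_simps\<close>)
  qed
  then show ?case using const by (simp add: carried_by_def)
next
  case (add P Q)
  have "u (P f + Q f) = u (P f) + u (Q f)" for f
    using add.prems by (simp add: carried_by_def)
  then show ?case using add carried_by_add by simp
qed (auto intro: carried_by_coord carried_by_pderiv)

lemma real_form_nth [simp]:
  "real_form p $ 1 = fst p" "real_form p $ 2 = snd p"
  "real_form p $ 3 = cnj (fst p)" "real_form p $ 4 = cnj (snd p)"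
  by (simp_all add: real_form_def vector_def)

lemma compact_real_form:
  assumes "compact K"
  shows "compact (real_form ` K)"
proof (intro compact_continuous_image assms)
  have eq: "real_form = (\<lambda>p. axis 1 (fst p) + axis 2 (snd p) + axis 3 (cnj (fst p)) + axis 4 (cnj (snd p)))"
    by (auto simp: fun_eq_iff vec_eq_iff forall_4 axis_def)
  show "continuous_on K real_form" unfolding eq by (intro continuous_intros)
qed

lemma analytic_functional_diff_ops:
  "P \<in> diff_ops \<Longrightarrow> analytic_functional S u \<Longrightarrow> analytic_functional S (\<lambda>f. u (P f))"
  unfolding analytic_functional_def using carried_by_diff_ops compact_real_form by blast

quotient_type hyperfunction = "nat \<Rightarrow> entire \<Rightarrow> complex" / partial: hyp_eq
proof (rule part_equivpI)
  show "\<exists>u. hyp_eq u u"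
    by (intro exI[of _ "\<lambda>_ _. 0"]) (simp add: hyp_eq_def hyp_rep_def analytic_functional_zero)
  show "symp hyp_eq"
  proof (rule sympI)
    fix u v assume "hyp_eq u v"
    then show "hyp_eq v u"
      using analytic_functional_uminus[of _ "\<lambda>f. u _ f - v _ f"] by (fastforce simp: hyp_eq_def)
  qed
  show "transp hyp_eq"
  proof (rule transpI)
    fix u v w assume "hyp_eq u v" "hyp_eq v w"
    then show "hyp_eq u w"
      using analytic_functional_add[of _ "\<lambda>f. u _ f - v _ f" "\<lambda>f. v _ f - w _ f"]
      by (fastforce simp: hyp_eq_def)
  qed
qed

lemma hyp_eq_add:
  assumes "hyp_eq u u'" "hyp_eq v v'"
  shows "hyp_eq (\<lambda>k f. u k f + v k f) (\<lambda>k f. u' k f + v' k f)"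
proof -
  have a: "a + b - (c + d) = (a - c) + (b - d)" for a b c d :: complex by simp
  show ?thesis
    using assms unfolding hyp_eq_def hyp_rep_def a
    by (auto intro!: analytic_functional_add)
qed

lemma hyp_eq_uminus:
  assumes "hyp_eq u u'"
  shows "hyp_eq (\<lambda>k f. - u k f) (\<lambda>k f. - u' k f)"
proof -
  have a: "- a - - b = - (a - b)" for a b :: complex by simp
  show ?thesis
    using assms unfolding hyp_eq_def hyp_rep_def a
    by (auto intro!: analytic_functional_uminus simp del: minus_diff_eq)
qed

lemma hyp_eq_diffop:
  assumes "hyp_eq u u'"
  shows "hyp_eq (\<lambda>k f. u k (apply_diffop P f)) (\<lambda>k f. u' k (apply_diffop P f))"
  using assms analytic_functional_diff_ops[OF apply_diffop, of _ "\<lambda>f. _ f - _ f" P]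
    analytic_functional_diff_ops[OF apply_diffop, of _ _ P]
  unfolding hyp_eq_def hyp_rep_def by simp

instantiation hyperfunction :: ab_group_add
begin

lift_definition zero_hyperfunction :: hyperfunction is "\<lambda>_ _. 0"
  by (simp add: hyp_eq_def hyp_rep_def analytic_functional_zero)
lift_definition plus_hyperfunction :: "hyperfunction \<Rightarrow> hyperfunction \<Rightarrow> hyperfunction"
  is "\<lambda>u v k f. u k f + v k f"
  by (rule hyp_eq_add)
lift_definition uminus_hyperfunction :: "hyperfunction \<Rightarrow> hyperfunction" is "\<lambda>u k f. - u k f"
  by (rule hyp_eq_uminus)
lift_definition minus_hyperfunction :: "hyperfunction \<Rightarrow> hyperfunction \<Rightarrow> hyperfunction"
  is "\<lambda>u v k f. u k f - v k f"
  using hyp_eq_add[OF _ hyp_eq_uminus] by force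

instance
proof
  fix u v w :: hyperfunction
  show "(u + v) + w = u + (v + w)"
    by transfer (drule (2) hyp_eq_add[OF hyp_eq_add], simp add: add.assoc)
  show "u + v = v + u" by transfer (drule (1) hyp_eq_add, simp add: add.commute)
  show "0 + u = u" by transfer simp
  show "- u + u = 0"
    by transfer (simp add: hyp_eq_def hyp_rep_def analytic_functional_zero)
  show "u - v = u + - v"
    by transfer (drule (1) hyp_eq_add[OF _ hyp_eq_uminus], simp)
qed

end

text \<open>In the coordinates of the complexification, multiplication by \<open>z3, z4\<close> and the derivatives
  along \<open>z1, ..., z4\<close> restrict on the real form to multiplication by the conjugates of \<open>z1, z2\<close> and
  to the Wirtinger derivatives. The action is dual to this, with the sign of integration by
  parts.\<close>

lift_definition act :: "diffop \<Rightarrow> hyperfunction \<Rightarrow> hyperfunction"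
  is "\<lambda>P u k f. u k (apply_diffop (transpose_op P) f)"
  by (rule hyp_eq_diffop)

definition solutions :: "diffop set \<Rightarrow> hyperfunction set" where
  "solutions I = {u. \<forall>P\<in>I. act P u = 0}"

text \<open>A map on the quotient module is represented by an extensional function on cosets.\<close>

definition Hom_D :: "diffop set \<Rightarrow> (diffop set \<Rightarrow> hyperfunction) set" where
  "Hom_D I = {\<phi> \<in> extensional (quotient_module I).
     (\<forall>P Q. \<phi> ((P + Q) +o I) = \<phi> (P +o I) + \<phi> (Q +o I)) \<and>
     (\<forall>P Q. \<phi> ((P * Q) +o I) = act P (\<phi> (Q +o I)))}"

definition Hom_add :: "diffop set \<Rightarrow> (diffop set \<Rightarrow> hyperfunction) \<Rightarrow>
    (diffop set \<Rightarrow> hyperfunction) \<Rightarrow> (diffop set \<Rightarrow> hyperfunction)" where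
  "Hom_add I \<phi> \<psi> = (\<lambda>m\<in>quotient_module I. \<phi> m + \<psi> m)"

definition Hom_scale :: "diffop set \<Rightarrow> complex \<Rightarrow>
    (diffop set \<Rightarrow> hyperfunction) \<Rightarrow> (diffop set \<Rightarrow> hyperfunction)" where
  "Hom_scale I c \<phi> = (\<lambda>m\<in>quotient_module I. act (const_op c) (\<phi> m))"


section \<open>Distributions on the real form\<close>

definition dir_deriv :: "'a::euclidean_space \<Rightarrow> ('a \<Rightarrow> 'b::real_normed_vector) \<Rightarrow> 'a \<Rightarrow> 'b" where
  "dir_deriv v f = (\<lambda>x. frechet_derivative f (at x) v)"

primrec Ck :: "nat \<Rightarrow> ('a::euclidean_space \<Rightarrow> 'b::real_normed_vector) \<Rightarrow> bool" where
  "Ck 0 f \<longleftrightarrow> continuous_on UNIV f"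
| "Ck (Suc k) f \<longleftrightarrow> (\<forall>x. f differentiable (at x)) \<and> (\<forall>v. Ck k (dir_deriv v f))"

definition test_function :: "('a::euclidean_space \<Rightarrow> complex) \<Rightarrow> bool" where
  "test_function \<phi> \<longleftrightarrow> (\<forall>k. Ck k \<phi>) \<and> compact (closure {x. \<phi> x \<noteq> 0})"

text \<open>A distribution is represented by a functional whose values outside the space of test
  functions are irrelevant.\<close>

definition distribution :: "(('a::euclidean_space \<Rightarrow> complex) \<Rightarrow> complex) \<Rightarrow> bool" where
  "distribution T \<longleftrightarrow>
     (\<forall>\<phi> \<psi>. test_function \<phi> \<and> test_function \<psi> \<longrightarrow> T (\<lambda>x. \<phi> x + \<psi> x) = T \<phi> + T \<psi>) \<and>
     (\<forall>c \<phi>. test_function \<phi> \<longrightarrow> T (\<lambda>x. c * \<phi> x) = c * T \<phi>) \<and>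
     (\<forall>K. compact K \<longrightarrow> (\<exists>N C. \<forall>\<phi> B. test_function \<phi> \<and> (\<forall>x. x \<notin> K \<longrightarrow> \<phi> x = 0) \<and>
        (\<forall>vs x. set vs \<subseteq> Basis \<and> length vs \<le> N \<longrightarrow> norm (fold dir_deriv vs \<phi> x) \<le> B)
        \<longrightarrow> norm (T \<phi>) \<le> C * B))"

definition eq_distribution ::
    "(('a::euclidean_space \<Rightarrow> complex) \<Rightarrow> complex) \<Rightarrow> (('a \<Rightarrow> complex) \<Rightarrow> complex) \<Rightarrow> bool" where
  "eq_distribution S T \<longleftrightarrow> (\<forall>\<phi>. test_function \<phi> \<longrightarrow> S \<phi> = T \<phi>)"

type_synonym dist_functional = "(complex \<times> complex \<Rightarrow> complex) \<Rightarrow> complex"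

definition dist_mult :: "(complex \<times> complex \<Rightarrow> complex) \<Rightarrow> dist_functional \<Rightarrow> dist_functional" where
  "dist_mult a T = (\<lambda>\<phi>. T (\<lambda>p. a p * \<phi> p))"

definition wirtinger_z2 :: "(complex \<times> complex \<Rightarrow> complex) \<Rightarrow> complex \<times> complex \<Rightarrow> complex" where
  "wirtinger_z2 \<phi> = (\<lambda>p. (dir_deriv (0, 1) \<phi> p - \<i> * dir_deriv (0, \<i>) \<phi> p) / 2)"

definition dist_d2 :: "dist_functional \<Rightarrow> dist_functional" where
  "dist_d2 T = (\<lambda>\<phi>. - T (wirtinger_z2 \<phi>))"

text \<open>Functions are identified with distributions through Lebesgue measure in the real and imaginary
  parts of \<open>z1, z2\<close>.\<close>

definition delta_z2 :: dist_functional where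
  "delta_z2 = (\<lambda>\<phi>. 1 / (- 2 * \<i>) * integral\<^sup>L lborel (\<lambda>z1. \<phi> (z1, 0)))"

definition T2 :: "nat \<Rightarrow> dist_functional" where
  "T2 l = dist_mult (\<lambda>p. fst p ^ l) ((dist_d2 ^^ l) delta_z2)"

text \<open>The embedding of distributions: the class on \<open>ball 0 k\<close> is that of the compactly supported
  distribution obtained by a cut-off, acting on entire functions through their restriction to the
  real form. The class does not depend on the choice of the cut-off functions.\<close>

definition cutoff :: "nat \<Rightarrow> complex \<times> complex \<Rightarrow> complex" where
  "cutoff k = (SOME \<theta>. test_function \<theta> \<and>
     (\<exists>U. open U \<and> cball 0 (real k) \<subseteq> U \<and> (\<forall>p\<in>U. \<theta> p = 1)))"

definition hyp_of_distribution :: "dist_functional \<Rightarrow> hyperfunction" where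
  "hyp_of_distribution T =
     abs_hyperfunction (\<lambda>k f. T (\<lambda>p. cutoff k p * eval_entire f (real_form p)))"


section \<open>Lie algebras and characters\<close>

definition E :: "4 \<Rightarrow> 4 \<Rightarrow> complex^4^4" where
  "E i j = (\<chi> a b. if a = i \<and> b = j then 1 else 0)"

definition mscale :: "complex \<Rightarrow> complex^4^4 \<Rightarrow> complex^4^4" where
  "mscale c A = (\<chi> i j. c * A $ i $ j)"

definition cspan :: "(complex^4^4) set \<Rightarrow> (complex^4^4) set" where
  "cspan S = {\<Sum>A\<in>F. mscale (c A) A | F c. finite F \<and> F \<subseteq> S}"

definition lie_a :: "(complex^4^4) set" where
  "lie_a = cspan {E 1 1, E 2 2, E 3 3, E 4 4}"

definition lie_n :: "(complex^4^4) set" where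
  "lie_n = cspan {E 1 4, E 2 4, E 3 1, E 3 2, E 3 4}"

definition h1 :: "(complex^4^4) set" where
  "h1 = lie_a + lie_n"

definition h3 :: "(complex^4^4) set" where
  "h3 = cspan {E 1 1 + E 2 2, E 3 3 + E 4 4, E 1 4, E 3 2}"

definition rho :: "complex^4^4 \<Rightarrow> diffop" where
  "rho A = (\<Sum>i\<in>UNIV. \<Sum>j\<in>UNIV. const_op (A $ i $ j) * (- (z_op j * d_op i)))"

text \<open>The linear extension to all matrices by zero on the remaining matrix units; only the
  restriction to \<open>h1\<close> is relevant.\<close>

definition chi :: "nat \<Rightarrow> complex^4^4 \<Rightarrow> complex" where
  "chi l A = - of_nat l * A $ 1 $ 1 + (of_nat l + 1) * A $ 2 $ 2 + 0 * A $ 3 $ 3 + 1 * A $ 4 $ 4"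

text \<open>The common restriction of all \<open>chi l\<close> to \<open>h3\<close>.\<close>

definition chi3 :: "complex^4^4 \<Rightarrow> complex" where
  "chi3 A = chi 0 A"

end

theory Submission
  imports Defs
begin

text \<open>
  The class of \<open>T2 l\<close> lies in the family \<open>slice_hyp c j m\<close> of multiples of the functionals
  \<open>\<phi> \<mapsto> \<integral> z1\<^sup>j (\<partial>\<^sup>m\<phi>/\<partial>z2\<^sup>m)(z1, 0)\<close>, that is, up to constants, to the distributions
  \<open>z1\<^sup>j \<partial>\<^sup>m/\<partial>z2\<^sup>m \<delta>(z2)\<close>. On this family the Weyl algebra acts by shifting the indices:
  \<open>z1\<close> raises \<open>j\<close>, \<open>\<partial>/\<partial>z1\<close> lowers \<open>j\<close> with the factor \<open>j\<close>, \<open>\<partial>/\<partial>z2\<close> raises \<open>m\<close> with a sign, \<open>z2\<close> lowers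
  \<open>m\<close> with the factor \<open>m\<close>, and \<open>z4\<close> and \<open>\<partial>/\<partial>z3\<close> act by 0 (lemmas \<open>act_z_slice\<close> and \<open>act_d_slice\<close>).
  For \<open>j = m = l\<close> all the generators of the ideal therefore act by 0, and each \<open>\<rho>(A)\<close> with \<open>A\<close> in
  \<open>h1\<close> is a combination of Euler operators, which act by the scalars that make up the character, and
  of operators involving \<open>z4\<close> or \<open>\<partial>/\<partial>z3\<close>. The description of homomorphisms from a cyclic module by
  the annihilated elements is formal.

  The work lies in justifying the index calculus for hyperfunctions. Three points carry it.

  First, the action is dual to the formal adjoint, so the formal adjoint must be shown to exist
  and to be unique. Every operator has a normal form \<open>\<Sum>\<^sub>b m\<^sub>b \<partial>\<^sup>b\<close> with multiplication operators \<open>m\<^sub>b\<close>.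
  Applied to exponentials it yields \<open>\<Sum>\<^sub>b m\<^sub>b \<zeta>\<^sup>b\<close>, and the independence of the characters \<open>\<zeta>\<^sup>b\<close> shows that
  the normal form is unique (\<open>normal_form_unique\<close>). The adjoint can therefore be defined on normal
  forms, and it is an anti-homomorphism because this holds for multiplication by generators.

  Second, derivatives can be moved by integration by parts on the slice \<open>z2 = 0\<close>. This follows
  from translation invariance of Lebesgue measure (\<open>integral_dir_deriv_eq_0\<close>) and from the fact
  that entire functions restrict to smooth functions on the real form whose Wirtinger derivatives
  are the restrictions of the complex partial derivatives (\<open>wirt_restr\<close>).

  Third, the hyperfunction of a distribution is defined through cut-off functions. These exist,
  and when a derivative is moved past the cut-off, the error term contains a derivative of the
  cut-off. It is carried outside the ball where the cut-off is 1, hence is zero as a hyperfunction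
  (\<open>act_d_op\<close>).
\<close>

section \<open>Calculus of smooth functions\<close>

lemma dir_deriv_eqI: "(f has_derivative f') (at x) \<Longrightarrow> dir_deriv v f x = f' v"
  unfolding dir_deriv_def by (metis frechet_derivative_at)

lemma has_derivative_dir_deriv:
  "f differentiable (at x) \<Longrightarrow> (f has_derivative (\<lambda>v. dir_deriv v f x)) (at x)"
  unfolding dir_deriv_def by (simp add: frechet_derivative_works)

lemma dir_deriv_add:
  assumes "\<And>x. f differentiable (at x)" "\<And>x. g differentiable (at x)"
  shows "dir_deriv v (\<lambda>x. f x + g x) = (\<lambda>x. dir_deriv v f x + dir_deriv v g x)"
  by (intro ext dir_deriv_eqI has_derivative_add has_derivative_dir_deriv assms)

lemma dir_deriv_mult:
  fixes f g :: "'a::euclidean_space \<Rightarrow> 'b::real_normed_algebra"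
  assumes "\<And>x. f differentiable (at x)" "\<And>x. g differentiable (at x)"
  shows "dir_deriv v (\<lambda>x. f x * g x) = (\<lambda>x. f x * dir_deriv v g x + dir_deriv v f x * g x)"
  by (intro ext dir_deriv_eqI has_derivative_mult has_derivative_dir_deriv assms)

lemma dir_deriv_const [simp]: "dir_deriv v (\<lambda>x. c) = (\<lambda>x. 0)"
  by (intro ext dir_deriv_eqI has_derivative_const)

lemma Ck_SucI:
  assumes "\<And>x. (f has_derivative f' x) (at x)" "\<And>v. Ck k (\<lambda>x. f' x v)"
  shows "Ck (Suc k) f"
proof -
  have "dir_deriv v f = (\<lambda>x. f' x v)" for v
    using assms(1) by (intro ext dir_deriv_eqI)
  then show ?thesis using assms by (auto simp: differentiable_def)
qed

text \<open>Needed in the inductions on the order: the product rule leaves one factor undifferentiated,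
  which must then count as a function of the lower order.\<close>

lemma Ck_SucD: "Ck (Suc k) f \<Longrightarrow> Ck k f"
proof (induction k arbitrary: f)
  case 0
  then show ?case by (auto simp: continuous_on_eq_continuous_at intro: differentiable_imp_continuous_within)
qed auto

lemma Ck_const [simp]: "Ck k (\<lambda>x. c)"
  by (induction k arbitrary: c) auto

lemma Ck_bounded_linear:
  assumes "bounded_linear f" shows "Ck k f"
proof (cases k)
  case 0
  then show ?thesis using assms by (simp add: linear_continuous_on)
next
  case (Suc j)
  have "Ck (Suc j) f"
    by (rule Ck_SucI[where f' = "\<lambda>x. f"]) (simp_all add: assms bounded_linear_imp_has_derivative)
  with Suc show ?thesis by simp
qed

lemma Ck_add: "Ck k f \<Longrightarrow> Ck k g \<Longrightarrow> Ck k (\<lambda>x. f x + g x)"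
  by (induction k arbitrary: f g) (auto intro: continuous_on_add simp: dir_deriv_add)

lemma Ck_mult:
  fixes f g :: "'a::euclidean_space \<Rightarrow> 'b::real_normed_algebra"
  shows "Ck k f \<Longrightarrow> Ck k g \<Longrightarrow> Ck k (\<lambda>x. f x * g x)"
proof (induction k arbitrary: f g)
  case (Suc k)
  then have "Ck k f" "Ck k g" by (blast intro: Ck_SucD)+
  with Suc show ?case by (auto intro!: Ck_add simp: dir_deriv_mult)
qed (auto intro: continuous_on_mult)

lemma Ck_of_real:
  fixes f :: "'a::euclidean_space \<Rightarrow> real"
  shows "Ck k f \<Longrightarrow> Ck k (\<lambda>x. of_real (f x) :: 'b::real_normed_algebra_1)"
proof (induction k arbitrary: f)
  case (Suc k)
  then show ?case
    by (intro Ck_SucI[where f' = "\<lambda>x v. of_real (dir_deriv v f x)"])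
       (auto intro!: has_derivative_of_real has_derivative_dir_deriv)
qed (auto intro: continuous_intros)

lemma Ck_inverse:
  fixes f :: "'a::euclidean_space \<Rightarrow> 'b::real_normed_field"
  assumes "\<And>x. f x \<noteq> 0"
  shows "Ck k f \<Longrightarrow> Ck k (\<lambda>x. inverse (f x))"
proof (induction k)
  case (Suc k)
  then have "Ck k (\<lambda>x. inverse (f x))" by (blast intro: Ck_SucD)
  moreover have "Ck k (\<lambda>x. -1 * (inverse (f x) * dir_deriv v f x * inverse (f x)))" for v
    using calculation Suc by (intro Ck_mult) auto
  ultimately show ?case using Suc assms
    by (intro Ck_SucI[where f' = "\<lambda>x v. -1 * (inverse (f x) * dir_deriv v f x * inverse (f x))"])
       (auto intro!: derivative_eq_intros has_derivative_dir_deriv)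
qed (simp add: continuous_on_inverse assms)

text \<open>Being smooth is stable under directional derivatives, which no fixed order of differentiability
  is.\<close>

definition smooth :: "('a::euclidean_space \<Rightarrow> 'b::real_normed_vector) \<Rightarrow> bool" where
  "smooth f \<longleftrightarrow> (\<forall>k. Ck k f)"

lemma smooth_differentiable: "smooth f \<Longrightarrow> f differentiable (at x)"
  unfolding smooth_def by (metis Ck.simps(2))

lemma smooth_dir_deriv: "smooth f \<Longrightarrow> smooth (dir_deriv v f)"
  unfolding smooth_def by (metis Ck.simps(2))

lemma smooth_continuous_on: "smooth f \<Longrightarrow> continuous_on S f"
  unfolding smooth_def by (metis Ck.simps(1) continuous_on_subset subset_UNIV)

lemma smooth_const [simp]: "smooth (\<lambda>x. c)"
  by (simp add: smooth_def)

lemma smooth_add: "smooth f \<Longrightarrow> smooth g \<Longrightarrow> smooth (\<lambda>x. f x + g x)"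
  by (simp add: smooth_def Ck_add)

lemma smooth_mult:
  fixes f g :: "'a::euclidean_space \<Rightarrow> 'b::real_normed_algebra"
  shows "smooth f \<Longrightarrow> smooth g \<Longrightarrow> smooth (\<lambda>x. f x * g x)"
  by (simp add: smooth_def Ck_mult)

lemma onorm_scaleR_left_le:
  assumes "norm c \<le> B" shows "onorm (\<lambda>k::real. k *\<^sub>R c) \<le> B"
proof (rule onorm_bound)
  show "0 \<le> B" using assms norm_ge_zero order_trans by blast
  show "norm (k *\<^sub>R c) \<le> B * norm k" for k
    using mult_right_mono[OF assms, of "norm k"] by (simp add: mult.commute)
qed

text \<open>Two applications of the mean value inequality, one in each direction, compare the second
  difference with the mixed derivative, which is continuous.\<close>

lemma second_difference_tendsto:
  fixes f :: "'a::euclidean_space \<Rightarrow> 'b::real_normed_vector"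
  assumes f: "Ck 2 f"
  shows "((\<lambda>h. (f (x + h *\<^sub>R v + h *\<^sub>R w) - f (x + h *\<^sub>R v) - f (x + h *\<^sub>R w) + f x) /\<^sub>R h\<^sup>2)
    \<longlongrightarrow> dir_deriv w (dir_deriv v f) x) (at_right 0)"
proof (rule tendstoI)
  fix e :: real assume e: "e > 0"
  define c where "c = dir_deriv w (dir_deriv v f) x"
  have D1: "f differentiable (at y)" and D2: "dir_deriv v f differentiable (at y)"
    and C: "continuous_on UNIV (dir_deriv w (dir_deriv v f))" for y
    using f by (auto simp: numeral_2_eq_2)
  have "\<forall>\<^sub>F y in nhds x. dist (dir_deriv w (dir_deriv v f) y) c < e / 2"
    using C e unfolding c_def
    by (intro tendstoD) (auto simp: continuous_on_eq_continuous_at isCont_def tendsto_at_iff_tendsto_nhds)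
  then obtain d where d: "d > 0"
    and bd: "\<And>y. dist y x < d \<Longrightarrow> norm (dir_deriv w (dir_deriv v f) y - c) \<le> e / 2"
    unfolding eventually_nhds_metric dist_norm by (metis less_imp_le)
  define r where "r = d / (norm v + norm w + 1)"
  have nv: "norm v + norm w + 1 > 0" by (simp add: add_nonneg_pos)
  have r: "r > 0" using d nv by (simp add: r_def)
  have "dist ((f (x + h *\<^sub>R v + h *\<^sub>R w) - f (x + h *\<^sub>R v) - f (x + h *\<^sub>R w) + f x) /\<^sub>R h\<^sup>2) c < e"
    if h: "0 < h" "h < r" for h
  proof -
    have near: "dist (x + s *\<^sub>R v + t *\<^sub>R w) x < d" if "s \<in> {0..h}" "t \<in> {0..h}" for s t
    proof -
      have "dist (x + s *\<^sub>R v + t *\<^sub>R w) x \<le> norm (s *\<^sub>R v) + norm (t *\<^sub>R w)"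
        by (metis add.assoc add_diff_cancel_left' dist_norm norm_triangle_ineq)
      also have "\<dots> \<le> h * norm v + h * norm w"
        using that by (intro add_mono) (auto intro!: mult_right_mono)
      also have "\<dots> \<le> h * (norm v + norm w + 1)" using h by (simp add: algebra_simps)
      also have "\<dots> < r * (norm v + norm w + 1)" using h nv by (intro mult_strict_right_mono)
      also have "\<dots> = d" using nv by (simp add: r_def)
      finally show ?thesis .
    qed
    \<comment> \<open>Subtracting the bilinear term \<open>s t c\<close> makes the mixed derivative small; \<open>G\<close> is what remains
      of it after one derivative, \<open>F\<close> what remains after one difference.\<close>
    define G where "G s t = dir_deriv v f (x + s *\<^sub>R v + t *\<^sub>R w) - t *\<^sub>R c" for s t
    define F where "F s = f (x + s *\<^sub>R v + h *\<^sub>R w) - f (x + s *\<^sub>R v + 0 *\<^sub>R w) - (s * h) *\<^sub>R c" for s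
    have G: "norm (G s h - G s 0) \<le> (e / 2) * norm (h - 0)" if s: "s \<in> {0..h}" for s
    proof (rule differentiable_bound[where S = "{0..h}"])
      fix t assume t: "t \<in> {0..h}"
      show "(G s has_derivative
          (\<lambda>k. k *\<^sub>R (dir_deriv w (dir_deriv v f) (x + s *\<^sub>R v + t *\<^sub>R w) - c))) (at t within {0..h})"
      proof -
        have lin: "dir_deriv (k *\<^sub>R w) (dir_deriv v f) y = k *\<^sub>R dir_deriv w (dir_deriv v f) y" for k y
          by (rule linear_scale[OF has_derivative_linear[OF has_derivative_dir_deriv[OF D2]]])
        have "((\<lambda>t. dir_deriv v f (x + s *\<^sub>R v + t *\<^sub>R w)) has_derivative
            (\<lambda>k. dir_deriv (k *\<^sub>R w) (dir_deriv v f) (x + s *\<^sub>R v + t *\<^sub>R w))) (at t within {0..h})"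
          by (rule has_derivative_compose[OF _ has_derivative_dir_deriv[OF D2]])
             (auto intro!: derivative_eq_intros)
        then show ?thesis unfolding G_def lin
          by (auto intro!: derivative_eq_intros simp: algebra_simps)
      qed
      show "onorm (\<lambda>k. k *\<^sub>R (dir_deriv w (dir_deriv v f) (x + s *\<^sub>R v + t *\<^sub>R w) - c)) \<le> e / 2"
        by (rule onorm_scaleR_left_le[OF bd[OF near[OF s t]]])
    qed (use h in auto)
    have "norm (F h - F 0) \<le> ((e / 2) * h) * norm (h - 0)"
    proof (rule differentiable_bound[where S = "{0..h}"])
      fix s assume s: "s \<in> {0..h}"
      show "(F has_derivative (\<lambda>k. k *\<^sub>R (G s h - G s 0))) (at s within {0..h})"
      proof -
        have lin: "dir_deriv (k *\<^sub>R v) f y = k *\<^sub>R dir_deriv v f y" for k y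
          by (rule linear_scale[OF has_derivative_linear[OF has_derivative_dir_deriv[OF D1]]])
        have "((\<lambda>s. f (x + s *\<^sub>R v + t *\<^sub>R w)) has_derivative
            (\<lambda>k. dir_deriv (k *\<^sub>R v) f (x + s *\<^sub>R v + t *\<^sub>R w))) (at s within {0..h})" for t
          by (rule has_derivative_compose[OF _ has_derivative_dir_deriv[OF D1]])
             (auto intro!: derivative_eq_intros)
        note * = this[unfolded lin]
        have "(F has_derivative (\<lambda>k. k *\<^sub>R dir_deriv v f (x + s *\<^sub>R v + h *\<^sub>R w)
            - k *\<^sub>R dir_deriv v f (x + s *\<^sub>R v + 0 *\<^sub>R w) - (k * h) *\<^sub>R c)) (at s within {0..h})"
          unfolding F_def
          by (intro has_derivative_diff * has_derivative_scaleR_left has_derivative_mult_left has_derivative_ident)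
        then show ?thesis by (simp add: G_def algebra_simps)
      qed
      show "onorm (\<lambda>k. k *\<^sub>R (G s h - G s 0)) \<le> (e / 2) * h"
        using G[OF s] h by (intro onorm_scaleR_left_le) simp
    qed (use h in auto)
    moreover have "F h - F 0 = (f (x + h *\<^sub>R v + h *\<^sub>R w) - f (x + h *\<^sub>R v) - f (x + h *\<^sub>R w) + f x) - h\<^sup>2 *\<^sub>R c"
      by (simp add: F_def power2_eq_square)
    moreover define Z where "Z = f (x + h *\<^sub>R v + h *\<^sub>R w) - f (x + h *\<^sub>R v) - f (x + h *\<^sub>R w) + f x"
    ultimately have "norm (Z - h\<^sup>2 *\<^sub>R c) \<le> (e / 2) * h\<^sup>2"
      using h by (simp add: power2_eq_square)
    moreover have "Z /\<^sub>R h\<^sup>2 - c = (Z - h\<^sup>2 *\<^sub>R c) /\<^sub>R h\<^sup>2"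
      using h by (simp add: algebra_simps)
    then have "dist (Z /\<^sub>R h\<^sup>2) c = norm (Z - h\<^sup>2 *\<^sub>R c) / h\<^sup>2"
      by (simp add: dist_norm divide_inverse mult.commute)
    ultimately have "dist (Z /\<^sub>R h\<^sup>2) c \<le> e / 2"
      using h by (simp add: divide_le_eq)
    then show ?thesis using e unfolding Z_def by linarith
  qed
  then show "\<forall>\<^sub>F h in at_right 0. dist ((f (x + h *\<^sub>R v + h *\<^sub>R w) - f (x + h *\<^sub>R v) - f (x + h *\<^sub>R w) + f x) /\<^sub>R h\<^sup>2)
      (dir_deriv w (dir_deriv v f) x) < e"
    unfolding eventually_at_right_field c_def using r by blast
qed

text \<open>Clairaut: the second difference does not distinguish its two directions, hence neither do the
  limits.\<close>

lemma dir_deriv_commute: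
  fixes f :: "'a::euclidean_space \<Rightarrow> 'b::real_normed_vector"
  assumes "Ck 2 f"
  shows "dir_deriv v (dir_deriv w f) = dir_deriv w (dir_deriv v f)"
proof
  fix x
  have eq: "f (x + h *\<^sub>R w + h *\<^sub>R v) - f (x + h *\<^sub>R w) - f (x + h *\<^sub>R v) + f x =
      f (x + h *\<^sub>R v + h *\<^sub>R w) - f (x + h *\<^sub>R v) - f (x + h *\<^sub>R w) + f x" for h
    by (simp add: algebra_simps)
  show "dir_deriv v (dir_deriv w f) x = dir_deriv w (dir_deriv v f) x"
    using second_difference_tendsto[OF assms, of x w v] second_difference_tendsto[OF assms, of x v w]
    unfolding eq by (intro tendsto_unique[of "at_right (0::real)"]) auto
qed

section \<open>Smooth cut-off functions\<close>

text \<open>For \<open>p = 1\<close> this is the standard flat function \<open>exp (- 1 / t)\<close>; polynomials \<open>p\<close> in \<open>1 / t\<close>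
  are admitted because they are what differentiation produces.\<close>

definition flat_fun :: "real poly \<Rightarrow> real \<Rightarrow> real" where
  "flat_fun p t = (if t > 0 then poly p (1 / t) * exp (- (1 / t)) else 0)"

text \<open>The exponential decay beats every power of \<open>1 / t\<close>. With the quotient in place of the function,
  this also gives differentiability at the origin.\<close>

lemma flat_fun_quotient_tendsto: "((\<lambda>t. flat_fun p t / t) \<longlongrightarrow> 0) (at 0)"
proof -
  have "((\<lambda>s. poly (p * [:0, 1:]) s * exp (- s)) \<longlongrightarrow> 0) at_top"
  proof -
    have "((\<lambda>s::real. \<Sum>i\<le>degree q. coeff q i * (s ^ i / exp s)) \<longlongrightarrow> (\<Sum>i\<le>degree q. coeff q i * 0)) at_top"
      for q by (intro tendsto_intros tendsto_power_div_exp_0)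
    then show ?thesis
      by (simp add: poly_altdef sum_distrib_right exp_minus divide_inverse mult.assoc del: mult_pCons_right)
  qed
  then have "((\<lambda>t. poly (p * [:0, 1:]) (inverse t) * exp (- inverse t)) \<longlongrightarrow> 0) (at_right 0)"
    by (rule filterlim_compose[OF _ filterlim_inverse_at_top_right])
  moreover have "\<forall>\<^sub>F t in at_right 0. poly (p * [:0, 1:]) (inverse t) * exp (- inverse t) = flat_fun p t / t"
    by (auto simp: eventually_at_right_field flat_fun_def divide_inverse intro!: exI[of _ 1])
  ultimately have "((\<lambda>t. flat_fun p t / t) \<longlongrightarrow> 0) (at_right 0)"
    by (rule Lim_transform_eventually)
  moreover have "((\<lambda>t. flat_fun p t / t) \<longlongrightarrow> 0) (at_left 0)"
    by (rule tendsto_eventually) (auto simp: eventually_at_left_field flat_fun_def intro!: exI[of _ "-1"])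
  ultimately show ?thesis by (simp add: filterlim_split_at)
qed

lemma flat_fun_has_derivative:
  "(flat_fun p has_real_derivative flat_fun ([:0, 0, 1:] * (p - pderiv p)) t) (at t)"
proof -
  consider "t > 0" | "t < 0" | "t = 0" by linarith
  then show ?thesis
  proof cases
    case 1
    have "((\<lambda>t. poly p (1 / t) * exp (- (1 / t))) has_real_derivative
        flat_fun ([:0, 0, 1:] * (p - pderiv p)) t) (at t)"
      using 1 by (auto intro!: derivative_eq_intros poly_DERIV[THEN DERIV_chain2] simp: flat_fun_def field_simps power2_eq_square)
    then show ?thesis
      by (rule has_field_derivative_transform_within[OF _ 1]) (use 1 in \<open>auto simp: flat_fun_def dist_real_def\<close>)
  next
    case 2
    have "((\<lambda>t. 0) has_real_derivative 0) (at t)" by simp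
    then show ?thesis
      using 2 by (rule_tac has_field_derivative_transform_within[where f = "\<lambda>t. 0" and d = "-t"])
        (auto simp: flat_fun_def dist_real_def)
  next
    case 3
    then show ?thesis using flat_fun_quotient_tendsto[of p]
      by (simp add: has_field_derivative_iff flat_fun_def[of _ 0])
  qed
qed

lemma Ck_flat_fun: "Ck k u \<Longrightarrow> Ck k (\<lambda>x. flat_fun p (u x))"
proof (induction k arbitrary: p)
  case 0
  have "continuous_on UNIV (flat_fun p)"
    using flat_fun_has_derivative DERIV_isCont by (blast intro: continuous_at_imp_continuous_on)
  with 0 show ?case by (auto intro: continuous_on_compose2)
next
  case (Suc k)
  show ?case
  proof (rule Ck_SucI)
    show "((\<lambda>x. flat_fun p (u x)) has_derivative
      (\<lambda>v. flat_fun ([:0, 0, 1:] * (p - pderiv p)) (u x) * dir_deriv v u x)) (at x)" for x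
      using flat_fun_has_derivative[of p "u x"] Suc.prems has_derivative_dir_deriv[of u x]
      unfolding has_field_derivative_def
      by (auto dest: has_derivative_compose)
    show "Ck k (\<lambda>x. flat_fun ([:0, 0, 1:] * (p - pderiv p)) (u x) * dir_deriv v u x)" for v
      using Suc Ck_SucD[OF Suc.prems] by (intro Ck_mult) (auto simp del: mult_pCons_left)
  qed
qed

lemma Ck_norm_square: "Ck k (\<lambda>x::'a::euclidean_space. x \<bullet> x)"
proof (cases k)
  case (Suc j)
  have "Ck (Suc j) (\<lambda>x::'a. x \<bullet> x)"
  proof (rule Ck_SucI)
    show "((\<lambda>x::'a. x \<bullet> x) has_derivative (\<lambda>v. 2 * (v \<bullet> x))) (at x)" for x
      by (auto intro!: derivative_eq_intros simp: inner_commute)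
    show "Ck j (\<lambda>x::'a. 2 * (v \<bullet> x))" for v
      by (intro Ck_mult Ck_const Ck_bounded_linear bounded_linear_inner_right)
  qed
  with Suc show ?thesis by simp
qed (auto intro: continuous_intros)

text \<open>A quotient of two flat functions interpolates smoothly between 1 on the ball of radius
  \<open>r + 1\<close> and 0 outside the ball of radius \<open>r + 2\<close>; the denominator has no zeros because the
  intervals on which its two terms vanish are disjoint.\<close>

lemma cutoff_exists:
  assumes "r \<ge> (0::real)"
  shows "\<exists>\<theta> :: 'a::euclidean_space \<Rightarrow> complex. test_function \<theta> \<and>
     (\<exists>U. open U \<and> cball 0 r \<subseteq> U \<and> (\<forall>p\<in>U. \<theta> p = 1))"
proof -
  define a where "a x = flat_fun 1 ((r + 2)\<^sup>2 + -1 * (x \<bullet> x))" for x :: 'a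
  define b where "b x = flat_fun 1 (- ((r + 1)\<^sup>2) + x \<bullet> x)" for x :: 'a
  define \<theta> where "\<theta> x = complex_of_real (a x * inverse (a x + b x))" for x
  have lt: "(r + 1)\<^sup>2 < (r + 2)\<^sup>2" using assms by (intro power_strict_mono) auto
  have nn: "a x \<ge> 0" "b x \<ge> 0" for x by (auto simp: a_def b_def flat_fun_def)
  have "a x + b x \<noteq> 0" for x
  proof -
    have "a x > 0 \<or> b x > 0" using lt by (auto simp: a_def b_def flat_fun_def)
    then show ?thesis using nn[of x] by linarith
  qed
  moreover have "Ck k a" "Ck k b" for k
    unfolding a_def b_def
    by (intro Ck_flat_fun Ck_add Ck_mult Ck_const Ck_norm_square)+
  ultimately have "Ck k \<theta>" for k
    unfolding \<theta>_def by (intro Ck_of_real Ck_mult Ck_inverse Ck_add)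
  moreover have "compact (closure {x. \<theta> x \<noteq> 0})"
  proof -
    have "{x. \<theta> x \<noteq> 0} \<subseteq> cball 0 (r + 2)"
    proof
      fix x assume "x \<in> {x. \<theta> x \<noteq> 0}"
      then have "(norm x)\<^sup>2 \<le> (r + 2)\<^sup>2"
        by (auto simp: \<theta>_def a_def flat_fun_def power2_norm_eq_inner split: if_splits)
      then show "x \<in> cball 0 (r + 2)" using assms by (simp add: power2_le_iff_abs_le)
    qed
    then show ?thesis by (meson bounded_cball bounded_subset compact_closure)
  qed
  moreover have "\<theta> x = 1" if "x \<in> ball 0 (r + 1)" for x
  proof -
    have "(norm x)\<^sup>2 < (r + 1)\<^sup>2" using that assms by (intro power_strict_mono) auto
    then have "b x = 0" "a x > 0" using lt by (auto simp: a_def b_def flat_fun_def power2_norm_eq_inner)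
    then show ?thesis by (simp add: \<theta>_def)
  qed
  ultimately show ?thesis
    unfolding test_function_def
    by (intro exI[of _ \<theta>] conjI exI[of _ "ball 0 (r + 1)"]) auto
qed

section \<open>Entire functions are smooth\<close>

lemma axis_zero [simp]: "axis i 0 = 0"
  by simp

text \<open>The second order bound along one complex axis holds uniformly near \<open>z\<close>. Uniformity is what
  permits moving several coordinates at once.\<close>

lemma entire_axis_expansion:
  assumes f: "entire_fun f"
  shows "\<exists>M. \<forall>w\<in>cball z 1. \<forall>t. norm t \<le> 1 \<longrightarrow>
    norm (f (w + axis i t) - f w - t * pderiv_fun i f w) \<le> M * (norm t)\<^sup>2"
proof -
  have "continuous_on (cball z 3) f"
    using f by (auto simp: entire_fun_def intro: continuous_on_subset)
  then have "bounded (f ` cball z 3)"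
    by (intro compact_imp_bounded compact_continuous_image) auto
  then obtain M where M: "\<And>w. w \<in> cball z 3 \<Longrightarrow> norm (f w) \<le> M"
    unfolding bounded_iff by blast
  have "norm (f (w + axis i t) - f w - t * pderiv_fun i f w) \<le> 2 * M * (norm t)\<^sup>2"
    if w: "w \<in> cball z 1" and t: "norm t \<le> 1" for w t
  proof (cases "t = 0")
    case False
    let ?F = "\<lambda>t. f (w + axis i t)"
    have "norm ((?F t - ?F 0) / t - deriv ?F 0) \<le> 2 * M * norm t"
    proof (rule diff_quotient_bound[OF _ _ False t])
      show "?F holomorphic_on UNIV" using f by (simp add: entire_fun_def)
      fix s :: complex assume s: "norm s \<le> 2"
      show "norm (?F s) \<le> M"
      proof (rule M)
        have "norm (w + axis i s - z) \<le> norm (w - z) + norm (axis i s :: complex^4)"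
          by (metis add_diff_eq add.commute norm_triangle_ineq)
        also have "\<dots> \<le> 3" using w s by (simp add: norm_axis dist_norm norm_minus_commute)
        finally show "w + axis i s \<in> cball z 3" by (simp add: dist_norm norm_minus_commute)
      qed
    qed
    then have "norm t * norm ((?F t - ?F 0) / t - deriv ?F 0) \<le> norm t * (2 * M * norm t)"
      by (intro mult_left_mono) auto
    moreover have "norm t * norm ((?F t - ?F 0) / t - deriv ?F 0) = norm (f (w + axis i t) - f w - t * pderiv_fun i f w)"
      using False unfolding norm_mult[symmetric] right_diff_distrib by (simp add: pderiv_fun_def)
    ultimately show ?thesis by (simp add: power2_eq_square mult_ac)
  qed simp
  then show ?thesis by blast
qed

text \<open>The coordinates are switched on one after another. Each step contributes a partial derivative
  at the point reached so far and a remainder of second order; by continuity, the partial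
  derivative may be taken at \<open>z\<close> instead.\<close>

lemma entire_has_derivative_0:
  assumes f: "entire_fun f"
  shows "((\<lambda>h. f (z + (\<Sum>i\<in>J. axis i (h $ i)))) has_derivative (\<lambda>h. \<Sum>i\<in>J. h $ i * pderiv_fun i f z)) (at 0)"
proof (induction J rule: infinite_finite_induct)
  case (insert j J)
  let ?w = "\<lambda>h. z + (\<Sum>i\<in>J. axis i (h $ i)) :: complex^4"
  have w0: "?w 0 = z" by simp
  have wc: "continuous (at 0) ?w"
  proof -
    have "continuous_on UNIV ?w" by (intro continuous_intros)
    then show ?thesis by (simp add: continuous_on_eq_continuous_at)
  qed
  obtain M where M: "\<And>w t. w \<in> cball z 1 \<Longrightarrow> norm t \<le> 1 \<Longrightarrow>
      norm (f (w + axis j t) - f w - t * pderiv_fun j f w) \<le> M * (norm t)\<^sup>2"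
    using entire_axis_expansion[OF f, of z j] by blast
  have M0: "M \<ge> 0" using order_trans[OF norm_ge_zero M[of z 1]] by simp
  define r where "r h = f (?w h + axis j (h $ j)) - f (?w h) - h $ j * pderiv_fun j f (?w h)" for h
  have rest: "(r has_derivative (\<lambda>h. 0)) (at 0)"
    unfolding has_derivative_at
  proof
    have "((\<lambda>h::complex^4. M * norm h) \<longlongrightarrow> M * norm (0::complex^4)) (at 0)"
      by (intro tendsto_intros)
    then have *: "((\<lambda>h::complex^4. M * norm h) \<longlongrightarrow> 0) (at 0)" by simp
    show "(\<lambda>h. norm (r (0 + h) - r 0 - 0) / norm h) \<midarrow>0\<rightarrow> 0"
    proof (rule tendsto_0_le[OF *, where K = 1])
      have "\<forall>\<^sub>F h in at 0. dist (?w h) (?w 0) < 1"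
        using wc unfolding continuous_at by (rule tendstoD) simp
      moreover have "\<forall>\<^sub>F h in at 0. dist h (0::complex^4) < 1"
        by (auto simp: eventually_at intro: exI[of _ 1])
      ultimately show "\<forall>\<^sub>F h in at 0. norm (norm (r (0 + h) - r 0 - 0) / norm h) \<le> norm (M * norm h) * 1"
      proof eventually_elim
        case (elim h)
        have nh: "norm (h $ j) \<le> norm h" by (rule Finite_Cartesian_Product.norm_nth_le)
        have "norm (r h) \<le> M * (norm (h $ j))\<^sup>2"
          unfolding r_def using elim nh by (intro M) (auto simp: dist_norm norm_minus_commute)
        also have "\<dots> \<le> M * (norm h)\<^sup>2" using nh M0 by (intro mult_left_mono power_mono) auto
        finally have "norm (r h) / norm h \<le> M * norm h"
          by (cases "h = 0") (auto simp: divide_le_eq power2_eq_square)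
        then show ?case using M0 by (simp add: r_def)
      qed
    qed
  qed simp
  have "((\<lambda>h. h $ j * pderiv_fun j f (?w h)) has_derivative (\<lambda>h. h $ j * pderiv_fun j f z)) (at 0)"
  proof -
    have c: "continuous (at 0) (\<lambda>h. pderiv_fun j f (?w h))"
      using pderiv_fun_continuous[OF f, of j]
      by (intro isCont_o2[OF wc]) (simp add: continuous_on_eq_continuous_at)
    show ?thesis
      unfolding has_derivative_at
    proof
      show "bounded_linear (\<lambda>h. h $ j * pderiv_fun j f z)"
        by (intro bounded_linear_mult_const bounded_linear_vec_nth)
      have "((\<lambda>h. norm (pderiv_fun j f (?w h) - pderiv_fun j f z)) \<longlongrightarrow> norm (pderiv_fun j f (?w 0) - pderiv_fun j f z)) (at 0)"
        using c unfolding continuous_at by (intro tendsto_intros)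
      then have *: "((\<lambda>h. norm (pderiv_fun j f (?w h) - pderiv_fun j f z)) \<longlongrightarrow> 0) (at 0)"
        by simp
      show "(\<lambda>h. norm ((0 + h) $ j * pderiv_fun j f (?w (0 + h)) - 0 $ j * pderiv_fun j f (?w 0)
          - h $ j * pderiv_fun j f z) / norm h) \<midarrow>0\<rightarrow> 0"
      proof (rule tendsto_0_le[OF *, where K = 1], rule always_eventually, rule allI)
        fix h :: "complex^4"
        have nh: "norm (h $ j) \<le> norm h" by (rule Finite_Cartesian_Product.norm_nth_le)
        have "norm (h $ j * pderiv_fun j f (?w h) - h $ j * pderiv_fun j f z) =
          norm (h $ j) * norm (pderiv_fun j f (?w h) - pderiv_fun j f z)"
          by (simp add: norm_mult[symmetric] right_diff_distrib)
        also have "\<dots> \<le> norm h * norm (pderiv_fun j f (?w h) - pderiv_fun j f z)"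
          using nh by (rule mult_right_mono) simp
        finally show "norm (norm ((0 + h) $ j * pderiv_fun j f (?w (0 + h)) - 0 $ j * pderiv_fun j f (?w 0)
          - h $ j * pderiv_fun j f z) / norm h) \<le> norm (norm (pderiv_fun j f (?w h) - pderiv_fun j f z)) * 1"
          by (cases "h = 0") (auto simp: divide_le_eq mult.commute)
      qed
    qed
  qed
  from has_derivative_add[OF has_derivative_add[OF rest this] insert.IH]
  have "((\<lambda>h. f (?w h + axis j (h $ j))) has_derivative
      (\<lambda>h. 0 + h $ j * pderiv_fun j f z + (\<Sum>i\<in>J. h $ i * pderiv_fun i f z))) (at 0)"
    by (simp add: r_def)
  then show ?case using insert.hyps by (simp add: add_ac)
qed simp_all

lemma entire_has_derivative:
  assumes "entire_fun f"
  shows "(f has_derivative (\<lambda>h. \<Sum>i\<in>UNIV. h $ i * pderiv_fun i f z)) (at z)"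
proof -
  have eq: "(\<Sum>i\<in>UNIV. axis i (h $ i)) = h" for h :: "complex^4"
    by (simp add: vec_eq_iff axis_def sum.delta' if_distrib)
  show ?thesis
    using entire_has_derivative_0[OF assms, of z UNIV] unfolding eq
    by (simp add: has_derivative_at)
qed

text \<open>The derivatives of an entire function are combinations of its partial derivatives, which are
  entire again. The linear map \<open>g\<close> is the identity or the parametrisation of the real form.\<close>

lemma Ck_entire:
  assumes "entire_fun f" "bounded_linear g" shows "Ck k (\<lambda>x. f (g x))"
  using assms(1)
proof (induction k arbitrary: f)
  case 0
  then show ?case using assms(2)
    by (auto simp: entire_fun_def intro: continuous_on_compose2 linear_continuous_on)
next
  case (Suc k)
  show ?case
  proof (rule Ck_SucI)
    show "((\<lambda>x. f (g x)) has_derivative (\<lambda>v. \<Sum>i\<in>UNIV. g v $ i * pderiv_fun i f (g x))) (at x)" for x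
      by (rule has_derivative_compose[OF bounded_linear_imp_has_derivative[OF assms(2)]
            entire_has_derivative[OF Suc.prems]])
    show "Ck k (\<lambda>x. \<Sum>i\<in>UNIV. g v $ i * pderiv_fun i f (g x))" for v
      unfolding sum_4 by (intro Ck_add Ck_mult Ck_const Suc.IH entire_pderiv_fun Suc.prems)
  qed
qed

lemma dir_deriv_entire:
  assumes "entire_fun f" "bounded_linear g"
  shows "dir_deriv v (\<lambda>x. f (g x)) x = (\<Sum>i\<in>UNIV. g v $ i * pderiv_fun i f (g x))"
  by (rule dir_deriv_eqI)
     (rule has_derivative_compose[OF bounded_linear_imp_has_derivative[OF assms(2)]
            entire_has_derivative[OF assms(1)]])

lemma pderiv_fun_eq_dir_deriv:
  "entire_fun f \<Longrightarrow> pderiv_fun i f = dir_deriv (axis i 1) f"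
  using dir_deriv_entire[OF _ bounded_linear_ident, of f "axis i 1"]
  by (simp add: fun_eq_iff axis_def if_distrib[of "\<lambda>x. x * _"] cong: if_cong)

text \<open>Without this identity the normal form of a differential operator would not be unique.\<close>

lemma pderiv_entire_commute: "pderiv_entire i (pderiv_entire j f) = pderiv_entire j (pderiv_entire i f)"
proof transfer
  fix i j f assume f: "entire_fun f"
  then show "pderiv_fun i (pderiv_fun j f) = pderiv_fun j (pderiv_fun i f)"
  proof -
    have "pderiv_fun i (pderiv_fun j f) = dir_deriv (axis i 1) (dir_deriv (axis j 1) f)" for i j
      using f by (metis pderiv_fun_eq_dir_deriv entire_pderiv_fun)
    then show ?thesis using dir_deriv_commute[OF Ck_entire[OF f bounded_linear_ident]] by simp
  qed
qed

lemma pderiv_entire_mult: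
  "pderiv_entire i (f * g) = pderiv_entire i f * g + f * pderiv_entire i g"
proof transfer
  fix i f g assume "entire_fun f" "entire_fun g"
  then show "pderiv_fun i (\<lambda>z. f z * g z) = (\<lambda>z. pderiv_fun i f z * g z + f z * pderiv_fun i g z)"
    unfolding pderiv_fun_def
    by (auto simp: deriv_mult entire_fun_differentiable add.commute)
qed

lemma pderiv_entire_const [simp]: "pderiv_entire i (const_entire c) = 0"
  by transfer (simp add: pderiv_fun_def)

lemma pderiv_entire_coord: "pderiv_entire i (coord_entire j) = (if i = j then 1 else 0)"
proof transfer
  fix i j :: 4
  have "deriv (\<lambda>t. (z + axis i t) $ j) 0 = (if i = j then 1 else 0)" for z :: "complex^4"
    by (rule DERIV_imp_deriv) (cases "i = j"; auto simp: axis_def intro!: derivative_eq_intros)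
  then show "pderiv_fun i (\<lambda>z. z $ j) = (if i = j then \<lambda>_. 1 else (\<lambda>_. 0))"
    unfolding pderiv_fun_def by (simp add: fun_eq_iff del: vector_add_component)
qed

section \<open>The formal adjoint\<close>

text \<open>An element of the ring is built from the generators, so identities that are compatible with
  sums and products need only be checked on generators.\<close>

lemma diffop_induct [case_names const coord pderiv add mult]:
  assumes "\<And>c. Q (const_op c)" "\<And>i. Q (z_op i)" "\<And>i. Q (d_op i)"
    and "\<And>R S. Q R \<Longrightarrow> Q S \<Longrightarrow> Q (R + S)" "\<And>R S. Q R \<Longrightarrow> Q S \<Longrightarrow> Q (R * S)"
  shows "Q P"
proof -
  have "Q (Abs_diffop F)" if "F \<in> diff_ops" for F
    using that
  proof (induction rule: diff_ops.induct)
    case (add F G)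
    then show ?case using assms(4)[of "Abs_diffop F" "Abs_diffop G"]
      by (simp add: plus_diffop_def Abs_diffop_inverse)
  next
    case (comp F G)
    then show ?case using assms(5)[of "Abs_diffop F" "Abs_diffop G"]
      by (simp add: times_diffop_def Abs_diffop_inverse)
  qed (use assms(1-3) in \<open>simp_all add: const_op_def z_op_def d_op_def\<close>)
  from this[OF apply_diffop[of P]] show ?thesis by (simp add: apply_diffop_inverse)
qed

lemma d_op_commute: "d_op i * d_op j = d_op j * d_op i"
  by transfer (simp add: pderiv_entire_commute)

lemma d_op_z_op: "d_op i * z_op j = z_op j * d_op i + (if i = j then 1 else 0)"
  by transfer (simp add: pderiv_entire_mult pderiv_entire_coord fun_eq_iff)

lemma const_op_simps: "const_op 0 = 0" "const_op 1 = 1"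
  by (transfer; simp add: const_entire_simps)+

lemma const_entire_add: "const_entire (a + b) = const_entire a + const_entire b"
  by transfer simp

lemma const_entire_mult: "const_entire (a * b) = const_entire a * const_entire b"
  by transfer simp

lemma const_op_add: "const_op (a + b) = const_op a + const_op b"
  by transfer (simp add: const_entire_add distrib_right fun_eq_iff)

lemma of_nat_diffop: "of_nat n = const_op (of_nat n)"
  by (induction n) (auto simp: const_op_simps const_op_add)

lemma apply_diffop_const_mult: "apply_diffop P (const_entire c * f) = const_entire c * apply_diffop P f"
  by (induction P arbitrary: f rule: diffop_induct)
     (simp_all add: const_op.rep_eq z_op.rep_eq d_op.rep_eq plus_diffop.rep_eq times_diffop.rep_eq
        pderiv_entire_const_mult distrib_left mult.left_commute)

lemma const_op_commute: "const_op c * P = P * const_op c"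
  by (simp add: times_diffop.rep_eq const_op.rep_eq apply_diffop_const_mult flip: apply_diffop_inject)

text \<open>The operators of order zero. They serve as the coefficients of the normal form, so that the
  monomials in the coordinates never have to be separated.\<close>

definition mult_ops :: "diffop set" where
  "mult_ops = {m. \<exists>p. \<forall>f. apply_diffop m f = p * f}"

lemma mult_opsI: "(\<And>f. apply_diffop m f = p * f) \<Longrightarrow> m \<in> mult_ops"
  by (auto simp: mult_ops_def)

lemma mult_opsE:
  assumes "m \<in> mult_ops" obtains p where "\<And>f. apply_diffop m f = p * f"
  using assms by (auto simp: mult_ops_def)

lemma mult_ops_gen: "const_op c \<in> mult_ops" "z_op i \<in> mult_ops"
  by (rule mult_opsI, simp add: const_op.rep_eq z_op.rep_eq)+

lemma mult_ops_mult:
  assumes "m \<in> mult_ops" "n \<in> mult_ops" shows "m * n \<in> mult_ops"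
proof -
  obtain p q where "\<And>f. apply_diffop m f = p * f" "\<And>f. apply_diffop n f = q * f"
    using assms by (metis mult_opsE)
  then show ?thesis
    by (intro mult_opsI[of _ "p * q"]) (simp add: times_diffop.rep_eq mult.assoc)
qed

lemma mult_ops_add:
  assumes "m \<in> mult_ops" "n \<in> mult_ops" shows "m + n \<in> mult_ops"
proof -
  obtain p q where "\<And>f. apply_diffop m f = p * f" "\<And>f. apply_diffop n f = q * f"
    using assms by (metis mult_opsE)
  then show ?thesis
    by (intro mult_opsI[of _ "p + q"]) (simp add: plus_diffop.rep_eq distrib_right)
qed

lemma mult_ops_commute:
  assumes "m \<in> mult_ops" "n \<in> mult_ops" shows "m * n = n * m"
proof -
  obtain p q where "\<And>f. apply_diffop m f = p * f" "\<And>f. apply_diffop n f = q * f"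
    using assms by (metis mult_opsE)
  then have "apply_diffop m (apply_diffop n f) = apply_diffop n (apply_diffop m f)" for f
    by (simp add: mult.left_commute)
  then show ?thesis by (simp add: times_diffop.rep_eq flip: apply_diffop_inject)
qed

lemma mult_ops_commutator:
  assumes "m \<in> mult_ops" shows "d_op i * m - m * d_op i \<in> mult_ops"
proof -
  obtain p where "\<And>f. apply_diffop m f = p * f"
    using assms by (metis mult_opsE)
  then show ?thesis
    by (intro mult_opsI[of _ "pderiv_entire i p"])
       (simp add: minus_diffop.rep_eq times_diffop.rep_eq d_op.rep_eq pderiv_entire_mult)
qed

definition mpow :: "(4 \<Rightarrow> 'a::monoid_mult) \<Rightarrow> (4 \<Rightarrow> nat) \<Rightarrow> 'a" where
  "mpow x b = x 1 ^ b 1 * x 2 ^ b 2 * x 3 ^ b 3 * x 4 ^ b 4"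

lemma mpow_Suc:
  assumes "\<And>i j. x i * x j = x j * x i"
  shows "x i * mpow x b = mpow x (b(i := Suc (b i)))" "mpow x b * x i = mpow x (b(i := Suc (b i)))"
proof -
  have c: "x j ^ n * x i = x i * x j ^ n" for j n
    by (rule power_commuting_commutes) (rule assms)
  have c': "x j ^ n * (x i * y) = x i * (x j ^ n * y)" for j n y
    using c[of j n] by (metis mult.assoc)
  show 1: "x i * mpow x b = mpow x (b(i := Suc (b i)))"
    using exhaust_4[of i] c' unfolding mpow_def mult.assoc
    by (elim disjE) (simp_all add: mult.assoc)
  have "mpow x b * x i = x i * mpow x b"
    unfolding mpow_def mult.assoc by (simp only: c c')
  with 1 show "mpow x b * x i = mpow x (b(i := Suc (b i)))" by simp
qed

abbreviation dpow :: "(4 \<Rightarrow> nat) \<Rightarrow> diffop" where "dpow \<equiv> mpow d_op"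
abbreviation mdpow :: "(4 \<Rightarrow> nat) \<Rightarrow> diffop" where "mdpow \<equiv> mpow (\<lambda>i. - d_op i)"

lemma dpow_Suc: "d_op i * dpow b = dpow (b(i := Suc (b i)))"
  by (intro mpow_Suc d_op_commute)

lemma mdpow_Suc: "mdpow (b(i := Suc (b i))) = - (mdpow b * d_op i)"
  using mpow_Suc(2)[of "\<lambda>i. - d_op i" b i] by (simp add: d_op_commute)

text \<open>The graph of the formal adjoint on operators in the normal form \<open>\<Sum>\<^sub>b m\<^sub>b \<partial>\<^sup>b\<close>, whose adjoint is
  \<open>\<Sum>\<^sub>b (-\<partial>)\<^sup>b m\<^sub>b\<close>. As a relation it is visibly additive; it has to be shown that it is total and
  single-valued.\<close>

inductive adj :: "diffop \<Rightarrow> diffop \<Rightarrow> bool" where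
  zero: "adj 0 0"
| step: "adj P Q \<Longrightarrow> m \<in> mult_ops \<Longrightarrow> adj (P + m * dpow b) (Q + mdpow b * m)"

lemma adj_add: "adj P Q \<Longrightarrow> adj P' Q' \<Longrightarrow> adj (P + P') (Q + Q')"
proof (induction rule: adj.induct)
  case (step P Q m b)
  then have "adj (P + P' + m * dpow b) (Q + Q' + mdpow b * m)" by (intro adj.step)
  then show ?case by (simp add: ac_simps)
qed simp

lemma adj_mult_ops: "adj P Q \<Longrightarrow> m \<in> mult_ops \<Longrightarrow> adj (m * P) (Q * m)"
proof (induction rule: adj.induct)
  case (step P Q n b)
  then have "adj (m * P + (m * n) * dpow b) (Q * m + mdpow b * (m * n))"
    by (intro adj.step mult_ops_mult)
  moreover have "m * n = n * m" using step by (intro mult_ops_commute)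
  ultimately have "adj (m * P + (m * n) * dpow b) (Q * m + mdpow b * (n * m))" by simp
  then show ?case by (simp add: distrib_left distrib_right mult.assoc)
qed (simp add: adj.zero)

lemma adj_d_op: "adj P Q \<Longrightarrow> adj (d_op i * P) (Q * - d_op i)"
proof (induction rule: adj.induct)
  case (step P Q n b)
  let ?b = "b(i := Suc (b i))"
  have "adj (d_op i * P + (d_op i * n - n * d_op i) * dpow b + n * dpow ?b)
      (Q * - d_op i + mdpow b * (d_op i * n - n * d_op i) + mdpow ?b * n)"
    using step by (intro adj.step mult_ops_commutator)
  moreover have "d_op i * P + (d_op i * n - n * d_op i) * dpow b + n * dpow ?b = d_op i * (P + n * dpow b)"
    by (simp add: algebra_simps flip: dpow_Suc)
  moreover have "Q * - d_op i + mdpow b * (d_op i * n - n * d_op i) + mdpow ?b * n = (Q + mdpow b * n) * - d_op i"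
    by (simp add: algebra_simps mdpow_Suc)
  ultimately show ?case by simp
qed (simp add: adj.zero)

text \<open>Left multiplication by a generator brings an operator in normal form back to normal form, and
  the adjoints follow by right multiplication. Applied to \<open>Q = 1\<close> this gives totality, and in
  general it gives anti-multiplicativity.\<close>

lemma adj_left_mult: "\<exists>P'. \<forall>Q Q'. adj Q Q' \<longrightarrow> adj (P * Q) (Q' * P')"
proof (induction P rule: diffop_induct)
  case (add R S)
  then obtain R' S' where "\<And>Q Q'. adj Q Q' \<Longrightarrow> adj (R * Q) (Q' * R')" "\<And>Q Q'. adj Q Q' \<Longrightarrow> adj (S * Q) (Q' * S')"
    by blast
  then show ?case by (intro exI[of _ "R' + S'"]) (simp add: distrib_left distrib_right adj_add)
next
  case (mult R S)
  then obtain R' S' where "\<And>Q Q'. adj Q Q' \<Longrightarrow> adj (R * Q) (Q' * R')" "\<And>Q Q'. adj Q Q' \<Longrightarrow> adj (S * Q) (Q' * S')"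
    by blast
  then show ?case by (intro exI[of _ "S' * R'"]) (metis mult.assoc)
qed (use adj_mult_ops mult_ops_gen adj_d_op in blast)+

text \<open>Distinct characters of a commutative monoid are linearly independent (Dedekind). This is
  used for monomials, which are characters of the multiplicative monoid of vectors.\<close>

lemma dedekind_independence:
  fixes ch :: "'i \<Rightarrow> 'm::comm_monoid_mult \<Rightarrow> 'k::field"
  assumes "finite A" and mult: "\<And>a x y. a \<in> A \<Longrightarrow> ch a (x * y) = ch a x * ch a y"
    and one: "\<And>a. a \<in> A \<Longrightarrow> ch a 1 = 1"
    and inj: "\<And>a b. a \<in> A \<Longrightarrow> b \<in> A \<Longrightarrow> a \<noteq> b \<Longrightarrow> \<exists>x. ch a x \<noteq> ch b x"
    and zero: "\<And>x. (\<Sum>a\<in>A. c a * ch a x) = 0"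
  shows "a \<in> A \<Longrightarrow> c a = 0"
  using assms
proof (induction A arbitrary: c a rule: finite_induct)
  case (insert b A)
  have A: "c a = 0" if a: "a \<in> A" for a
  proof -
    obtain y where y: "ch a y \<noteq> ch b y" using insert.prems(4)[of a b] insert.hyps a by blast
    \<comment> \<open>Translating the relation by \<open>y\<close> and subtracting \<open>ch b y\<close> times the relation removes \<open>b\<close>.\<close>
    have "(\<Sum>a\<in>A. (c a * (ch a y - ch b y)) * ch a x) = 0" for x
    proof -
      have "(\<Sum>a\<in>A. (c a * (ch a y - ch b y)) * ch a x) =
          (\<Sum>a\<in>insert b A. c a * ch a (y * x)) - ch b y * (\<Sum>a\<in>insert b A. c a * ch a x)"
        using insert.hyps insert.prems(2)
        by (simp add: sum_distrib_left algebra_simps sum_subtractf)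
      then show ?thesis using insert.prems(5) by simp
    qed
    with insert.IH[OF a, of "\<lambda>a. c a * (ch a y - ch b y)"] insert.prems have "c a * (ch a y - ch b y) = 0"
      by simp
    with y show ?thesis by simp
  qed
  moreover have "c b = 0"
    using insert.prems(5)[of 1] insert.prems(3) insert.hyps A by simp
  ultimately show ?case using insert.prems by blast
qed simp

text \<open>Exponentials are joint eigenfunctions of the partial derivatives, so they turn an operator into
  a polynomial in the eigenvalues.\<close>

lift_definition exp_entire :: "complex^4 \<Rightarrow> entire" is "\<lambda>\<zeta> z. exp (\<Sum>i\<in>UNIV. \<zeta> $ i * z $ i)"
proof -
  fix \<zeta> :: "complex^4"
  have "(\<lambda>t. exp (\<Sum>i\<in>UNIV. \<zeta> $ i * (z + axis j t) $ i)) holomorphic_on UNIV" for z j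
  proof -
    have "(\<Sum>i\<in>UNIV. \<zeta> $ i * (z + axis j t) $ i) = (\<Sum>i\<in>UNIV. \<zeta> $ i * z $ i) + \<zeta> $ j * t" for t
      by (simp add: distrib_left sum.distrib axis_def if_distrib[of "\<lambda>x. _ * x"] cong: if_cong)
    then show ?thesis by (auto intro!: holomorphic_intros)
  qed
  then show "entire_fun (\<lambda>z. exp (\<Sum>i\<in>UNIV. \<zeta> $ i * z $ i))"
    by (auto simp: entire_fun_def intro!: continuous_intros)
qed

lemma pderiv_exp_entire: "pderiv_entire i (exp_entire \<zeta>) = const_entire (\<zeta> $ i) * exp_entire \<zeta>"
proof transfer
  fix i and \<zeta> :: "complex^4"
  have "(\<Sum>k\<in>UNIV. \<zeta> $ k * (z + axis i t) $ k) = (\<Sum>k\<in>UNIV. \<zeta> $ k * z $ k) + \<zeta> $ i * t" for z t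
    by (simp add: distrib_left sum.distrib axis_def if_distrib[of "\<lambda>x. _ * x"] cong: if_cong)
  then show "pderiv_fun i (\<lambda>z. exp (\<Sum>k\<in>UNIV. \<zeta> $ k * z $ k)) =
      (\<lambda>z. \<zeta> $ i * exp (\<Sum>k\<in>UNIV. \<zeta> $ k * z $ k))"
    unfolding pderiv_fun_def
    by (intro ext DERIV_imp_deriv) (auto intro!: derivative_eq_intros)
qed

lemma d_op_power_exp:
  "apply_diffop (P * d_op i ^ n) (exp_entire \<zeta>) = const_entire (\<zeta> $ i ^ n) * apply_diffop P (exp_entire \<zeta>)"
proof (induction n)
  case (Suc n)
  have "apply_diffop (P * d_op i ^ Suc n) (exp_entire \<zeta>) =
      apply_diffop (P * d_op i ^ n) (const_entire (\<zeta> $ i) * exp_entire \<zeta>)"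
    by (simp only: power_Suc2 mult.assoc[symmetric] times_diffop.rep_eq[of _ "d_op i"] d_op.rep_eq pderiv_exp_entire)
  also have "\<dots> = const_entire (\<zeta> $ i) * (const_entire (\<zeta> $ i ^ n) * apply_diffop P (exp_entire \<zeta>))"
    by (simp only: apply_diffop_const_mult Suc)
  finally show ?case by (simp add: const_entire_mult mult.assoc)
qed (simp add: const_entire_simps)

lemma dpow_exp:
  "eval_entire (apply_diffop (m * dpow b) (exp_entire \<zeta>)) z =
    mpow (\<lambda>i. \<zeta> $ i) b * eval_entire (apply_diffop m (exp_entire \<zeta>)) z"
  unfolding mpow_def mult.assoc[symmetric] d_op_power_exp
  by (simp add: times_entire.rep_eq const_entire.rep_eq mult_ac)

lemma mpow_independent:
  fixes c :: "(4 \<Rightarrow> nat) \<Rightarrow> complex"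
  assumes "finite A" "\<And>\<zeta>::complex^4. (\<Sum>b\<in>A. c b * mpow (\<lambda>i. \<zeta> $ i) b) = 0" "b \<in> A"
  shows "c b = 0"
  \<comment> \<open>Distinct exponents are separated by a vector with entry 2 in one place and 1 elsewhere.\<close>
proof (rule dedekind_independence[where ch = "\<lambda>b (\<zeta>::complex^4). mpow (\<lambda>i. \<zeta> $ i) b", OF assms(1)])
  show "\<exists>x::complex^4. mpow (\<lambda>i. x $ i) a \<noteq> mpow (\<lambda>i. x $ i) b" if ab: "a \<noteq> b" for a b :: "4 \<Rightarrow> nat"
  proof -
    obtain i where i: "a i \<noteq> b i" using ab by (auto simp: fun_eq_iff)
    have "mpow (\<lambda>j. (\<chi> j. if j = i then 2 else 1) $ j :: complex) a = 2 ^ a i" for a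
      using exhaust_4[of i] by (auto simp: mpow_def)
    moreover have "(2::complex) ^ a i \<noteq> 2 ^ b i" using i
      by (metis norm_numeral norm_power power_inject_exp one_less_numeral_iff semiring_norm(76))
    ultimately show ?thesis by metis
  qed
qed (use assms in \<open>auto simp: mpow_def power_mult_distrib\<close>)

text \<open>The normal form is unique: applied to an exponential, an operator in normal form produces its
  full symbol, which vanishes only if all its coefficients do.\<close>

lemma normal_form_unique:
  assumes "finite A" "\<And>b. b \<in> A \<Longrightarrow> m b \<in> mult_ops" "(\<Sum>b\<in>A. m b * dpow b) = 0" "b \<in> A"
  shows "m b = 0"
proof -
  have "\<forall>b\<in>A. \<exists>p. \<forall>f. apply_diffop (m b) f = p * f"
    using assms(2) by (simp add: mult_ops_def)
  then obtain p where p: "\<And>b f. b \<in> A \<Longrightarrow> apply_diffop (m b) f = p b * f" by metis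
  have "eval_entire (p b) z = 0" for z
  proof (rule mpow_independent[OF assms(1) _ assms(4)])
    fix \<zeta> :: "complex^4"
    have sum: "eval_entire (apply_diffop (\<Sum>b\<in>B. m b * dpow b) (exp_entire \<zeta>)) z =
      (\<Sum>b\<in>B. eval_entire (p b) z * mpow (\<lambda>i. \<zeta> $ i) b) * eval_entire (exp_entire \<zeta>) z"
      if "finite B" "B \<subseteq> A" for B
      using that
    proof (induction B rule: finite_induct)
      case (insert b B)
      then show ?case
        by (simp add: plus_diffop.rep_eq plus_entire.rep_eq dpow_exp p times_entire.rep_eq algebra_simps)
    qed (simp add: zero_diffop.rep_eq zero_entire.rep_eq)
    have "eval_entire (exp_entire \<zeta>) z \<noteq> 0" by (simp add: exp_entire.rep_eq)
    with sum[OF assms(1)] assms(3)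
    show "(\<Sum>b\<in>A. eval_entire (p b) z * mpow (\<lambda>i. \<zeta> $ i) b) = 0"
      by (simp add: zero_diffop.rep_eq zero_entire.rep_eq)
  qed
  then have "p b = 0" by (simp add: fun_eq_iff zero_entire.rep_eq flip: eval_entire_inject)
  then show ?thesis using p[OF assms(4)] by (simp add: fun_eq_iff zero_diffop.rep_eq flip: apply_diffop_inject)
qed

lemma adj_normal_form:
  "adj P Q \<Longrightarrow> \<exists>A m. finite A \<and> (\<forall>b\<in>A. m b \<in> mult_ops) \<and>
     P = (\<Sum>b\<in>A. m b * dpow b) \<and> Q = (\<Sum>b\<in>A. mdpow b * m b)"
proof (induction rule: adj.induct)
  case zero
  then show ?case by (intro exI[of _ "{}"]) simp
next
  case (step P Q n b)
  then obtain A m where A: "finite A" "\<And>b. b \<in> A \<Longrightarrow> m b \<in> mult_ops"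
    "P = (\<Sum>b\<in>A. m b * dpow b)" "Q = (\<Sum>b\<in>A. mdpow b * m b)"
    by blast
  define m' where "m' = m(b := (if b \<in> A then m b + n else n))"
  have eq: "m' c = m c" if "c \<in> A - {b}" for c using that by (simp add: m'_def)
  have m': "(\<Sum>c\<in>insert b A. m' c * dpow c) = P + n * dpow b"
    "(\<Sum>c\<in>insert b A. mdpow c * m' c) = Q + mdpow b * n"
    using A(1) eq unfolding A(3,4)
    by (cases "b \<in> A"; simp add: sum.insert_remove sum.remove[of A b] m'_def algebra_simps)+
  show ?case
    using A step.hyps m' by (intro exI[of _ "insert b A"] exI[of _ m']) (auto simp: m'_def mult_ops_add)
qed

text \<open>The relation is additive, so it is enough that only zero is related to zero. This is the
  uniqueness of the normal form.\<close>

lemma adj_unique: "adj P Q \<Longrightarrow> adj P Q' \<Longrightarrow> Q = Q'"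
proof -
  have zero: "Q = 0" if "adj 0 Q" for Q
    using adj_normal_form[OF that] normal_form_unique by (metis (no_types, lifting) mult_zero_right sum.neutral)
  assume "adj P Q" "adj P Q'"
  then have "adj (P + const_op (-1) * P) (Q + Q' * const_op (-1))"
    by (intro adj_add adj_mult_ops mult_ops_gen)
  moreover have "const_op (-1) = -1"
    using const_op_add[of "-1" 1] by (simp add: const_op_simps eq_neg_iff_add_eq_0)
  ultimately have "adj 0 (Q - Q')" by simp
  then have "Q - Q' = 0" by (rule zero)
  then show "Q = Q'" by simp
qed

lemma adj_one: "adj 1 1"
  using adj.step[OF adj.zero, of 1 "\<lambda>_. 0"] mult_ops_gen(1)[of 1]
  by (simp add: const_op_simps mpow_def)

lemma adj_ex1: "\<exists>!Q. adj P Q"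
  using adj_left_mult[of P] adj_one adj_unique by (metis mult_1_left mult_1_right)

text \<open>The property that characterises \<open>transpose_op\<close>, named so that the description operator can be
  eliminated.\<close>

definition anti_hom :: "(diffop \<Rightarrow> diffop) \<Rightarrow> bool" where
  "anti_hom \<tau> \<longleftrightarrow>
     (\<forall>P Q. \<tau> (P + Q) = \<tau> P + \<tau> Q) \<and> (\<forall>P Q. \<tau> (P * Q) = \<tau> Q * \<tau> P) \<and>
     (\<forall>c. \<tau> (const_op c) = const_op c) \<and> (\<forall>i. \<tau> (z_op i) = z_op i) \<and>
     (\<forall>i. \<tau> (d_op i) = - d_op i)"

lemma anti_hom_transpose_op: "anti_hom transpose_op"
proof -
  define \<tau> where "\<tau> P = (THE Q. adj P Q)" for P
  have adj: "adj P (\<tau> P)" for P unfolding \<tau>_def using adj_ex1 by (rule theI')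
  have eq: "\<tau> P = Q" if "adj P Q" for P Q using adj adj_unique that by blast
  have \<tau>: "anti_hom \<tau>"
    unfolding anti_hom_def
  proof (intro conjI allI eq)
    show "adj (P + Q) (\<tau> P + \<tau> Q)" for P Q by (intro adj_add adj)
    show "adj (P * Q) (\<tau> Q * \<tau> P)" for P Q
    proof -
      obtain P' where P': "\<And>Q Q'. adj Q Q' \<Longrightarrow> adj (P * Q) (Q' * P')" using adj_left_mult by blast
      from P'[OF adj_one] have "P' = \<tau> P" by (simp add: eq)
      with P'[OF adj] show ?thesis by simp
    qed
    show "adj (const_op c) (const_op c)" for c using adj_mult_ops[OF adj_one mult_ops_gen(1)] by simp
    show "adj (z_op i) (z_op i)" for i using adj_mult_ops[OF adj_one mult_ops_gen(2)] by simp
    show "adj (d_op i) (- d_op i)" for i using adj_d_op[OF adj_one] by simp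
  qed
  have "\<sigma> = \<tau>" if "anti_hom \<sigma>" for \<sigma>
  proof
    show "\<sigma> P = \<tau> P" for P
      by (induction P rule: diffop_induct) (use that \<tau> in \<open>simp_all add: anti_hom_def\<close>)
  qed
  with \<tau> have "anti_hom (THE \<tau>. anti_hom \<tau>)" by (rule theI)
  then show ?thesis by (simp add: transpose_op_def anti_hom_def)
qed

lemma transpose_op_simps:
  "transpose_op (P + Q) = transpose_op P + transpose_op Q"
  "transpose_op (P * Q) = transpose_op Q * transpose_op P"
  "transpose_op (const_op c) = const_op c"
  "transpose_op (z_op i) = z_op i"
  "transpose_op (d_op i) = - d_op i"
  using anti_hom_transpose_op unfolding anti_hom_def by blast+

section \<open>Test functions and Wirtinger derivatives\<close>

lemma test_function_smooth: "test_function \<phi> \<Longrightarrow> smooth \<phi>"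
  by (simp add: test_function_def smooth_def)

lemma test_functionI:
  assumes "smooth \<phi>" "compact K" "\<And>x. x \<notin> K \<Longrightarrow> \<phi> x = 0"
  shows "test_function \<phi>"
proof -
  have "closure {x. \<phi> x \<noteq> 0} \<subseteq> K"
    using assms by (intro closure_minimal compact_imp_closed) auto
  then have "compact (closure {x. \<phi> x \<noteq> 0})"
    using assms(2) by (metis closed_closure compact_Int_closed inf.absorb_iff2)
  then show ?thesis using assms(1) by (simp add: test_function_def smooth_def)
qed

lemma test_function_support:
  assumes "test_function \<phi>"
  shows "\<exists>K. compact K \<and> (\<forall>x. x \<notin> K \<longrightarrow> \<phi> x = 0)"
proof (intro exI conjI)
  show "compact (closure {x. \<phi> x \<noteq> 0})" using assms by (simp add: test_function_def)
  show "\<forall>x. x \<notin> closure {x. \<phi> x \<noteq> 0} \<longrightarrow> \<phi> x = 0"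
    using closure_subset[of "{x. \<phi> x \<noteq> 0}"] by auto
qed

lemma test_function_add:
  assumes "test_function \<phi>" "test_function \<psi>" shows "test_function (\<lambda>x. \<phi> x + \<psi> x)"
proof -
  obtain K where "compact K" "\<And>x. x \<notin> K \<Longrightarrow> \<phi> x = 0" using test_function_support[OF assms(1)] by metis
  moreover obtain L where "compact L" "\<And>x. x \<notin> L \<Longrightarrow> \<psi> x = 0" using test_function_support[OF assms(2)] by metis
  ultimately show ?thesis
    by (intro test_functionI[of _ "K \<union> L"]) (auto intro: smooth_add test_function_smooth assms)
qed

lemma test_function_mult:
  assumes "test_function \<phi>" "smooth a" shows "test_function (\<lambda>x. \<phi> x * a x)"
proof -
  obtain K where "compact K" "\<And>x. x \<notin> K \<Longrightarrow> \<phi> x = 0" using test_function_support[OF assms(1)] by metis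
  then show ?thesis
    by (intro test_functionI[of _ K]) (auto intro: smooth_mult test_function_smooth assms)
qed

lemma test_function_cmult: "test_function \<phi> \<Longrightarrow> test_function (\<lambda>x. c * \<phi> x)"
  using test_function_mult[of \<phi> "\<lambda>_. c"] by (simp add: mult.commute)

lemma dir_deriv_vanish:
  assumes "closed K" "\<And>x. x \<notin> K \<Longrightarrow> \<phi> x = 0" "x \<notin> K"
  shows "dir_deriv v \<phi> x = 0"
proof (rule dir_deriv_eqI)
  show "(\<phi> has_derivative (\<lambda>_. 0)) (at x)"
    by (rule has_derivative_transform_within_open[OF has_derivative_const, of "- K"])
       (use assms in auto)
qed

lemma test_function_dir_deriv:
  assumes "test_function \<phi>" shows "test_function (dir_deriv v \<phi>)"
proof -
  obtain K where "compact K" "\<And>x. x \<notin> K \<Longrightarrow> \<phi> x = 0"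
    using test_function_support[OF assms] by metis
  then show ?thesis
    by (intro test_functionI[of _ K])
       (auto intro: smooth_dir_deriv test_function_smooth assms dir_deriv_vanish compact_imp_closed)
qed

text \<open>For \<open>v, w\<close> the real and imaginary directions of a coordinate, this is the Wirtinger derivative
  along that coordinate if \<open>c = - \<i>\<close>, and along its conjugate if \<open>c = \<i>\<close>.\<close>

definition wirt :: "complex \<Rightarrow> complex \<times> complex \<Rightarrow> complex \<times> complex \<Rightarrow>
    (complex \<times> complex \<Rightarrow> complex) \<Rightarrow> complex \<times> complex \<Rightarrow> complex" where
  "wirt c v w \<phi> = (\<lambda>p. (1/2) * dir_deriv v \<phi> p + (c/2) * dir_deriv w \<phi> p)"

definition wirt_z1 where "wirt_z1 = wirt (- \<i>) (1, 0) (\<i>, 0)"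
definition wirt_z2 where "wirt_z2 = wirt (- \<i>) (0, 1) (0, \<i>)"
definition wirt_cz1 where "wirt_cz1 = wirt \<i> (1, 0) (\<i>, 0)"

lemma wirtinger_z2_eq: "wirtinger_z2 = wirt_z2"
  by (simp add: fun_eq_iff wirtinger_z2_def wirt_z2_def wirt_def field_simps)

lemma smooth_wirt: "smooth \<phi> \<Longrightarrow> smooth (wirt c v w \<phi>)"
  unfolding wirt_def by (intro smooth_add smooth_mult smooth_const smooth_dir_deriv)

lemma wirt_vanish:
  assumes "closed K" "\<And>x. x \<notin> K \<Longrightarrow> \<phi> x = 0" "x \<notin> K"
  shows "wirt c v w \<phi> x = 0"
  unfolding wirt_def using dir_deriv_vanish[of K \<phi> x] assms by simp

lemma test_function_wirt: "test_function \<phi> \<Longrightarrow> test_function (wirt c v w \<phi>)"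
  unfolding wirt_def by (intro test_function_add test_function_cmult test_function_dir_deriv)

lemma wirt_add:
  "smooth \<phi> \<Longrightarrow> smooth \<psi> \<Longrightarrow> wirt c v w (\<lambda>p. \<phi> p + \<psi> p) = (\<lambda>p. wirt c v w \<phi> p + wirt c v w \<psi> p)"
  by (simp add: wirt_def dir_deriv_add smooth_differentiable algebra_simps)

lemma wirt_mult:
  "smooth \<phi> \<Longrightarrow> smooth a \<Longrightarrow>
    wirt c v w (\<lambda>p. \<phi> p * a p) = (\<lambda>p. wirt c v w \<phi> p * a p + \<phi> p * wirt c v w a p)"
  by (simp add: wirt_def dir_deriv_mult smooth_differentiable algebra_simps)

lemma wirt_cmult: "smooth \<phi> \<Longrightarrow> wirt c v w (\<lambda>p. a * \<phi> p) = (\<lambda>p. a * wirt c v w \<phi> p)"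
  using wirt_mult[of "\<lambda>_. a" \<phi> c v w] by (simp add: wirt_def)

lemma dir_deriv_wirt:
  assumes "smooth \<phi>"
  shows "dir_deriv u (wirt c v w \<phi>) = wirt c v w (dir_deriv u \<phi>)"
proof -
  have s: "smooth (dir_deriv x \<phi>)" for x using assms by (rule smooth_dir_deriv)
  have c: "dir_deriv u (\<lambda>p. a * dir_deriv x \<phi> p) = (\<lambda>p. a * dir_deriv u (dir_deriv x \<phi>) p)" for a x
    using s[of x] by (subst dir_deriv_mult) (simp_all add: smooth_differentiable)
  have "dir_deriv u (wirt c v w \<phi>) = (\<lambda>p. dir_deriv u (\<lambda>p. (1/2) * dir_deriv v \<phi> p) p
      + dir_deriv u (\<lambda>p. (c/2) * dir_deriv w \<phi> p) p)"
    unfolding wirt_def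
    by (intro dir_deriv_add smooth_differentiable smooth_mult smooth_const s)
  also have "\<dots> = wirt c v w (dir_deriv u \<phi>)"
    unfolding c using assms by (simp add: wirt_def smooth_def dir_deriv_commute[of \<phi> u])
  finally show ?thesis .
qed

lemma wirt_commute:
  assumes "smooth \<phi>"
  shows "wirt c v w (wirt c' v' w' \<phi>) = wirt c' v' w' (wirt c v w \<phi>)"
proof -
  have s: "smooth (dir_deriv x \<phi>)" for x using assms by (rule smooth_dir_deriv)
  have "wirt c' v' w' (wirt c v w \<phi>) = (\<lambda>p. wirt c' v' w' (\<lambda>p. (1/2) * dir_deriv v \<phi> p) p
      + wirt c' v' w' (\<lambda>p. (c/2) * dir_deriv w \<phi> p) p)"
    unfolding wirt_def[of c v w]
    by (intro wirt_add smooth_mult smooth_const s)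
  also have "\<dots> = wirt c v w (wirt c' v' w' \<phi>)"
    unfolding wirt_cmult[OF s] using assms by (simp add: wirt_def[of c v w] dir_deriv_wirt)
  finally show ?thesis ..
qed

abbreviation restr :: "entire \<Rightarrow> complex \<times> complex \<Rightarrow> complex" where
  "restr f \<equiv> (\<lambda>p. eval_entire f (real_form p))"

lemma bounded_linear_real_form: "bounded_linear real_form"
  unfolding linear_conv_bounded_linear[symmetric]
  by (rule linearI) (simp_all add: vec_eq_iff forall_4)

lemma smooth_restr: "smooth (restr f)"
  unfolding smooth_def
  using Ck_entire[OF eval_entire[of f, simplified] bounded_linear_real_form] by blast

text \<open>On the real form the conjugate coordinates are independent variables of the complexification,
  so the Wirtinger derivatives of a restriction restrict the complex partial derivatives.\<close>

lemma wirt_restr: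
  "wirt_z1 (restr f) = restr (pderiv_entire 1 f)"
  "wirt_z2 (restr f) = restr (pderiv_entire 2 f)"
  "wirt_cz1 (restr f) = restr (pderiv_entire 3 f)"
  using dir_deriv_entire[OF eval_entire[of f, simplified] bounded_linear_real_form]
  by (simp_all add: fun_eq_iff wirt_z1_def wirt_z2_def wirt_cz1_def wirt_def pderiv_entire.rep_eq sum_4 algebra_simps)

lemmas smooth_wirt_coord [simp] = smooth_wirt[of _ "- \<i>" "(1, 0)" "(\<i>, 0)", folded wirt_z1_def]
  smooth_wirt[of _ "- \<i>" "(0, 1)" "(0, \<i>)", folded wirt_z2_def]
  smooth_wirt[of _ "\<i>" "(1, 0)" "(\<i>, 0)", folded wirt_cz1_def]
lemmas test_function_wirt_coord [simp] = test_function_wirt[of _ "- \<i>" "(1, 0)" "(\<i>, 0)", folded wirt_z1_def]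
  test_function_wirt[of _ "- \<i>" "(0, 1)" "(0, \<i>)", folded wirt_z2_def]
  test_function_wirt[of _ "\<i>" "(1, 0)" "(\<i>, 0)", folded wirt_cz1_def]

lemma smooth_wirt_z2_iter: "smooth \<phi> \<Longrightarrow> smooth ((wirt_z2 ^^ m) \<phi>)"
  by (induction m) auto

lemma test_wirt_z2_iter: "test_function \<phi> \<Longrightarrow> test_function ((wirt_z2 ^^ m) \<phi>)"
  by (induction m) auto

lemma wirt_z2_iter_add:
  "smooth \<phi> \<Longrightarrow> smooth \<psi> \<Longrightarrow> (wirt_z2 ^^ m) (\<lambda>p. \<phi> p + \<psi> p) = (\<lambda>p. (wirt_z2 ^^ m) \<phi> p + (wirt_z2 ^^ m) \<psi> p)"
  by (induction m) (auto simp: wirt_z2_def wirt_add smooth_wirt_z2_iter[unfolded wirt_z2_def])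

text \<open>A function killed by \<open>\<partial>/\<partial>z2\<close> acts as a constant for that derivative.\<close>

lemma wirt_z2_iter_mult:
  assumes "smooth \<phi>" "smooth a" "wirt_z2 a = (\<lambda>_. 0)"
  shows "(wirt_z2 ^^ m) (\<lambda>p. \<phi> p * a p) = (\<lambda>p. (wirt_z2 ^^ m) \<phi> p * a p)"
  using assms by (induction m) (auto simp: wirt_z2_def wirt_mult smooth_wirt_z2_iter[unfolded wirt_z2_def])

lemma wirt_z2_iter_cmult: "smooth \<phi> \<Longrightarrow> (wirt_z2 ^^ m) (\<lambda>p. c * \<phi> p) = (\<lambda>p. c * (wirt_z2 ^^ m) \<phi> p)"
  by (induction m) (auto simp: wirt_z2_def wirt_cmult smooth_wirt_z2_iter[unfolded wirt_z2_def])

lemma wirt_z2_iter_commute: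
  assumes "smooth \<phi>" shows "(wirt_z2 ^^ m) (wirt c v w \<phi>) = wirt c v w ((wirt_z2 ^^ m) \<phi>)"
  using assms by (induction m) (auto simp: wirt_z2_def wirt_commute[of _ c v w] smooth_wirt_z2_iter[unfolded wirt_z2_def])

section \<open>Integration over the slice where the second coordinate vanishes\<close>

lemma integrable_compact_support:
  fixes g :: "'a::euclidean_space \<Rightarrow> complex"
  assumes "continuous_on UNIV g" "compact K" "\<And>x. x \<notin> K \<Longrightarrow> g x = 0"
  shows "integrable lborel g"
proof -
  have "integrable lborel (\<lambda>x. indicator K x *\<^sub>R g x)"
    using assms by (intro borel_integrable_compact) (auto intro: continuous_on_subset)
  moreover have "(\<lambda>x. indicator K x *\<^sub>R g x) = g"
    using assms(3) by (auto simp: fun_eq_iff indicator_def)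
  ultimately show ?thesis by simp
qed

text \<open>The integral of a difference quotient vanishes by translation invariance; dominated
  convergence carries this over to the derivative.\<close>

lemma integral_dir_deriv_eq_0:
  fixes g :: "'a::euclidean_space \<Rightarrow> complex"
  assumes g: "Ck 1 g" and K: "compact K" and g0: "\<And>x. x \<notin> K \<Longrightarrow> g x = 0"
  shows "integral\<^sup>L lborel (dir_deriv v g) = 0"
proof -
  have gd: "g differentiable (at x)" and gc: "continuous_on UNIV (dir_deriv v g)" for x
    using g by auto
  have gc': "continuous_on UNIV g" using Ck_SucD[of 0 g] g by simp
  define h :: "nat \<Rightarrow> real" where "h n = inverse (real (Suc n))" for n
  have h: "h n > 0" "h n \<le> 1" for n by (auto simp: h_def inverse_le_1_iff)
  define s where "s n x = (g (x + h n *\<^sub>R v) - g x) /\<^sub>R h n" for n x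
  have lin: "dir_deriv (k *\<^sub>R v) g y = k *\<^sub>R dir_deriv v g y" for k y
    by (rule linear_scale[OF has_derivative_linear[OF has_derivative_dir_deriv[OF gd]]])
  have der: "((\<lambda>t. g (x + t *\<^sub>R v)) has_derivative (\<lambda>k. k *\<^sub>R dir_deriv v g (x + t *\<^sub>R v))) (at t within S)"
    for x t S
  proof -
    have "((\<lambda>t. g (x + t *\<^sub>R v)) has_derivative (\<lambda>k. dir_deriv (k *\<^sub>R v) g (x + t *\<^sub>R v))) (at t within S)"
      by (rule has_derivative_compose[OF _ has_derivative_dir_deriv[OF gd]])
         (auto intro!: derivative_eq_intros)
    then show ?thesis unfolding lin .
  qed
  have "bounded (dir_deriv v g ` K)"
    using K gc by (intro compact_imp_bounded compact_continuous_image) (auto intro: continuous_on_subset)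
  then obtain B where "\<And>x. x \<in> K \<Longrightarrow> norm (dir_deriv v g x) \<le> B" and B0: "B > 0"
    unfolding bounded_pos by auto
  then have B: "norm (dir_deriv v g x) \<le> B" for x
    using dir_deriv_vanish[of K g x v] compact_imp_closed[OF K] g0 by (cases "x \<in> K") auto
  \<comment> \<open>The translates of \<open>K\<close> that the difference quotients of step at most 1 can see.\<close>
  define K' where "K' = (\<lambda>(x, t). x + t *\<^sub>R v) ` (K \<times> {-1..0})"
  have K': "compact K'"
    unfolding K'_def case_prod_unfold
    by (intro compact_continuous_image compact_Times K compact_Icc continuous_intros)
  have bound: "norm (s n x) \<le> indicator K' x *\<^sub>R B" for n x
  proof (cases "x \<in> K'")
    case True
    have "norm (g (x + h n *\<^sub>R v) - g (x + 0 *\<^sub>R v)) \<le> B * norm (h n - 0)"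
    proof (rule differentiable_bound[where S = "{0..h n}"])
      show "((\<lambda>t. g (x + t *\<^sub>R v)) has_derivative (\<lambda>k. k *\<^sub>R dir_deriv v g (x + t *\<^sub>R v))) (at t within {0..h n})" for t
        by (rule der)
      show "onorm (\<lambda>k. k *\<^sub>R dir_deriv v g (x + t *\<^sub>R v)) \<le> B" for t
        by (rule onorm_scaleR_left_le[OF B])
    qed (use h[of n] in auto)
    with True h[of n] show ?thesis
      by (simp add: s_def divide_inverse[symmetric] mult.commute[of "inverse _"] divide_le_eq)
  next
    case False
    have "x \<notin> K" using False imageI[of "(x, 0)" "K \<times> {-1..0}" "\<lambda>(x, t). x + t *\<^sub>R v"]
      by (auto simp: K'_def)
    moreover have "x + h n *\<^sub>R v \<notin> K"
      using False h[of n] imageI[of "(x + h n *\<^sub>R v, - h n)" "K \<times> {-1..0}" "\<lambda>(x, t). x + t *\<^sub>R v"]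
      by (auto simp: K'_def)
    ultimately show ?thesis using g0 False by (simp add: s_def)
  qed
  have h0: "h \<longlonglongrightarrow> 0" unfolding h_def by (rule LIMSEQ_inverse_real_of_nat)
  have lim: "(\<lambda>n. s n x) \<longlonglongrightarrow> dir_deriv v g x" for x
  proof -
    have *: "((\<lambda>t. norm (g (x + t *\<^sub>R v) - g x - t *\<^sub>R dir_deriv v g x) / norm t) \<longlongrightarrow> 0) (at 0)"
      using der[of x 0 UNIV] by (simp add: has_derivative_at)
    have "((\<lambda>t. (g (x + t *\<^sub>R v) - g x) /\<^sub>R t - dir_deriv v g x) \<longlongrightarrow> 0) (at 0)"
    proof (rule tendsto_0_le[OF *, where K = 1])
      have "norm ((g (x + t *\<^sub>R v) - g x) /\<^sub>R t - dir_deriv v g x) =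
          norm (g (x + t *\<^sub>R v) - g x - t *\<^sub>R dir_deriv v g x) / norm t" if "t \<noteq> 0" for t
      proof -
        have "(g (x + t *\<^sub>R v) - g x) /\<^sub>R t - dir_deriv v g x = (g (x + t *\<^sub>R v) - g x - t *\<^sub>R dir_deriv v g x) /\<^sub>R t"
          using that by (simp add: scaleR_right_diff_distrib)
        then show ?thesis by (simp add: divide_inverse mult.commute)
      qed
      then show "\<forall>\<^sub>F t in at 0. norm ((g (x + t *\<^sub>R v) - g x) /\<^sub>R t - dir_deriv v g x)
          \<le> norm (norm (g (x + t *\<^sub>R v) - g x - t *\<^sub>R dir_deriv v g x) / norm t) * 1"
        by (auto simp: eventually_at intro!: exI[of _ 1])
    qed
    then have "((\<lambda>t. (g (x + t *\<^sub>R v) - g x) /\<^sub>R t) \<longlongrightarrow> dir_deriv v g x) (at 0)"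
      by (rule LIM_zero_cancel)
    moreover have "filterlim h (at 0) sequentially"
      using h0 h(1) by (auto simp: filterlim_at intro!: always_eventually) (metis less_irrefl)
    ultimately show ?thesis unfolding s_def by (rule filterlim_compose)
  qed
  have "integral\<^sup>L lborel (s n) = 0" for n
  proof -
    have int: "integrable lborel g" by (rule integrable_compact_support[OF gc' K g0])
    have shift: "integrable lborel (\<lambda>x. g (x + a))" "integral\<^sup>L lborel (\<lambda>x. g (x + a)) = integral\<^sup>L lborel g" for a
    proof -
      have m: "(\<lambda>x. a + x) \<in> measurable lborel borel" by simp
      have gm: "g \<in> borel_measurable borel" using gc' by (rule borel_measurable_continuous_onI)
      show "integrable lborel (\<lambda>x. g (x + a))"
        using int integrable_distr_eq[OF m gm] unfolding lborel_distr_plus by (simp add: add.commute)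
      show "integral\<^sup>L lborel (\<lambda>x. g (x + a)) = integral\<^sup>L lborel g"
        using integral_distr[OF m gm] unfolding lborel_distr_plus by (simp add: add.commute)
    qed
    show ?thesis unfolding s_def using int shift[of "h n *\<^sub>R v"] by simp
  qed
  moreover have "(\<lambda>n. integral\<^sup>L lborel (s n)) \<longlonglongrightarrow> integral\<^sup>L lborel (dir_deriv v g)"
  proof (rule integral_dominated_convergence)
    show "integrable lborel (\<lambda>x. indicator K' x *\<^sub>R B)"
      by (rule borel_integrable_compact[OF K']) simp
    show "dir_deriv v g \<in> borel_measurable lborel"
      using borel_measurable_continuous_onI[OF gc] by simp
    show "s n \<in> borel_measurable lborel" for n
    proof -
      have "continuous_on UNIV (s n)"
        unfolding s_def by (intro continuous_intros continuous_on_compose2[OF gc']) auto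
      then show ?thesis using borel_measurable_continuous_onI by simp
    qed
  qed (use lim bound in auto)
  ultimately show ?thesis using LIMSEQ_unique[OF _ tendsto_const] by simp
qed

lemma Ck_slice: "smooth \<phi> \<Longrightarrow> Ck 1 (\<lambda>z. \<phi> (z, 0))"
  and dir_deriv_slice: "smooth \<phi> \<Longrightarrow> dir_deriv v (\<lambda>z. \<phi> (z, 0)) = (\<lambda>z. dir_deriv (v, 0) \<phi> (z, 0))"
  for \<phi> :: "complex \<times> complex \<Rightarrow> complex"
proof -
  assume \<phi>: "smooth \<phi>"
  have d: "((\<lambda>z. \<phi> (z, 0)) has_derivative (\<lambda>v. dir_deriv (v, 0) \<phi> (z, 0))) (at z)" for z
    by (rule has_derivative_compose[OF _ has_derivative_dir_deriv[OF smooth_differentiable[OF \<phi>]]])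
       (auto intro!: derivative_eq_intros)
  have c: "continuous_on UNIV (\<lambda>z. dir_deriv (v, 0) \<phi> (z, 0))" for v
    by (rule continuous_on_compose2[OF smooth_continuous_on[OF smooth_dir_deriv[OF \<phi>]]])
       (auto intro!: continuous_intros)
  show "Ck 1 (\<lambda>z. \<phi> (z, 0))" unfolding One_nat_def
    by (rule Ck_SucI[OF d]) (simp add: c)
  show "dir_deriv v (\<lambda>z. \<phi> (z, 0)) = (\<lambda>z. dir_deriv (v, 0) \<phi> (z, 0))"
    using d by (intro ext dir_deriv_eqI)
qed

lemma slice_support:
  fixes \<phi> :: "complex \<times> complex \<Rightarrow> complex"
  assumes "test_function \<phi>"
  shows "\<exists>K. compact K \<and> (\<forall>z. z \<notin> K \<longrightarrow> \<phi> (z, 0) = 0)"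
proof -
  obtain K where K: "compact K" "\<And>x. x \<notin> K \<Longrightarrow> \<phi> x = 0" using test_function_support[OF assms] by metis
  have "compact (fst ` K)" using K(1) by (intro compact_continuous_image continuous_intros)
  moreover have "\<phi> (z, 0) = 0" if "z \<notin> fst ` K" for z using that K(2)[of "(z, 0)"] by force
  ultimately show ?thesis by blast
qed

lemma integrable_slice:
  fixes \<phi> :: "complex \<times> complex \<Rightarrow> complex"
  assumes "test_function \<phi>" shows "integrable lborel (\<lambda>z. \<phi> (z, 0))"
proof -
  obtain K where "compact K" "\<And>z. z \<notin> K \<Longrightarrow> \<phi> (z, 0) = 0" using slice_support[OF assms] by metis
  moreover have "continuous_on UNIV (\<lambda>z. \<phi> (z, 0))"
    by (rule continuous_on_compose2[OF smooth_continuous_on[OF test_function_smooth[OF assms]]])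
       (auto intro!: continuous_intros)
  ultimately show ?thesis by (intro integrable_compact_support)
qed

lemma integral_slice_wirt:
  assumes \<phi>: "test_function \<phi>"
  shows "integral\<^sup>L lborel (\<lambda>z. wirt c (v, 0) (w, 0) \<phi> (z, 0)) = 0"
proof -
  have 0: "integral\<^sup>L lborel (\<lambda>z. dir_deriv (v, 0) \<phi> (z, 0)) = 0"
    and i: "integrable lborel (\<lambda>z. dir_deriv (v, 0) \<phi> (z, 0))" for v
  proof -
    have sm: "smooth \<phi>" using \<phi> by (rule test_function_smooth)
    obtain K where K: "compact K" "\<And>z. z \<notin> K \<Longrightarrow> \<phi> (z, 0) = 0" using slice_support[OF \<phi>] by metis
    show "integral\<^sup>L lborel (\<lambda>z. dir_deriv (v, 0) \<phi> (z, 0)) = 0"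
      using integral_dir_deriv_eq_0[OF Ck_slice[OF sm] K, of v] by (simp add: dir_deriv_slice[OF sm])
    show "integrable lborel (\<lambda>z. dir_deriv (v, 0) \<phi> (z, 0))"
      by (intro integrable_slice test_function_dir_deriv \<phi>)
  qed
  show ?thesis unfolding wirt_def using 0[of v] 0[of w] i[of v] i[of w] by simp
qed

section \<open>The distributions supported on the slice\<close>

text \<open>The distribution \<open>z1\<^sup>j \<partial>\<^sup>m/\<partial>z2\<^sup>m \<delta>(z2)\<close> up to a constant factor. The differential operators
  that occur in the ideal map this family to itself, which reduces the differential equations to
  arithmetic with the indices.\<close>

definition slice :: "nat \<Rightarrow> nat \<Rightarrow> dist_functional" where
  "slice j m \<phi> = integral\<^sup>L lborel (\<lambda>z. z ^ j * (wirt_z2 ^^ m) \<phi> (z, 0))"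

lemma eval_entire_simps:
  "eval_entire (f + g) z = eval_entire f z + eval_entire g z"
  "eval_entire (f - g) z = eval_entire f z - eval_entire g z"
  "eval_entire (- f) z = - eval_entire f z"
  "eval_entire (f * g) z = eval_entire f z * eval_entire g z"
  "eval_entire (f ^ n) z = eval_entire f z ^ n"
  "eval_entire (of_nat n) z = of_nat n"
  "eval_entire (const_entire c) z = c"
  "eval_entire (coord_entire i) z = z $ i"
  "eval_entire 0 z = 0" "eval_entire 1 z = 1"
proof -
  show "eval_entire (f ^ n) z = eval_entire f z ^ n"
    by (induction n) (auto simp: times_entire.rep_eq one_entire.rep_eq)
  show "eval_entire (of_nat n) z = of_nat n"
    by (induction n) (auto simp: zero_entire.rep_eq one_entire.rep_eq plus_entire.rep_eq)
qed (simp_all add: times_entire.rep_eq plus_entire.rep_eq minus_entire.rep_eq uminus_entire.rep_eq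
    const_entire.rep_eq coord_entire.rep_eq zero_entire.rep_eq one_entire.rep_eq)

lemma pderiv_entire_coord_power:
  "pderiv_entire i (coord_entire k ^ j) = (if i = k then of_nat j * coord_entire k ^ (j - 1) else 0)"
proof (induction j)
  case 0
  show ?case using pderiv_entire_const[of i 1] by (simp add: const_entire_simps)
next
  case (Suc j)
  then show ?case
    by (cases j) (auto simp: pderiv_entire_mult pderiv_entire_coord algebra_simps)
qed

lemma smooth_fst_power: "smooth (\<lambda>p::complex \<times> complex. fst p ^ j)"
  using smooth_restr[of "coord_entire 1 ^ j"] by (simp add: eval_entire_simps)

lemma wirt_fst_power:
  "wirt_z1 (\<lambda>p. fst p ^ j) = (\<lambda>p. of_nat j * fst p ^ (j - 1))"
  "wirt_z2 (\<lambda>p. fst p ^ j) = (\<lambda>p. 0)"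
  "wirt_cz1 (\<lambda>p. fst p ^ j) = (\<lambda>p. 0)"
  using wirt_restr[of "coord_entire 1 ^ j"]
  by (simp_all add: eval_entire_simps pderiv_entire_coord_power)

lemma wirt_const: "wirt c v w (\<lambda>_. a) = (\<lambda>_. 0)"
  by (simp add: wirt_def)

lemma slice_test: "test_function \<phi> \<Longrightarrow> test_function (\<lambda>p. (wirt_z2 ^^ m) \<phi> p * fst p ^ j)"
  by (intro test_function_mult test_wirt_z2_iter smooth_fst_power)

lemma slice_integrable: "test_function \<phi> \<Longrightarrow> integrable lborel (\<lambda>z. z ^ j * (wirt_z2 ^^ m) \<phi> (z, 0))"
  using integrable_slice[OF slice_test, of \<phi> m j] by (simp add: mult.commute)

lemma slice_add:
  assumes "test_function \<phi>" "test_function \<psi>"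
  shows "slice j m (\<lambda>p. \<phi> p + \<psi> p) = slice j m \<phi> + slice j m \<psi>"
  using assms unfolding slice_def
  by (simp add: wirt_z2_iter_add test_function_smooth slice_integrable distrib_left)

lemma slice_cmult: "test_function \<phi> \<Longrightarrow> slice j m (\<lambda>p. c * \<phi> p) = c * slice j m \<phi>"
  unfolding slice_def by (simp add: wirt_z2_iter_cmult test_function_smooth mult.left_commute)

lemma slice_wirt_z2: "slice j m (wirt_z2 \<phi>) = slice j (Suc m) \<phi>"
  by (simp add: slice_def funpow_swap1)

text \<open>Integration by parts on the slice moves the derivative to the power of \<open>z1\<close>.\<close>

lemma slice_wirt_z1:
  assumes \<phi>: "test_function \<phi>"
  shows "slice j m (wirt_z1 \<phi>) = - of_nat j * slice (j - 1) m \<phi>"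
proof -
  let ?\<psi> = "(wirt_z2 ^^ m) \<phi>"
  have s: "smooth ?\<psi>" using \<phi> by (intro smooth_wirt_z2_iter test_function_smooth)
  have "wirt_z1 (\<lambda>p. ?\<psi> p * fst p ^ j) = (\<lambda>p. wirt_z1 ?\<psi> p * fst p ^ j + ?\<psi> p * (of_nat j * fst p ^ (j - 1)))"
    using wirt_mult[OF s smooth_fst_power[of j]] wirt_fst_power(1)[of j] by (simp add: wirt_z1_def)
  then have "0 = integral\<^sup>L lborel (\<lambda>z. wirt_z1 ?\<psi> (z, 0) * z ^ j + of_nat j * (z ^ (j - 1) * ?\<psi> (z, 0)))"
    using integral_slice_wirt[OF slice_test[OF \<phi>], of "- \<i>" 1 "\<i>" m j] by (simp add: wirt_z1_def mult_ac)
  also have "wirt_z1 ?\<psi> = (wirt_z2 ^^ m) (wirt_z1 \<phi>)"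
    using wirt_z2_iter_commute[OF test_function_smooth[OF \<phi>]] by (simp add: wirt_z1_def)
  finally show ?thesis
    using slice_integrable[OF \<phi>, of "j - 1" m] slice_integrable[of "wirt_z1 \<phi>" j m] \<phi>
    by (simp add: slice_def mult.commute[of "(wirt_z2 ^^ m) (wirt_z1 \<phi>) _"] eq_neg_iff_add_eq_0)
qed

text \<open>Integration by parts produces no further term because the power of \<open>z1\<close> is holomorphic.\<close>

lemma slice_wirt_cz1:
  assumes \<phi>: "test_function \<phi>"
  shows "slice j m (wirt_cz1 \<phi>) = 0"
proof -
  let ?\<psi> = "(wirt_z2 ^^ m) \<phi>"
  have s: "smooth ?\<psi>" using \<phi> by (intro smooth_wirt_z2_iter test_function_smooth)
  have "wirt_cz1 (\<lambda>p. ?\<psi> p * fst p ^ j) = (\<lambda>p. wirt_cz1 ?\<psi> p * fst p ^ j)"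
    using wirt_mult[OF s smooth_fst_power[of j]] wirt_fst_power(3)[of j] by (simp add: wirt_cz1_def)
  then have "0 = integral\<^sup>L lborel (\<lambda>z. wirt_cz1 ?\<psi> (z, 0) * z ^ j)"
    using integral_slice_wirt[OF slice_test[OF \<phi>], of "\<i>" 1 "\<i>" m j] by (simp add: wirt_cz1_def)
  also have "wirt_cz1 ?\<psi> = (wirt_z2 ^^ m) (wirt_cz1 \<phi>)"
    using wirt_z2_iter_commute[OF test_function_smooth[OF \<phi>]] by (simp add: wirt_cz1_def)
  finally show ?thesis by (simp add: slice_def mult.commute)
qed

lemma slice_z1:
  assumes "test_function \<phi>"
  shows "slice j m (\<lambda>p. \<phi> p * restr (coord_entire 1) p) = slice (Suc j) m \<phi>"
proof -
  have "wirt_z2 (restr (coord_entire 1)) = (\<lambda>_. 0)"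
    unfolding wirt_restr by (simp add: pderiv_entire_coord eval_entire_simps)
  from wirt_z2_iter_mult[OF test_function_smooth[OF assms] smooth_restr this, of m]
  show ?thesis by (simp add: slice_def eval_entire_simps mult_ac)
qed

lemma slice_z4:
  assumes "test_function \<phi>"
  shows "slice j m (\<lambda>p. \<phi> p * restr (coord_entire 4) p) = 0"
proof -
  have "wirt_z2 (restr (coord_entire 4)) = (\<lambda>_. 0)"
    unfolding wirt_restr by (simp add: pderiv_entire_coord eval_entire_simps)
  from wirt_z2_iter_mult[OF test_function_smooth[OF assms] smooth_restr this, of m]
  show ?thesis by (simp add: slice_def eval_entire_simps mult_ac)
qed

text \<open>The commutator of \<open>\<partial>\<^sup>m/\<partial>z2\<^sup>m\<close> with \<open>z2\<close>. On the slice the term that keeps the factor \<open>z2\<close>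
  vanishes.\<close>

lemma wirt_z2_iter_z2:
  assumes "smooth \<phi>"
  shows "(wirt_z2 ^^ m) (\<lambda>p. \<phi> p * snd p) = (\<lambda>p. (wirt_z2 ^^ m) \<phi> p * snd p + of_nat m * (wirt_z2 ^^ (m - 1)) \<phi> p)"
proof (induction m)
  case (Suc m)
  have s: "smooth ((wirt_z2 ^^ m) \<phi>)" for m using assms by (rule smooth_wirt_z2_iter)
  have s2: "smooth (snd :: complex \<times> complex \<Rightarrow> complex)" "wirt_z2 snd = (\<lambda>_. 1)"
    using smooth_restr[of "coord_entire 2"] wirt_restr(2)[of "coord_entire 2"]
    by (simp_all add: eval_entire_simps pderiv_entire_coord)
  have "(wirt_z2 ^^ Suc m) (\<lambda>p. \<phi> p * snd p) = wirt_z2 (\<lambda>p. (wirt_z2 ^^ m) \<phi> p * snd p + of_nat m * (wirt_z2 ^^ (m - 1)) \<phi> p)"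
    by (simp add: Suc)
  also have "\<dots> = (\<lambda>p. wirt_z2 ((wirt_z2 ^^ m) \<phi>) p * snd p + (wirt_z2 ^^ m) \<phi> p + of_nat m * wirt_z2 ((wirt_z2 ^^ (m - 1)) \<phi>) p)"
    using s s2 unfolding wirt_z2_def
    by (subst wirt_add) (auto intro!: smooth_mult simp: wirt_mult wirt_cmult wirt_const)
  also have "\<dots> = (\<lambda>p. (wirt_z2 ^^ Suc m) \<phi> p * snd p + of_nat (Suc m) * (wirt_z2 ^^ (Suc m - 1)) \<phi> p)"
    by (cases m) (auto simp: algebra_simps)
  finally show ?case .
qed simp

lemma slice_z2:
  assumes "test_function \<phi>"
  shows "slice j m (\<lambda>p. \<phi> p * restr (coord_entire 2) p) = of_nat m * slice j (m - 1) \<phi>"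
  using wirt_z2_iter_z2[OF test_function_smooth[OF assms], of m]
  by (simp add: slice_def eval_entire_simps mult.left_commute)

lemma T2_eq_slice:
  assumes "test_function \<phi>"
  shows "T2 l \<phi> = (-1) ^ l / (- 2 * \<i>) * slice l l \<phi>"
proof -
  have "(dist_d2 ^^ l) delta_z2 \<psi> = (-1) ^ l * delta_z2 ((wirt_z2 ^^ l) \<psi>)" for \<psi>
  proof (induction l arbitrary: \<psi>)
    case (Suc l)
    have "(dist_d2 ^^ Suc l) delta_z2 \<psi> = - (dist_d2 ^^ l) delta_z2 (wirt_z2 \<psi>)"
      by (simp add: dist_d2_def wirtinger_z2_eq)
    with Suc show ?case by (simp add: funpow_swap1)
  qed simp
  moreover have "(wirt_z2 ^^ l) (\<lambda>p. \<phi> p * fst p ^ l) = (\<lambda>p. (wirt_z2 ^^ l) \<phi> p * fst p ^ l)"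
    using assms by (intro wirt_z2_iter_mult test_function_smooth smooth_fst_power wirt_fst_power)
  ultimately show ?thesis
    by (simp add: T2_def dist_mult_def delta_z2_def slice_def mult.commute)
qed

text \<open>The factor \<open>z1\<close> is constant with respect to \<open>\<partial>/\<partial>z2\<close>, so all the factors can be collected behind
  all the derivatives.\<close>

lemma T2_eq_iterated:
  "eq_distribution (T2 l) (((\<lambda>T. dist_mult fst (dist_d2 T)) ^^ l) delta_z2)"
  unfolding eq_distribution_def
proof (intro allI impI)
  fix \<phi> :: "complex \<times> complex \<Rightarrow> complex" assume "test_function \<phi>"
  then have "((\<lambda>T. dist_mult fst (dist_d2 T)) ^^ l) delta_z2 \<phi> =
      (-1) ^ l * delta_z2 ((wirt_z2 ^^ l) (\<lambda>p. \<phi> p * fst p ^ l))"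
  proof (induction l arbitrary: \<phi>)
    case (Suc l)
    have sm: "smooth (\<lambda>p::complex \<times> complex. fst p)" using smooth_fst_power[of 1] by simp
    have t: "test_function (\<lambda>p. \<phi> p * fst p)" using Suc.prems sm by (rule test_function_mult)
    have "((\<lambda>T. dist_mult fst (dist_d2 T)) ^^ Suc l) delta_z2 \<phi> =
      - ((\<lambda>T. dist_mult fst (dist_d2 T)) ^^ l) delta_z2 (wirt_z2 (\<lambda>p. \<phi> p * fst p))"
      by (simp add: dist_mult_def dist_d2_def wirtinger_z2_eq mult.commute)
    also have "\<dots> = (-1) ^ Suc l * delta_z2 ((wirt_z2 ^^ l) (\<lambda>p. wirt_z2 (\<lambda>p. \<phi> p * fst p) p * fst p ^ l))"
      using t by (simp add: Suc.IH)
    also have "(\<lambda>p. wirt_z2 (\<lambda>p. \<phi> p * fst p) p * fst p ^ l) = wirt_z2 (\<lambda>p. \<phi> p * fst p * fst p ^ l)"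
      using wirt_mult[OF test_function_smooth[OF t] smooth_fst_power[of l]] wirt_fst_power(2)[of l]
      by (simp add: wirt_z2_def)
    finally show ?case by (simp add: funpow_swap1 mult.assoc)
  qed (simp add: dist_mult_def)
  moreover have "(wirt_z2 ^^ l) (\<lambda>p. \<phi> p * fst p ^ l) = (\<lambda>p. (wirt_z2 ^^ l) \<phi> p * fst p ^ l)"
    using \<open>test_function \<phi>\<close> by (intro wirt_z2_iter_mult test_function_smooth smooth_fst_power wirt_fst_power)
  ultimately show "T2 l \<phi> = ((\<lambda>T. dist_mult fst (dist_d2 T)) ^^ l) delta_z2 \<phi>"
    using T2_eq_slice[OF \<open>test_function \<phi>\<close>] by (simp add: delta_z2_def slice_def mult.commute)
qed

text \<open>A Wirtinger derivative is the mean of two derivatives along basis vectors, up to unimodular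
  factors, so it costs one order of differentiation and no constant.\<close>

lemma wirt_z2_iter_bound:
  assumes "smooth \<phi>" "\<And>vs x. set vs \<subseteq> Basis \<Longrightarrow> length vs \<le> n + m \<Longrightarrow> norm (fold dir_deriv vs \<phi> x) \<le> B"
    "set vs \<subseteq> Basis" "length vs \<le> n"
  shows "norm (fold dir_deriv vs ((wirt_z2 ^^ m) \<phi>) x) \<le> B"
  using assms
proof (induction m arbitrary: \<phi>)
  case (Suc m)
  have comm: "fold dir_deriv vs (wirt_z2 \<psi>) = wirt_z2 (fold dir_deriv vs \<psi>) \<and> smooth (fold dir_deriv vs \<psi>)"
    if "smooth \<psi>" for vs \<psi>
    using that
    by (induction vs arbitrary: \<psi>) (auto simp: wirt_z2_def dir_deriv_wirt smooth_dir_deriv)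
  have "norm (fold dir_deriv us (wirt_z2 \<phi>) x) \<le> B" if us: "set us \<subseteq> Basis" "length us \<le> n + m" for us x
  proof -
    have b: "norm (dir_deriv v (fold dir_deriv us \<phi>) x) \<le> B" if "v \<in> Basis" for v
      using Suc.prems(2)[of "us @ [v]" x] us that by simp
    have "(0, 1) \<in> (Basis :: (complex \<times> complex) set)" "(0, \<i>) \<in> (Basis :: (complex \<times> complex) set)"
      by (auto simp: Basis_prod_def Basis_complex_def)
    note this[THEN b]
    moreover have "norm (wirt_z2 (fold dir_deriv us \<phi>) x) \<le>
      norm (dir_deriv (0, 1) (fold dir_deriv us \<phi>) x) / 2 + norm (dir_deriv (0, \<i>) (fold dir_deriv us \<phi>) x) / 2"
      unfolding wirt_z2_def wirt_def by (rule order_trans[OF norm_triangle_ineq]) (simp add: norm_mult norm_divide)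
    ultimately show ?thesis using comm[OF Suc.prems(1), of us] by simp
  qed
  from Suc.IH[OF _ this Suc.prems(3,4)] Suc.prems(1) show ?case by (simp add: funpow_swap1)
qed simp

text \<open>The order of the distribution is at most \<open>l\<close>.\<close>

lemma distribution_T2: "distribution (T2 l)"
  unfolding distribution_def
proof (intro conjI allI impI)
  show "T2 l (\<lambda>x. \<phi> x + \<psi> x) = T2 l \<phi> + T2 l \<psi>" if "test_function \<phi> \<and> test_function \<psi>" for \<phi> \<psi>
    using that by (simp add: T2_eq_slice test_function_add slice_add distrib_left del: divide_minus_right)
  show "T2 l (\<lambda>x. c * \<phi> x) = c * T2 l \<phi>" if "test_function \<phi>" for c \<phi>
    using that by (simp add: T2_eq_slice test_function_cmult slice_cmult)
  fix K :: "(complex \<times> complex) set" assume K: "compact K"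
  define L where "L = fst ` K"
  have L: "compact L" unfolding L_def using K by (intro compact_continuous_image continuous_intros)
  define I where "I = integral\<^sup>L lborel (\<lambda>z. indicator L z *\<^sub>R norm (z ^ l :: complex))"
  have int: "integrable lborel (\<lambda>z. indicator L z *\<^sub>R norm (z ^ l :: complex))"
    by (intro borel_integrable_compact L continuous_intros)
  show "\<exists>N C. \<forall>\<phi> B. test_function \<phi> \<and> (\<forall>x. x \<notin> K \<longrightarrow> \<phi> x = 0) \<and>
        (\<forall>vs x. set vs \<subseteq> Basis \<and> length vs \<le> N \<longrightarrow> norm (fold dir_deriv vs \<phi> x) \<le> B)
        \<longrightarrow> norm (T2 l \<phi>) \<le> C * B"
  proof (intro exI allI impI)
    fix \<phi> B
    assume *: "test_function \<phi> \<and> (\<forall>x. x \<notin> K \<longrightarrow> \<phi> x = 0) \<and>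
        (\<forall>vs x. set vs \<subseteq> Basis \<and> length vs \<le> l \<longrightarrow> norm (fold dir_deriv vs \<phi> x) \<le> B)"
    have van: "\<forall>x. x \<notin> K \<longrightarrow> (wirt_z2 ^^ m) \<phi> x = 0" for m
      using * K by (induction m) (auto simp: wirt_z2_def intro: wirt_vanish compact_imp_closed)
    have bd: "norm ((wirt_z2 ^^ l) \<phi> x) \<le> B" for x
      using wirt_z2_iter_bound[of \<phi> 0 l B "[]" x] * by (auto simp: test_function_smooth)
    have "norm (z ^ l * (wirt_z2 ^^ l) \<phi> (z, 0)) \<le> B * (indicator L z *\<^sub>R norm (z ^ l))" for z
    proof (cases "z \<in> L")
      case True
      then show ?thesis using mult_right_mono[OF bd[of "(z, 0)"], of "norm (z ^ l)"]
        by (simp add: norm_mult mult.commute)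
    next
      case False
      then have "(z, 0) \<notin> K" by (force simp: L_def)
      then show ?thesis using van False by simp
    qed
    then have "norm (slice l l \<phi>) \<le> integral\<^sup>L lborel (\<lambda>z. B * (indicator L z *\<^sub>R norm (z ^ l :: complex)))"
      unfolding slice_def using int * by (intro Bochner_Integration.integral_norm_bound_integral slice_integrable) auto
    also have "\<dots> = B * I" unfolding I_def by simp
    finally have "norm (slice l l \<phi>) \<le> B * I" .
    moreover have "norm (T2 l \<phi>) = (1/2) * norm (slice l l \<phi>)"
      using * by (simp add: T2_eq_slice norm_mult norm_divide norm_power)
    ultimately show "norm (T2 l \<phi>) \<le> (I / 2) * B" by (simp add: mult.commute)
  qed
qed

section \<open>Differential operators acting on hyperfunctions\<close>

lemma hyperfunction_eqI: "hyp_eq u v \<Longrightarrow> abs_hyperfunction u = abs_hyperfunction v"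
  using Quotient_rel_abs[OF Quotient_hyperfunction] by blast

lemma act_abs: "hyp_rep u \<Longrightarrow> act P (abs_hyperfunction u) = abs_hyperfunction (\<lambda>k f. u k (apply_diffop (transpose_op P) f))"
  by (rule act.abs_eq) (simp add: hyp_eq_def analytic_functional_zero)

lemma hyp_rep_additive:
  assumes "hyp_eq u v" shows "u k (f + g) = u k f + u k g"
proof -
  have "analytic_functional UNIV (u k)" using assms by (simp add: hyp_eq_def hyp_rep_def)
  then obtain K where "carried_by (real_form ` K) (u k)" by (auto simp: analytic_functional_def)
  then show ?thesis by (simp add: carried_by_def)
qed

lemma act_plus: "act (P + Q) u = act P u + act Q u"
proof transfer
  fix P Q and u :: "nat \<Rightarrow> entire \<Rightarrow> complex" assume u: "hyp_eq u u"
  have "(\<lambda>k f. u k (apply_diffop (transpose_op (P + Q)) f)) =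
      (\<lambda>k f. u k (apply_diffop (transpose_op P) f) + u k (apply_diffop (transpose_op Q) f))"
    by (simp add: transpose_op_simps plus_diffop.rep_eq hyp_rep_additive[OF u])
  then show "hyp_eq (\<lambda>k f. u k (apply_diffop (transpose_op (P + Q)) f))
      (\<lambda>k f. u k (apply_diffop (transpose_op P) f) + u k (apply_diffop (transpose_op Q) f))"
    using hyp_eq_diffop[OF u, of "transpose_op (P + Q)"] by simp
qed

lemma act_times: "act (P * Q) u = act P (act Q u)"
proof transfer
  fix P Q and u :: "nat \<Rightarrow> entire \<Rightarrow> complex" assume "hyp_eq u u"
  from hyp_eq_diffop[OF this, of "transpose_op (P * Q)"]
  show "hyp_eq (\<lambda>k f. u k (apply_diffop (transpose_op (P * Q)) f))
      (\<lambda>k f. u k (apply_diffop (transpose_op Q) (apply_diffop (transpose_op P) f)))"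
    by (simp add: transpose_op_simps times_diffop.rep_eq)
qed

lemma act_add: "act P (u + v) = act P u + act P v"
  by transfer (drule (1) hyp_eq_add, drule hyp_eq_diffop, simp)

lemma act_one: "act 1 u = u"
  by transfer (simp add: transpose_op_simps(3)[of 1, unfolded const_op_simps] one_diffop.rep_eq)

lemma act_zero_right [simp]: "act P 0 = 0"
  using act_add[of P 0 0] by simp

lemma act_zero_left [simp]: "act 0 u = 0"
  using act_plus[of 0 0 u] by simp

lemma act_uminus: "act (- P) u = - act P u"
  using act_plus[of P "- P" u] by (simp add: eq_neg_iff_add_eq_0 add.commute)

lemma act_diff: "act (P - Q) u = act P u - act Q u"
  using act_plus[of P "- Q" u] by (simp add: act_uminus)

text \<open>An equation needs to be checked on generators only, because the annihilator of a hyperfunction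
  is a left ideal.\<close>

lemma left_ideal_annihilator: "left_ideal {P. act P u = 0}"
  by (simp add: left_ideal_def act_plus act_times)

lemma mem_solutions_left_ideal_gen:
  assumes "\<And>P. P \<in> S \<Longrightarrow> act P u = 0" shows "u \<in> solutions (left_ideal_gen S)"
  using assms left_ideal_annihilator[of u] by (auto simp: solutions_def left_ideal_gen_def)

section \<open>Solutions and homomorphisms from a cyclic module\<close>

lemma left_ideal_left_ideal_gen: "left_ideal (left_ideal_gen S)"
  unfolding left_ideal_def left_ideal_gen_def by blast

lemma coset_eq_iff:
  assumes "left_ideal (I :: 'a::ring_1 set)"
  shows "P +o I = Q +o I \<longleftrightarrow> P - Q \<in> I"
proof
  assume eq: "P +o I = Q +o I"
  have "P \<in> P +o I" using assms by (auto simp: elt_set_plus_def left_ideal_def)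
  then obtain R where "R \<in> I" "P = Q + R" unfolding eq by (auto simp: elt_set_plus_def)
  then show "P - Q \<in> I" by simp
next
  have sub: "A +o I \<subseteq> B +o I" if "A - B \<in> I" for A B
  proof
    fix X assume "X \<in> A +o I"
    then obtain R where "R \<in> I" "X = A + R" by (auto simp: elt_set_plus_def)
    moreover from this that assms have "(A - B) + R \<in> I" by (simp add: left_ideal_def)
    ultimately show "X \<in> B +o I" by (auto simp: elt_set_plus_def intro!: bexI[of _ "(A - B) + R"])
  qed
  assume PQ: "P - Q \<in> I"
  moreover have "Q - P \<in> I"
    using assms PQ unfolding left_ideal_def by (metis minus_diff_eq mult_minus1)
  ultimately show "P +o I = Q +o I" using sub by blast
qed

context
  fixes I :: "diffop set"
  assumes I: "left_ideal I"
begin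

text \<open>A homomorphism from a cyclic module is determined by the image of the generator.\<close>

lemma Hom_D_eq: "\<phi> \<in> Hom_D I \<Longrightarrow> \<phi> (P +o I) = act P (\<phi> (1 +o I))"
  unfolding Hom_D_def by (metis (mono_tags, lifting) mem_Collect_eq mult_1_right)

lemma Hom_D_solution:
  assumes "\<phi> \<in> Hom_D I" shows "\<phi> (1 +o I) \<in> solutions I"
proof -
  have "act P (\<phi> (1 +o I)) = 0" if "P \<in> I" for P
  proof -
    have "P +o I = 0 +o I" by (rule iffD2[OF coset_eq_iff[OF I]]) (use that in simp)
    then have "act P (\<phi> (1 +o I)) = act 0 (\<phi> (1 +o I))"
      using Hom_D_eq[OF assms, of P] Hom_D_eq[OF assms, of 0] by metis
    then show ?thesis by simp
  qed
  then show ?thesis by (simp add: solutions_def)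
qed

lemma coset_mem: "P +o I \<in> quotient_module I"
  by (simp add: quotient_module_def)

lemma Hom_D_of_solution:
  assumes u: "u \<in> solutions I"
  shows "\<exists>\<phi>\<in>Hom_D I. \<phi> (1 +o I) = u"
proof -
  define \<phi> where "\<phi> = (\<lambda>m\<in>quotient_module I. act (SOME P. P +o I = m) u)"
  have \<phi>: "\<phi> (P +o I) = act P u" for P
  proof -
    have "(SOME Q. Q +o I = P +o I) +o I = P +o I" by (rule someI[of "\<lambda>Q. Q +o I = P +o I" P]) simp
    then have "act ((SOME Q. Q +o I = P +o I) - P) u = 0"
      using u coset_eq_iff[OF I] by (simp add: solutions_def)
    then show ?thesis by (simp add: \<phi>_def coset_mem act_diff)
  qed
  have "\<phi> \<in> extensional (quotient_module I)" by (simp add: \<phi>_def)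
  then have "\<phi> \<in> Hom_D I" by (simp add: Hom_D_def \<phi> act_plus act_times)
  then show ?thesis using \<phi>[of 1] by (auto simp: act_one)
qed

lemma bij_betw_Hom_D: "bij_betw (\<lambda>\<phi>. \<phi> (1 +o I)) (Hom_D I) (solutions I)"
  unfolding bij_betw_def
proof
  show "inj_on (\<lambda>\<phi>. \<phi> (1 +o I)) (Hom_D I)"
  proof (rule inj_onI)
    fix \<phi> \<psi> assume *: "\<phi> \<in> Hom_D I" "\<psi> \<in> Hom_D I" "\<phi> (1 +o I) = \<psi> (1 +o I)"
    show "\<phi> = \<psi>"
    proof (rule extensionalityI)
      show "\<phi> \<in> extensional (quotient_module I)" "\<psi> \<in> extensional (quotient_module I)"
        using * by (simp_all add: Hom_D_def)
      show "\<phi> m = \<psi> m" if m: "m \<in> quotient_module I" for m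
      proof -
        obtain P where "m = P +o I" using m by (auto simp: quotient_module_def)
        then show ?thesis using Hom_D_eq[OF *(1), of P] Hom_D_eq[OF *(2), of P] *(3) by metis
      qed
    qed
  qed
  show "(\<lambda>\<phi>. \<phi> (1 +o I)) ` Hom_D I = solutions I"
    using Hom_D_solution Hom_D_of_solution by (auto simp: image_iff)
qed

lemma Hom_add_mem:
  assumes "\<phi> \<in> Hom_D I" "\<psi> \<in> Hom_D I"
  shows "Hom_add I \<phi> \<psi> \<in> Hom_D I" "Hom_add I \<phi> \<psi> (1 +o I) = \<phi> (1 +o I) + \<psi> (1 +o I)"
  using assms by (simp_all add: Hom_D_def Hom_add_def coset_mem act_add)

lemma Hom_scale_mem:
  assumes "\<phi> \<in> Hom_D I"
  shows "Hom_scale I c \<phi> \<in> Hom_D I" "Hom_scale I c \<phi> (1 +o I) = act (const_op c) (\<phi> (1 +o I))"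
proof -
  have "act (const_op c) (act P u) = act P (act (const_op c) u)" for P u
    by (simp add: const_op_commute flip: act_times)
  then show "Hom_scale I c \<phi> \<in> Hom_D I" "Hom_scale I c \<phi> (1 +o I) = act (const_op c) (\<phi> (1 +o I))"
    using assms by (simp_all add: Hom_D_def Hom_scale_def coset_mem act_add)
qed

end

section \<open>Hyperfunctions of local functionals\<close>

text \<open>The functionals whose cut-offs are analytic functionals carried by the support of the
  cut-off. This locality is what makes the pieces on the different balls compatible.\<close>

definition local_functional :: "dist_functional \<Rightarrow> bool" where
  "local_functional T \<longleftrightarrow>
     (\<forall>\<phi> \<psi>. test_function \<phi> \<and> test_function \<psi> \<longrightarrow> T (\<lambda>x. \<phi> x + \<psi> x) = T \<phi> + T \<psi>) \<and>
     (\<forall>c \<phi>. test_function \<phi> \<longrightarrow> T (\<lambda>x. c * \<phi> x) = c * T \<phi>) \<and>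
     (\<forall>\<eta> K. test_function \<eta> \<and> compact K \<and> (\<forall>x. x \<notin> K \<longrightarrow> \<eta> x = 0) \<longrightarrow>
        carried_by (real_form ` K) (\<lambda>f. T (\<lambda>p. \<eta> p * restr f p)))"

lemma local_functional_add:
  "local_functional T \<Longrightarrow> test_function \<phi> \<Longrightarrow> test_function \<psi> \<Longrightarrow> T (\<lambda>x. \<phi> x + \<psi> x) = T \<phi> + T \<psi>"
  by (simp add: local_functional_def)

lemma local_functional_cmult:
  "local_functional T \<Longrightarrow> test_function \<phi> \<Longrightarrow> T (\<lambda>x. c * \<phi> x) = c * T \<phi>"
  by (simp add: local_functional_def)

lemma local_functional_uminus:
  "local_functional T \<Longrightarrow> test_function \<phi> \<Longrightarrow> T (\<lambda>x. - \<phi> x) = - T \<phi>"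
  using local_functional_cmult[of T \<phi> "-1"] by simp

lemma local_functional_carried:
  "local_functional T \<Longrightarrow> test_function \<eta> \<Longrightarrow> compact K \<Longrightarrow> (\<And>x. x \<notin> K \<Longrightarrow> \<eta> x = 0) \<Longrightarrow>
    carried_by (real_form ` K) (\<lambda>f. T (\<lambda>p. \<eta> p * restr f p))"
  by (simp add: local_functional_def)

lemma test_cutoff: "test_function (cutoff k)"
  and cutoff_neighbourhood: "\<exists>U. open U \<and> cball 0 (real k) \<subseteq> U \<and> (\<forall>p\<in>U. cutoff k p = 1)"
proof -
  have "test_function (cutoff k) \<and> (\<exists>U. open U \<and> cball 0 (real k) \<subseteq> U \<and> (\<forall>p\<in>U. cutoff k p = 1))"
    unfolding cutoff_def by (rule someI_ex[OF cutoff_exists]) simp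
  then show "test_function (cutoff k)" "\<exists>U. open U \<and> cball 0 (real k) \<subseteq> U \<and> (\<forall>p\<in>U. cutoff k p = 1)"
    by simp_all
qed

lemma test_restr: "test_function \<eta> \<Longrightarrow> test_function (\<lambda>p. \<eta> p * restr f p)"
  by (intro test_function_mult smooth_restr)

text \<open>The support of \<open>\<eta>\<close> may meet the boundary of the ball, but not \<open>U\<close>. Removing \<open>U\<close> from a compact set
  outside of which \<open>\<eta>\<close> vanishes leaves a compact carrier.\<close>

lemma analytic_functional_outside:
  assumes T: "local_functional T" and \<eta>: "test_function \<eta>" and U: "open U" "ball 0 r \<subseteq> U" "\<And>p. p \<in> U \<Longrightarrow> \<eta> p = 0"
  shows "analytic_functional (- ball 0 r) (\<lambda>f. T (\<lambda>p. \<eta> p * restr f p))"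
proof -
  obtain K where K: "compact K" "\<And>x. x \<notin> K \<Longrightarrow> \<eta> x = 0" using test_function_support[OF \<eta>] by metis
  have "compact (K - U)" using K(1) U(1) by (rule compact_diff)
  moreover have "\<forall>x. x \<notin> K - U \<longrightarrow> \<eta> x = 0" using K(2) U(3) by blast
  ultimately have "carried_by (real_form ` (K - U)) (\<lambda>f. T (\<lambda>p. \<eta> p * restr f p))"
    by (intro local_functional_carried[OF T \<eta>]) auto
  then show ?thesis
    unfolding analytic_functional_def using \<open>compact (K - U)\<close> U(2) by (intro exI[of _ "K - U"]) auto
qed

lemma hyp_rep_cutoff:
  assumes T: "local_functional T"
  shows "hyp_rep (\<lambda>k f. T (\<lambda>p. cutoff k p * restr f p))"
  unfolding hyp_rep_def
proof (intro conjI allI)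
  fix k
  obtain K where "compact K" "\<And>x. x \<notin> K \<Longrightarrow> cutoff k x = 0"
    using test_function_support[OF test_cutoff] by metis
  then show "analytic_functional UNIV (\<lambda>f. T (\<lambda>p. cutoff k p * restr f p))"
    unfolding analytic_functional_def using local_functional_carried[OF T test_cutoff] by (intro exI[of _ K]) simp
next
  fix k
  obtain U where U: "open U" "cball 0 (real k) \<subseteq> U" "\<And>p. p \<in> U \<Longrightarrow> cutoff k p = 1"
    using cutoff_neighbourhood[of k] by metis
  obtain V where V: "open V" "cball 0 (real (Suc k)) \<subseteq> V" "\<And>p. p \<in> V \<Longrightarrow> cutoff (Suc k) p = 1"
    using cutoff_neighbourhood[of "Suc k"] by metis
  define \<eta> where "\<eta> p = cutoff (Suc k) p + (-1) * cutoff k p" for p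
  have \<eta>: "test_function \<eta>"
    unfolding \<eta>_def by (intro test_function_add test_function_cmult test_cutoff)
  have "analytic_functional (- ball 0 (real k)) (\<lambda>f. T (\<lambda>p. \<eta> p * restr f p))"
  proof (rule analytic_functional_outside[OF T \<eta>, of "U \<inter> V"])
    \<comment> \<open>Both cut-offs are 1 near the smaller ball.\<close>
    show "ball 0 (real k) \<subseteq> U \<inter> V" using U(2) V(2) by force
  qed (use U V in \<open>auto simp: \<eta>_def\<close>)
  moreover have "T (\<lambda>p. \<eta> p * restr f p) = T (\<lambda>p. cutoff (Suc k) p * restr f p) - T (\<lambda>p. cutoff k p * restr f p)" for f
  proof -
    have t: "test_function (\<lambda>p. - (cutoff k p * restr f p))"
      using test_function_cmult[OF test_restr[OF test_cutoff], of "-1"] by simp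
    have "T (\<lambda>p. \<eta> p * restr f p) = T (\<lambda>p. cutoff (Suc k) p * restr f p + - (cutoff k p * restr f p))"
      by (simp add: \<eta>_def algebra_simps)
    also have "\<dots> = T (\<lambda>p. cutoff (Suc k) p * restr f p) + T (\<lambda>p. - (cutoff k p * restr f p))"
      by (intro local_functional_add[OF T] test_restr test_cutoff t)
    also have "T (\<lambda>p. - (cutoff k p * restr f p)) = - T (\<lambda>p. cutoff k p * restr f p)"
      by (intro local_functional_uminus[OF T] test_restr test_cutoff)
    finally show ?thesis by simp
  qed
  ultimately show "analytic_functional (- ball 0 (real k))
      (\<lambda>f. T (\<lambda>p. cutoff (Suc k) p * restr f p) - T (\<lambda>p. cutoff k p * restr f p))" by simp
qed

lemma hyp_of_distribution_cong:
  "(\<And>\<phi>. test_function \<phi> \<Longrightarrow> S \<phi> = T \<phi>) \<Longrightarrow> hyp_of_distribution S = hyp_of_distribution T"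
  unfolding hyp_of_distribution_def by (simp add: test_restr test_cutoff)

text \<open>Multiplication operators commute with the cut-off, so the two representing sequences are equal.\<close>

lemma act_mult_op:
  assumes T: "local_functional T" and S: "\<And>\<phi>. test_function \<phi> \<Longrightarrow> S \<phi> = T (\<lambda>p. \<phi> p * restr a p)"
    and P: "\<And>f. apply_diffop (transpose_op P) f = a * f"
  shows "act P (hyp_of_distribution T) = hyp_of_distribution S"
proof -
  have "T (\<lambda>p. cutoff k p * restr (a * f) p) = S (\<lambda>p. cutoff k p * restr f p)" for k f
    by (simp add: S test_restr test_cutoff eval_entire_simps mult_ac)
  then show ?thesis
    unfolding hyp_of_distribution_def act_abs[OF hyp_rep_cutoff[OF T]] by (simp add: P)
qed

text \<open>When a derivative is moved from the entire function to its product with the cut-off, the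
  error contains a derivative of the cut-off and is therefore carried outside the ball.\<close>

lemma act_d_op:
  assumes T: "local_functional T" and S: "local_functional S"
    and ST: "\<And>\<phi>. test_function \<phi> \<Longrightarrow> S \<phi> = - T (wirt c v w \<phi>)"
    and restr: "\<And>f. wirt c v w (restr f) = restr (pderiv_entire i f)"
  shows "act (d_op i) (hyp_of_distribution T) = hyp_of_distribution S"
proof -
  let ?u = "\<lambda>k f. T (\<lambda>p. cutoff k p * restr f p)"
  let ?v = "\<lambda>k f. S (\<lambda>p. cutoff k p * restr f p)"
  let ?u' = "\<lambda>k f. ?u k (apply_diffop (transpose_op (d_op i)) f)"
  have "hyp_eq ?u ?u" using hyp_rep_cutoff[OF T] by (simp add: hyp_eq_def analytic_functional_zero)
  then have u': "hyp_rep ?u'" using hyp_eq_diffop[of ?u ?u] by (simp add: hyp_eq_def)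
  have diff: "analytic_functional (- ball 0 (real k)) (\<lambda>f. ?u' k f - ?v k f)" for k
  proof -
    obtain U where U: "open U" "cball 0 (real k) \<subseteq> U" "\<And>p. p \<in> U \<Longrightarrow> cutoff k p = 1"
      using cutoff_neighbourhood[of k] by metis
    have t: "test_function (wirt c v w (cutoff k))" by (intro test_function_wirt test_cutoff)
    have 0: "wirt c v w (cutoff k) p = 0" if "p \<in> U" for p
    proof -
      \<comment> \<open>Subtracting 1 makes the cut-off vanish on \<open>U\<close> without changing its derivatives.\<close>
      have "wirt c v w (\<lambda>p. cutoff k p + (-1)) p = 0"
        by (rule wirt_vanish[of "- U"]) (use U that in auto)
      then show ?thesis
        unfolding wirt_add[OF test_function_smooth[OF test_cutoff] smooth_const] wirt_const by simp
    qed
    have "?u' k f - ?v k f = T (\<lambda>p. wirt c v w (cutoff k) p * restr f p)" for f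
    proof -
      have "wirt c v w (\<lambda>p. cutoff k p * restr f p) =
          (\<lambda>p. wirt c v w (cutoff k) p * restr f p + cutoff k p * restr (pderiv_entire i f) p)"
        using wirt_mult[OF test_function_smooth[OF test_cutoff] smooth_restr[of f]] by (simp add: restr)
      then have "?v k f = - (T (\<lambda>p. wirt c v w (cutoff k) p * restr f p)
          + T (\<lambda>p. cutoff k p * restr (pderiv_entire i f) p))"
        using local_functional_add[OF T test_restr[OF t] test_restr[OF test_cutoff]] by (simp add: ST test_restr test_cutoff)
      moreover have "?u' k f = - T (\<lambda>p. cutoff k p * restr (pderiv_entire i f) p)"
        using local_functional_uminus[OF T test_restr[OF test_cutoff]]
        by (simp add: transpose_op_simps uminus_diffop.rep_eq d_op.rep_eq eval_entire_simps)
      ultimately show ?thesis by simp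
    qed
    moreover have "analytic_functional (- ball 0 (real k)) (\<lambda>f. T (\<lambda>p. wirt c v w (cutoff k) p * restr f p))"
      by (rule analytic_functional_outside[OF T t U(1) _ 0]) (use U(2) in \<open>auto intro: order_trans[OF ball_subset_cball]\<close>)
    ultimately show ?thesis by simp
  qed
  have "hyp_eq ?u' ?v"
    unfolding hyp_eq_def using u' hyp_rep_cutoff[OF S] diff by blast
  then show ?thesis
    unfolding hyp_of_distribution_def act_abs[OF hyp_rep_cutoff[OF T]] by (rule hyperfunction_eqI)
qed

section \<open>Multiples of derivatives of the delta distribution\<close>

text \<open>Without derivatives the functional is a measure on the slice. A derivative falls either on
  \<open>\<eta>\<close>, which does not enlarge the support, or on the entire function, where Cauchy's estimate
  preserves the carrier.\<close>

lemma carried_by_slice: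
  assumes "test_function \<eta>" "compact K" "\<And>x. x \<notin> K \<Longrightarrow> \<eta> x = 0"
  shows "carried_by (real_form ` K) (\<lambda>f. slice j m (\<lambda>p. \<eta> p * restr f p))"
  using assms
proof (induction m arbitrary: \<eta>)
  case 0
  show ?case
    unfolding carried_by_def
  proof (intro conjI allI impI)
    show "slice j 0 (\<lambda>p. \<eta> p * restr (f + g) p) = slice j 0 (\<lambda>p. \<eta> p * restr f p) + slice j 0 (\<lambda>p. \<eta> p * restr g p)" for f g
      using slice_add[OF test_restr test_restr, of \<eta> \<eta> j 0 f g] 0 by (simp add: eval_entire_simps distrib_left)
    show "slice j 0 (\<lambda>p. \<eta> p * restr (const_entire c * f) p) = c * slice j 0 (\<lambda>p. \<eta> p * restr f p)" for c f
      using slice_cmult[OF test_restr, of \<eta> j 0 c f] 0 by (simp add: eval_entire_simps mult.left_commute)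
    fix \<omega> :: "(complex^4) set" assume w: "open \<omega> \<and> real_form ` K \<subseteq> \<omega>"
    define C where "C = integral\<^sup>L lborel (\<lambda>z. norm (z ^ j * \<eta> (z, 0)))"
    have int: "integrable lborel (\<lambda>z. norm (z ^ j * \<eta> (z, 0)))"
      using slice_integrable[of \<eta> j 0] 0 by (intro integrable_norm) simp
    show "\<exists>C. \<forall>f B. 0 \<le> B \<and> (\<forall>z\<in>\<omega>. norm (eval_entire f z) \<le> B) \<longrightarrow>
        norm (slice j 0 (\<lambda>p. \<eta> p * restr f p)) \<le> C * B"
    proof (intro exI allI impI)
      fix f B assume B: "0 \<le> B \<and> (\<forall>z\<in>\<omega>. norm (eval_entire f z) \<le> B)"
      have "norm (z ^ j * (\<eta> (z, 0) * restr f (z, 0))) \<le> norm (z ^ j * \<eta> (z, 0)) * B" for z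
      proof (cases "(z, 0) \<in> K")
        case True
        then have "norm (restr f (z, 0)) \<le> B" using w B by blast
        then show ?thesis unfolding norm_mult mult.assoc[symmetric] by (intro mult_left_mono) auto
      qed (use 0 in simp)
      then have "norm (slice j 0 (\<lambda>p. \<eta> p * restr f p)) \<le> integral\<^sup>L lborel (\<lambda>z. norm (z ^ j * \<eta> (z, 0)) * B)"
        unfolding slice_def using slice_integrable[OF test_restr[OF 0(1)], of j 0 f] int
        by (intro Bochner_Integration.integral_norm_bound_integral) auto
      then show "norm (slice j 0 (\<lambda>p. \<eta> p * restr f p)) \<le> C * B" by (simp add: C_def)
    qed
  qed
next
  case (Suc m)
  have K: "compact (real_form ` K)" using Suc.prems(2) by (rule compact_real_form)
  have t: "test_function (wirt_z2 \<eta>)" using Suc.prems(1) by simp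
  have "carried_by (real_form ` K) (\<lambda>f. slice j m (\<lambda>p. wirt_z2 \<eta> p * restr f p))"
    using Suc.prems t by (intro Suc.IH) (auto simp: wirt_z2_def intro: wirt_vanish compact_imp_closed)
  moreover have "carried_by (real_form ` K) (\<lambda>f. slice j m (\<lambda>p. \<eta> p * restr (pderiv_entire 2 f) p))"
    using carried_by_pderiv[OF Suc.IH[OF Suc.prems] K] .
  ultimately have "carried_by (real_form ` K) (\<lambda>f. slice j m (\<lambda>p. wirt_z2 \<eta> p * restr f p)
      + slice j m (\<lambda>p. \<eta> p * restr (pderiv_entire 2 f) p))"
    by (rule carried_by_add)
  moreover have "slice j (Suc m) (\<lambda>p. \<eta> p * restr f p) = slice j m (\<lambda>p. wirt_z2 \<eta> p * restr f p)
      + slice j m (\<lambda>p. \<eta> p * restr (pderiv_entire 2 f) p)" for f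
  proof -
    have "wirt_z2 (\<lambda>p. \<eta> p * restr f p) = (\<lambda>p. wirt_z2 \<eta> p * restr f p + \<eta> p * restr (pderiv_entire 2 f) p)"
      using wirt_mult[OF test_function_smooth[OF Suc.prems(1)] smooth_restr[of f]] wirt_restr(2)[of f]
      by (simp add: wirt_z2_def)
    then show ?thesis
      using slice_wirt_z2[of j m "\<lambda>p. \<eta> p * restr f p"] slice_add[OF test_restr[OF t] test_restr[OF Suc.prems(1)], of j m f "pderiv_entire 2 f"]
      by simp
  qed
  ultimately show ?case by simp
qed

lemma local_functional_slice: "local_functional (\<lambda>\<phi>. c * slice j m \<phi>)"
  unfolding local_functional_def
proof (intro conjI allI impI)
  fix \<eta> and K :: "(complex \<times> complex) set"
  assume "test_function \<eta> \<and> compact K \<and> (\<forall>x. x \<notin> K \<longrightarrow> \<eta> x = 0)"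
  then have *: "carried_by (real_form ` K) (\<lambda>f. slice j m (\<lambda>p. \<eta> p * restr f p))" "compact (real_form ` K)"
    by (auto intro: carried_by_slice compact_real_form)
  have "carried_by (real_form ` K) (\<lambda>f. slice j m (\<lambda>p. \<eta> p * restr (const_entire c * f) p))"
    using carried_by_diff_ops[OF diff_ops.const *] .
  moreover have "slice j m (\<lambda>p. \<eta> p * restr (const_entire c * f) p) = c * slice j m (\<lambda>p. \<eta> p * restr f p)" for f
    using *(1) by (simp add: carried_by_def)
  ultimately show "carried_by (real_form ` K) (\<lambda>f. c * slice j m (\<lambda>p. \<eta> p * restr f p))" by simp
qed (simp_all add: slice_add slice_cmult distrib_left)

definition slice_hyp :: "complex \<Rightarrow> nat \<Rightarrow> nat \<Rightarrow> hyperfunction" where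
  "slice_hyp c j m = hyp_of_distribution (\<lambda>\<phi>. c * slice j m \<phi>)"

lemma slice_hyp_0 [simp]: "slice_hyp 0 j m = 0"
  by (simp add: slice_hyp_def hyp_of_distribution_def zero_hyperfunction_def)

lemma slice_hyp_add: "slice_hyp a j m + slice_hyp b j m = slice_hyp (a + b) j m"
proof -
  have "hyp_eq u u" if "hyp_rep u" for u using that by (simp add: hyp_eq_def analytic_functional_zero)
  then show ?thesis
    unfolding slice_hyp_def hyp_of_distribution_def
    by (subst plus_hyperfunction.abs_eq) (auto simp: distrib_right intro: hyp_rep_cutoff local_functional_slice)
qed

lemma slice_hyp_diff: "slice_hyp a j m - slice_hyp b j m = slice_hyp (a - b) j m"
  unfolding diff_eq_eq by (simp add: slice_hyp_add)

lemma slice_hyp_uminus: "- slice_hyp a j m = slice_hyp (- a) j m"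
  using slice_hyp_diff[of 0 j m a] by simp

lemma act_const_slice: "act (const_op a) (slice_hyp c j m) = slice_hyp (a * c) j m"
  unfolding slice_hyp_def
proof (rule act_mult_op[OF local_functional_slice, where a = "const_entire a"])
  show "a * c * slice j m \<phi> = c * slice j m (\<lambda>p. \<phi> p * restr (const_entire a) p)" if "test_function \<phi>" for \<phi>
    using slice_cmult[OF that, of j m a] by (simp add: eval_entire_simps mult_ac)
qed (simp add: transpose_op_simps const_op.rep_eq)

lemma act_z_slice:
  "act (z_op 1) (slice_hyp c j m) = slice_hyp c (Suc j) m"
  "act (z_op 2) (slice_hyp c j m) = slice_hyp (of_nat m * c) j (m - 1)"
  "act (z_op 4) (slice_hyp c j m) = 0"
proof -
  have P: "apply_diffop (transpose_op (z_op i)) f = coord_entire i * f" for i f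
    by (simp add: transpose_op_simps z_op.rep_eq)
  show "act (z_op 1) (slice_hyp c j m) = slice_hyp c (Suc j) m"
    unfolding slice_hyp_def by (rule act_mult_op[OF local_functional_slice _ P]) (simp only: slice_z1)
  show "act (z_op 2) (slice_hyp c j m) = slice_hyp (of_nat m * c) j (m - 1)"
    unfolding slice_hyp_def by (rule act_mult_op[OF local_functional_slice _ P]) (simp only: slice_z2 mult_ac)
  have "act (z_op 4) (slice_hyp c j m) = slice_hyp 0 j m"
    unfolding slice_hyp_def by (rule act_mult_op[OF local_functional_slice _ P]) (simp only: slice_z4 mult_zero_left mult_zero_right)
  then show "act (z_op 4) (slice_hyp c j m) = 0" by simp
qed

lemma act_d_slice:
  "act (d_op 1) (slice_hyp c j m) = slice_hyp (of_nat j * c) (j - 1) m"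
  "act (d_op 2) (slice_hyp c j m) = slice_hyp (- c) j (Suc m)"
  "act (d_op 3) (slice_hyp c j m) = 0"
proof -
  show "act (d_op 1) (slice_hyp c j m) = slice_hyp (of_nat j * c) (j - 1) m"
    unfolding slice_hyp_def
    by (rule act_d_op[OF local_functional_slice local_functional_slice _ wirt_restr(1)[unfolded wirt_z1_def]])
       (simp add: slice_wirt_z1[unfolded wirt_z1_def])
  show "act (d_op 2) (slice_hyp c j m) = slice_hyp (- c) j (Suc m)"
    unfolding slice_hyp_def
    by (rule act_d_op[OF local_functional_slice local_functional_slice _ wirt_restr(2)[unfolded wirt_z2_def]])
       (simp add: slice_wirt_z2[unfolded wirt_z2_def])
  have "act (d_op 3) (slice_hyp c j m) = slice_hyp 0 j m"
    unfolding slice_hyp_def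
    by (rule act_d_op[OF local_functional_slice local_functional_slice _ wirt_restr(3)[unfolded wirt_cz1_def]])
       (simp add: slice_wirt_cz1[unfolded wirt_cz1_def])
  then show "act (d_op 3) (slice_hyp c j m) = 0" by simp
qed

text \<open>Each derivative lowers the exponent of \<open>z1\<close> by one; at exponent 0 the coefficient becomes 0.\<close>

lemma act_d_power_slice: "j < n \<Longrightarrow> act (d_op 1 ^ n) (slice_hyp c j m) = 0"
proof (induction n arbitrary: c j)
  case (Suc n)
  have "act (d_op 1 ^ Suc n) (slice_hyp c j m) = act (d_op 1 ^ n) (slice_hyp (of_nat j * c) (j - 1) m)"
    by (simp only: power_Suc2 act_times act_d_slice)
  also have "\<dots> = 0" using Suc by (cases j) auto
  finally show ?case .
qed simp

lemma act_z_power_slice: "m < n \<Longrightarrow> act (z_op 2 ^ n) (slice_hyp c j m) = 0"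
proof (induction n arbitrary: c m)
  case (Suc n)
  have "act (z_op 2 ^ Suc n) (slice_hyp c j m) = act (z_op 2 ^ n) (slice_hyp (of_nat m * c) j (m - 1))"
    by (simp only: power_Suc2 act_times act_z_slice)
  also have "\<dots> = 0" using Suc by (cases m) auto
  finally show ?case .
qed simp

text \<open>The functions in the family are homogeneous. The last identity expresses that the family is
  killed by \<open>z4\<close>: commuting \<open>z4\<close> to the right leaves only the commutator.\<close>

lemma act_euler_slice:
  "act (z_op 1 * d_op 1) (slice_hyp c j m) = slice_hyp (of_nat j * c) j m"
  "act (z_op 2 * d_op 2) (slice_hyp c j m) = slice_hyp (- of_nat (Suc m) * c) j m"
  "act (z_op 4 * d_op 4) (slice_hyp c j m) = slice_hyp (- c) j m"
proof -
  show "act (z_op 1 * d_op 1) (slice_hyp c j m) = slice_hyp (of_nat j * c) j m"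
    by (cases j) (simp_all add: act_times act_d_slice act_z_slice)
  show "act (z_op 2 * d_op 2) (slice_hyp c j m) = slice_hyp (- of_nat (Suc m) * c) j m"
    by (simp add: act_times act_d_slice act_z_slice del: of_nat_Suc)
  have "z_op 4 * d_op 4 = d_op 4 * z_op 4 - 1" by (simp add: d_op_z_op)
  then show "act (z_op 4 * d_op 4) (slice_hyp c j m) = slice_hyp (- c) j m"
    by (simp add: act_diff act_times act_z_slice act_one slice_hyp_uminus)
qed

lemma slice_hyp_solution: "slice_hyp c l l \<in> solutions (ideal_I1 l)"
proof -
  have "act (z_op 1 * d_op 1 - of_nat l) (slice_hyp c l l) = 0"
    by (simp add: act_diff act_euler_slice of_nat_diffop act_const_slice)
  moreover have "act (z_op 2 * d_op 2 + of_nat l + 1) (slice_hyp c l l) = 0"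
    by (simp add: act_plus act_one act_euler_slice of_nat_diffop act_const_slice slice_hyp_add algebra_simps)
  ultimately show ?thesis
    unfolding ideal_I1_def
    by (intro mem_solutions_left_ideal_gen)
       (auto simp del: power_Suc simp: act_d_power_slice act_z_power_slice act_d_slice act_z_slice)
qed

section \<open>Relative invariance\<close>

lemma cspan_vanish:
  assumes "A \<in> cspan S" "\<And>B. B \<in> S \<Longrightarrow> B $ i $ j = 0" shows "A $ i $ j = 0"
proof -
  obtain F c where "F \<subseteq> S" "A = (\<Sum>A\<in>F. mscale (c A) A)" using assms(1) by (auto simp: cspan_def)
  then show ?thesis using assms(2) by (auto simp: mscale_def sum_component intro!: sum.neutral)
qed

lemma cspan_diag_eq:
  assumes "A \<in> cspan S" "\<And>B. B \<in> S \<Longrightarrow> B $ i $ i = B $ j $ j" shows "A $ i $ i = A $ j $ j"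
proof -
  obtain F c where "F \<subseteq> S" "A = (\<Sum>A\<in>F. mscale (c A) A)" using assms(1) by (auto simp: cspan_def)
  then show ?thesis using assms(2) by (auto simp: mscale_def sum_component intro!: sum.cong)
qed

text \<open>The vanishing of the entries outside the pattern of \<open>h1\<close>, as a condition that \<open>h1\<close> and \<open>h3\<close> can
  share.\<close>

definition h1_shape :: "complex^4^4 \<Rightarrow> bool" where
  "h1_shape A \<longleftrightarrow> A $ 1 $ 2 = 0 \<and> A $ 1 $ 3 = 0 \<and> A $ 2 $ 1 = 0 \<and> A $ 2 $ 3 = 0 \<and>
     A $ 4 $ 1 = 0 \<and> A $ 4 $ 2 = 0 \<and> A $ 4 $ 3 = 0"

lemma h1_shape_h1: "A \<in> h1 \<Longrightarrow> h1_shape A"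
proof -
  assume "A \<in> h1"
  then obtain B C where B: "B \<in> lie_a" and C: "C \<in> lie_n" and A: "A = B + C"
    unfolding h1_def by (rule set_plus_elim)
  have "h1_shape B" unfolding h1_shape_def
    by (intro conjI; rule cspan_vanish[OF B[unfolded lie_a_def]]; auto simp: E_def)
  moreover have "h1_shape C" unfolding h1_shape_def
    by (intro conjI; rule cspan_vanish[OF C[unfolded lie_n_def]]; auto simp: E_def)
  ultimately show "h1_shape A" by (simp add: A h1_shape_def)
qed

lemma h1_shape_h3: "A \<in> h3 \<Longrightarrow> h1_shape A"
  unfolding h1_shape_def h3_def
  by (intro conjI; erule cspan_vanish; auto simp: E_def)

lemma chi_h3: "A \<in> h3 \<Longrightarrow> chi l A = chi3 A"
proof -
  assume "A \<in> h3"
  then have "A $ 1 $ 1 = A $ 2 $ 2"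
    unfolding h3_def by (rule cspan_diag_eq) (auto simp: E_def)
  then show ?thesis by (simp add: chi_def chi3_def algebra_simps)
qed

text \<open>Of the nine remaining matrix entries, the diagonal ones act by the Euler operators, that is, by
  scalars that add up to the character, while the others involve \<open>z4\<close> or \<open>\<partial>/\<partial>z3\<close> and act by 0.\<close>

lemma slice_hyp_relatively_invariant:
  assumes "h1_shape A"
  shows "act (rho A - const_op (chi l A)) (slice_hyp c l l) = 0"
proof -
  have mixed: "act (z_op 4 * d_op 1) (slice_hyp c l l) = 0" "act (z_op 4 * d_op 2) (slice_hyp c l l) = 0"
    "act (z_op j * d_op 3) (slice_hyp c l l) = 0" for j
    by (simp_all add: act_times act_d_slice act_z_slice)
  have rho: "act (rho A) (slice_hyp c l l) = slice_hyp (chi l A * c) l l"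
    using assms unfolding rho_def sum_4 h1_shape_def
    by (simp add: act_plus act_diff act_uminus const_op_simps act_times[of "const_op _"] mixed act_euler_slice
        slice_hyp_uminus slice_hyp_diff slice_hyp_add act_const_slice, simp add: chi_def algebra_simps)
  show ?thesis by (simp add: act_diff rho act_const_slice)
qed

text \<open>The constant collects the signs of the \<open>l\<close> integrations by parts and the normalisation of the
  Dirac distribution.\<close>

lemma hyp_of_distribution_T2: "hyp_of_distribution (T2 l) = slice_hyp ((-1) ^ l / (- 2 * \<i>)) l l"
  unfolding slice_hyp_def by (rule hyp_of_distribution_cong) (rule T2_eq_slice)

theorem proposition9:
  fixes l :: nat
  shows "distribution (T2 l)
    \<and> eq_distribution (T2 l) (((\<lambda>T. dist_mult fst (dist_d2 T)) ^^ l) delta_z2)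
    \<and> hyp_of_distribution (T2 l) \<in> solutions (ideal_I1 l)
    \<and> bij_betw (\<lambda>\<phi>. \<phi> (1 +o ideal_I1 l)) (Hom_D (ideal_I1 l)) (solutions (ideal_I1 l))
    \<and> (\<forall>\<phi>\<in>Hom_D (ideal_I1 l). \<forall>\<psi>\<in>Hom_D (ideal_I1 l).
          Hom_add (ideal_I1 l) \<phi> \<psi> \<in> Hom_D (ideal_I1 l)
          \<and> Hom_add (ideal_I1 l) \<phi> \<psi> (1 +o ideal_I1 l)
              = \<phi> (1 +o ideal_I1 l) + \<psi> (1 +o ideal_I1 l))
    \<and> (\<forall>c. \<forall>\<phi>\<in>Hom_D (ideal_I1 l).
          Hom_scale (ideal_I1 l) c \<phi> \<in> Hom_D (ideal_I1 l)
          \<and> Hom_scale (ideal_I1 l) c \<phi> (1 +o ideal_I1 l)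
              = act (const_op c) (\<phi> (1 +o ideal_I1 l)))
    \<and> (\<forall>A\<in>h1. act (rho A - const_op (chi l A)) (hyp_of_distribution (T2 l)) = 0)
    \<and> (\<forall>A\<in>h3. chi l A = chi3 A)
    \<and> (\<forall>A\<in>h3. act (rho A - const_op (chi3 A)) (hyp_of_distribution (T2 l)) = 0)"
proof -
  have I: "left_ideal (ideal_I1 l)" unfolding ideal_I1_def by (rule left_ideal_left_ideal_gen)
  have "\<forall>A\<in>h3. act (rho A - const_op (chi3 A)) (hyp_of_distribution (T2 l)) = 0"
    by (metis chi_h3 h1_shape_h3 hyp_of_distribution_T2 slice_hyp_relatively_invariant)
  then show ?thesis
    using Hom_add_mem[OF I] Hom_scale_mem[OF I]
    by (intro conjI distribution_T2 T2_eq_iterated bij_betw_Hom_D[OF I] ballI allI)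
       (simp_all add: hyp_of_distribution_T2 slice_hyp_solution slice_hyp_relatively_invariant h1_shape_h1 chi_h3)
qed

end
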